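(* Let $k$ be a field of characteristic zero, let $d$ be a positive integer, let $L \in R = k[x_1,\ldots,x_7]$ be a general linear form, and let $I = \langle x_1^{d}, \ldots, x_7^{d}, L^{d} \rangle$. If $d = 2$, then the ring $R/I$ has the WLP. If $d \ge 4$, then $R/I$ fails the WLP.
   Context: "General linear form" means that the assertion holds for all linear forms whose coefficient vector lies in some nonempty Zariski-open subset of the space of linear forms $[R]_1$. A standard graded artinian $k$-algebra $A = R/I$ has the Weak Lefschetz Property (WLP) if, for a general linear form $\ell \in R$, the multiplication map $\times \ell : [A]_{t} \to [A]_{t+1}$ has maximal rank (i.e. is injective or surjective) for every integer $t$; otherwise $A$ fails the WLP. *)

theory Defs
  imports
    Complex_Main
    "HOL-Library.Poly_Mapping"
    "HOL-Library.Set_Algebras"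
    "HOL-Library.Numeral_Type"
begin

text \<open>
  The polynomial ring \<open>k[x\<^sub>i | i \<in> UNIV :: 'n set]\<close> is the monoid algebra of the exponent
  vectors \<open>'n \<Rightarrow>\<^sub>0 nat\<close>; its commutative ring structure is the one of
  \<^theory>\<open>HOL-Library.Poly_Mapping\<close>.
\<close>

type_synonym ('n, 'k) mpoly = "('n \<Rightarrow>\<^sub>0 nat) \<Rightarrow>\<^sub>0 'k"

definition Const :: "'k::field \<Rightarrow> ('n::finite, 'k) mpoly" where
  "Const c = Poly_Mapping.single 0 c"

definition Var :: "'n::finite \<Rightarrow> ('n, 'k::field) mpoly" where
  "Var i = Poly_Mapping.single (Poly_Mapping.single i 1) 1"

definition mdegree :: "('n::finite \<Rightarrow>\<^sub>0 nat) \<Rightarrow> nat" where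
  "mdegree m = (\<Sum>i\<in>UNIV. Poly_Mapping.lookup m i)"

text \<open>\<open>[R]\<^sub>t\<close>, which is the zero space for \<open>t < 0\<close>.\<close>

definition graded_part :: "int \<Rightarrow> ('n::finite, 'k::field) mpoly set" where
  "graded_part t = {f. \<forall>m\<in>Poly_Mapping.keys f. int (mdegree m) = t}"

definition eval_mpoly :: "('n::finite \<Rightarrow> 'k::field) \<Rightarrow> ('n, 'k) mpoly \<Rightarrow> 'k" where
  "eval_mpoly a f =
     (\<Sum>m\<in>Poly_Mapping.keys f. Poly_Mapping.lookup f m * (\<Prod>i\<in>UNIV. a i ^ Poly_Mapping.lookup m i))"

definition zariski_open :: "('n::finite \<Rightarrow> 'k::field) set \<Rightarrow> bool" where
  "zariski_open U \<longleftrightarrow> (\<exists>F :: ('n, 'k) mpoly set. U = - {a. \<forall>f\<in>F. eval_mpoly a f = 0})"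

definition linear_form :: "('n::finite \<Rightarrow> 'k::field) \<Rightarrow> ('n, 'k) mpoly" where
  "linear_form a = (\<Sum>i\<in>UNIV. Const (a i) * Var i)"

text \<open>\<open>P\<close> holds for a general linear form.\<close>

definition for_general_linear_form :: "(('n::finite, 'k::field) mpoly \<Rightarrow> bool) \<Rightarrow> bool" where
  "for_general_linear_form P \<longleftrightarrow>
     (\<exists>U. zariski_open U \<and> U \<noteq> {} \<and> (\<forall>a\<in>U. P (linear_form a)))"

text \<open>The ideal generated by \<open>G\<close>: the span of \<open>G\<close> in the ring viewed as a module over itself.\<close>

definition ideal_gen :: "'a::comm_ring_1 set \<Rightarrow> 'a set" where
  "ideal_gen G = module.span (*) G"

text \<open>
  \<open>[R/I]\<^sub>t\<close> as a set of cosets \<open>f + I\<close>. Multiplication by \<open>l\<close> on \<open>R/I\<close> sends a coset \<open>C\<close> to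
  \<open>l C + I\<close>; the set \<open>l C\<close> alone is in general only a subset of a coset.
\<close>

definition quot_part ::
    "('n::finite, 'k::field) mpoly set \<Rightarrow> int \<Rightarrow> ('n, 'k) mpoly set set" where
  "quot_part I t = (\<lambda>f. f +o I) ` graded_part t"

definition quot_mult :: "'a::comm_ring_1 set \<Rightarrow> 'a \<Rightarrow> 'a set \<Rightarrow> 'a set" where
  "quot_mult I l C = (l *o C) + I"

lemma module_self: "module ((*) :: 'a::comm_ring_1 \<Rightarrow> 'a \<Rightarrow> 'a)"
  by standard (simp_all add: algebra_simps)

lemma quot_mult_coset:
  "quot_mult (ideal_gen G) l (f +o ideal_gen G) = (l * f) +o ideal_gen G"
proof -
  interpret M: module "(*) :: 'a \<Rightarrow> 'a \<Rightarrow> 'a"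
    by (rule module_self)
  let ?I = "M.span G"
  have "l * (f + i) + j \<in> l * f +o ?I" if "i \<in> ?I" "j \<in> ?I" for i j
    using M.span_add[OF M.span_scale[OF that(1), of l] that(2)]
    by (auto simp: elt_set_plus_def distrib_left add.assoc)
  moreover have "l * f + j \<in> (l *o (f +o ?I)) + ?I" if "j \<in> ?I" for j
  proof -
    have "f \<in> f +o ?I"
      using M.span_zero[of G] by (force simp: elt_set_plus_def)
    then show ?thesis
      using that by (auto simp: elt_set_times_def set_plus_def)
  qed
  ultimately show ?thesis
    unfolding quot_mult_def ideal_gen_def
    by (fastforce simp: elt_set_plus_def elt_set_times_def set_plus_def)
qed

text \<open>
  The weak Lefschetz property of \<open>R/I\<close>. It is meant for homogeneous ideals \<open>I\<close> with artinian
  quotient.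
\<close>

definition wlp :: "('n::finite, 'k::field) mpoly set \<Rightarrow> bool" where
  "wlp I \<longleftrightarrow> for_general_linear_form (\<lambda>l. \<forall>t.
     inj_on (quot_mult I l) (quot_part I t) \<or>
     quot_mult I l ` quot_part I t = quot_part I (t + 1))"

end

theory Submission
  imports
    Defs
    "HOL-Library.Product_Plus"
    "HOL-Computational_Algebra.Polynomial"
    "HOL-Computational_Algebra.Formal_Power_Series"
begin

text \<open>
  Write \<open>R = k[x\<^sub>1, \<dots>, x\<^sub>7]\<close>, \<open>J = (x\<^sub>1\<^sup>d, \<dots>, x\<^sub>7\<^sup>d)\<close>, \<open>L = \<Sum> a\<^sub>i x\<^sub>i\<close>, \<open>I = J + (L\<^sup>d)\<close>,
  \<open>A = R/I\<close> and \<open>l = \<Sum> b\<^sub>i x\<^sub>i\<close>. Everything is shown for all \<open>a\<close> and \<open>b\<close> in explicit nonempty open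
  sets: all \<open>a\<^sub>i\<close> and \<open>b\<^sub>i\<close> are nonzero and the ratios \<open>a\<^sub>i / b\<^sub>i\<close> are pairwise distinct. Since two
  nonempty open sets meet, one such set of bad \<open>l\<close> is enough to refute the weak Lefschetz property.

  In both cases the structure of \<open>A\<close> is controlled by the strong Lefschetz property of the monomial
  complete intersection \<open>R/J\<close>: powers of a linear form are injective on \<open>R/J\<close> as far as the symmetry
  of its Hilbert function allows
  (\<open>strong_lefschetz_monomial_complete_intersection\<close>). It comes from an action of \<open>sl\<^sub>2\<close>.

  For \<open>d \<ge> 4\<close>, write \<open>d - 1 = 3 q + r\<close> with \<open>r \<le> 2\<close>. The map \<open>\<times>l\<close> into degree \<open>j = 10 q + 3 r\<close> is
  neither surjective nor injective. By apolarity, a form \<open>F \<noteq> 0\<close> of degree \<open>j\<close> in the dual variables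
  which is killed by \<open>\<partial>\<^sub>b\<close>, by all \<open>\<partial>\<^sub>i\<^sup>d\<close> and by \<open>\<partial>\<^sub>a\<^sup>d\<close> is a functional on \<open>[R]\<^sub>j\<close> that vanishes on
  \<open>l R + I\<close>, so it obstructs surjectivity. Modulo the direction \<open>b\<close>, such an \<open>F\<close> is a
  hypersurface in \<open>P\<^sup>5\<close> of degree \<open>j\<close> with multiplicity at least \<open>j - d + 1\<close> at the eight points given by
  the unit vectors and \<open>a\<close>. Eight general points of \<open>P\<^sup>5\<close> lie on a rational normal curve. The cone
  with vertex at one of them over the secant variety of the projected curve in \<open>P\<^sup>4\<close> is a cubic with a
  triple point at its vertex and double points at the other seven, and it is a \<open>3 \<times> 3\<close> Hankel
  determinant. Three such cubics and the hyperplane through the five points that are not vertices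
  have total degree 10 and multiplicity 7 at each of the eight points; \<open>F\<close> is a product of
  \<open>q\<close> copies of this and \<open>r\<close> cubics (\<open>exists_form_with_high_multiplicities\<close>). On the other hand
  \<open>dim [A]\<^sub>j \<le> dim [A]\<^sub>j\<^sub>-\<^sub>1\<close>, because the coefficient of \<open>X\<^sup>j\<close> in \<open>(1 - X\<^sup>d)\<^sup>8 / (1 - X)\<^sup>6\<close> is
  not positive (\<open>second_difference_nonpos\<close>). A map between these spaces that is not surjective is then
  not injective either (\<open>multiplication_not_injective\<close>).

  For \<open>d = 2\<close> the Hilbert function of \<open>A\<close> is \<open>1, 7, 20, 28, 14\<close>, so \<open>\<times>l\<close> has to be injective up to
  degree 2 and surjective from degree 3 on. Injectivity on \<open>[A]\<^sub>2\<close> compares the coefficients of the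
  35 squarefree cubic monomials; this is a linear system indexed by the triples of seven indices
  that can be solved by hand (\<open>triangle_system\<close>). Surjectivity onto \<open>[A]\<^sub>4\<close>
  follows by eliminating one variable with \<open>l\<close>: the square of the resulting linear form in six
  variables is a bijection from degree 2 to degree 4 of the squarefree algebra, by the strong
  Lefschetz property.
\<close>

abbreviation lookup where "lookup \<equiv> Poly_Mapping.lookup"
abbreviation keys where "keys \<equiv> Poly_Mapping.keys"
abbreviation single where "single \<equiv> Poly_Mapping.single"
abbreviation unit_exp :: "'n \<Rightarrow> ('n \<Rightarrow>\<^sub>0 nat)" where "unit_exp i \<equiv> single i (Suc 0)"

section \<open>Coefficients of polynomials\<close>

lemma lookup_monomial_times_add:
  fixes f :: "('n \<Rightarrow>\<^sub>0 nat) \<Rightarrow>\<^sub>0 'k::comm_ring_1"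
  shows "lookup (single m c * f) (m + q) = c * lookup f q"
proof -
  have "lookup (single m c * f) (m + q)
      = Sum_any (\<lambda>l. lookup (single m c) l * Sum_any (\<lambda>p. lookup f p when m + q = l + p))"
    by (simp add: lookup_mult)
  also have "\<dots> = Sum_any (\<lambda>l. (c * Sum_any (\<lambda>p. lookup f p when m + q = l + p)) when l = m)"
    by (rule Sum_any.cong) (simp add: lookup_single when_def)
  also have "\<dots> = c * Sum_any (\<lambda>p. lookup f p when m + q = m + p)"
    by (simp add: Sum_any_when_equal)
  also have "\<dots> = c * lookup f q"
    by simp
  finally show ?thesis .
qed

lemma lookup_monomial_times_zero:
  fixes f :: "('n \<Rightarrow>\<^sub>0 nat) \<Rightarrow>\<^sub>0 'k::comm_ring_1"
  assumes "\<And>q. k \<noteq> m + q"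
  shows "lookup (single m c * f) k = 0"
proof (rule ccontr)
  assume "\<not> ?thesis"
  then have "k \<in> keys (single m c * f)" by (simp add: in_keys_iff)
  then obtain a b where "k = a + b" "a \<in> keys (single m c)"
    using keys_mult by blast
  then show False using assms by (auto split: if_splits)
qed

lemma lookup_Const_times [simp]: "lookup (Const c * f) m = c * lookup f m"
  using lookup_monomial_times_add[of 0 c f m] by (simp add: Const_def)

lemma exponent_split: "lookup m i \<noteq> 0 \<Longrightarrow> unit_exp i + (m - unit_exp i) = m"
  by (rule poly_mapping_eqI) (auto simp: lookup_add lookup_minus lookup_single when_def)

lemma lookup_Var_times:
  fixes f :: "('n::finite, 'k::field) mpoly"
  shows "lookup (Var i * f) m = (if lookup m i = 0 then 0 else lookup f (m - unit_exp i))"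
proof (cases "lookup m i = 0")
  case True
  have "m \<noteq> unit_exp i + q" for q
    using True by (auto simp: lookup_add)
  then show ?thesis using True by (simp add: Var_def lookup_monomial_times_zero)
next
  case False
  then show ?thesis
    using lookup_monomial_times_add[of "unit_exp i" 1 f "m - unit_exp i"]
    by (simp add: Var_def exponent_split)
qed

lemma lookup_Var_times_add [simp]:
  fixes f :: "('n::finite, 'k::field) mpoly"
  shows "lookup (Var i * f) (m + unit_exp i) = lookup f m"
  using lookup_monomial_times_add[of "unit_exp i" 1 f m] by (simp add: Var_def add.commute)

lemma lookup_linear_form_times:
  fixes f :: "('n::finite, 'k::field) mpoly"
  shows "lookup (linear_form a * f) m
    = (\<Sum>i\<in>UNIV. a i * (if lookup m i = 0 then 0 else lookup f (m - unit_exp i)))"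
  by (simp add: linear_form_def sum_distrib_right lookup_sum mult.assoc lookup_Var_times)

lemma sum_of_monomials: "(\<Sum>m\<in>keys f. single m (lookup f m)) = f"
  by (rule poly_mapping_eqI)
     (auto simp: lookup_sum lookup_single when_def in_keys_iff)

lemma poly_induct [case_names monomial add]:
  assumes "\<And>m c. P (single m c)" and "\<And>f g. P f \<Longrightarrow> P g \<Longrightarrow> P (f + g)"
  shows "P (f :: 'a \<Rightarrow>\<^sub>0 'b::comm_monoid_add)"
proof -
  have "P (\<Sum>m\<in>A. single m (lookup f m))" if "finite A" for A
    using that
  proof induction
    case empty show ?case using assms(1)[of undefined 0] by simp
  qed (simp add: assms)
  from this[OF finite_keys[of f]] show ?thesis by (simp only: sum_of_monomials)
qed

lemma Const_add: "Const (c + c') = Const c + Const c'"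
  and Const_mult: "Const (c * c') = Const c * Const c'"
  and Const_0 [simp]: "Const 0 = 0"
  and Const_1 [simp]: "Const 1 = 1"
  and Const_minus: "Const (- c) = - Const c"
  and Const_diff: "Const (c - c') = Const c - Const c'"
  by (simp_all add: Const_def single_add mult_single single_uminus single_diff)

lemma Const_of_nat [simp]: "Const (of_nat n) = of_nat n"
  by (induction n) (simp_all add: Const_add)

lemma Const_numeral [simp]: "Const (numeral n) = numeral n"
  using Const_of_nat[of "numeral n"] by simp

text \<open>Keeping only the monomials with a given property; this is used both to take homogeneous
  components and to reduce modulo \<open>(x\<^sub>1\<^sup>d, \<dots>, x\<^sub>n\<^sup>d)\<close>.\<close>

definition restrict_monomials :: "('a \<Rightarrow> bool) \<Rightarrow> ('a \<Rightarrow>\<^sub>0 'b::zero) \<Rightarrow> 'a \<Rightarrow>\<^sub>0 'b" where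
  "restrict_monomials P f = Poly_Mapping.mapp (\<lambda>m c. if P m then c else 0) f"

lemma lookup_restrict [simp]:
  "lookup (restrict_monomials P f) m = (if P m then lookup f m else 0)"
  by (auto simp: restrict_monomials_def lookup_mapp when_def in_keys_iff)

section \<open>Homogeneous polynomials\<close>

abbreviation homogeneous :: "nat \<Rightarrow> ('n::finite, 'k::field) mpoly set" where
  "homogeneous t \<equiv> graded_part (int t)"

lemma homogeneous_iff: "f \<in> homogeneous t \<longleftrightarrow> (\<forall>m. lookup f m \<noteq> 0 \<longrightarrow> mdegree m = t)"
  by (auto simp: graded_part_def in_keys_iff)

lemma mdegree_add: "mdegree (m + q) = mdegree m + mdegree q"
  by (simp add: mdegree_def lookup_add sum.distrib)

lemma mdegree_unit_exp [simp]: "mdegree (unit_exp i) = 1"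
  by (simp add: mdegree_def lookup_single when_def)

lemma mdegree_0 [simp]: "mdegree 0 = 0"
  by (simp add: mdegree_def)

lemma graded_part_add: "f \<in> graded_part t \<Longrightarrow> g \<in> graded_part t \<Longrightarrow> f + g \<in> graded_part t"
  using keys_add[of f g] by (auto simp: graded_part_def)

lemma graded_part_uminus: "f \<in> graded_part t \<Longrightarrow> - f \<in> graded_part t"
  by (auto simp: graded_part_def in_keys_iff)

lemma graded_part_diff: "f \<in> graded_part t \<Longrightarrow> g \<in> graded_part t \<Longrightarrow> f - g \<in> graded_part t"
  using graded_part_add[of f t "- g"] graded_part_uminus[of g t] by simp

lemma graded_part_0 [simp]: "0 \<in> graded_part t"
  by (simp add: graded_part_def)

lemma graded_part_sum: "(\<And>i. i \<in> A \<Longrightarrow> f i \<in> graded_part t) \<Longrightarrow> sum f A \<in> graded_part t"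
  by (induction A rule: infinite_finite_induct) (auto intro: graded_part_add)

lemma graded_part_mult:
  "f \<in> graded_part s \<Longrightarrow> g \<in> graded_part t \<Longrightarrow> f * g \<in> graded_part (s + t)"
  using keys_mult[of f g] by (fastforce simp: graded_part_def mdegree_add)

lemma graded_part_Const: "Const c \<in> graded_part 0"
  by (auto simp: graded_part_def Const_def)

lemma graded_part_Const_times: "f \<in> graded_part t \<Longrightarrow> Const c * f \<in> graded_part t"
  using graded_part_mult[OF graded_part_Const] by fastforce

lemma graded_part_Var: "Var i \<in> graded_part 1"
  by (auto simp: graded_part_def Var_def)

lemma graded_part_linear_form: "linear_form a \<in> graded_part 1"
  unfolding linear_form_def
  by (intro graded_part_sum graded_part_Const_times graded_part_Var)

lemma homogeneous_mult:
  "f \<in> homogeneous s \<Longrightarrow> g \<in> homogeneous t \<Longrightarrow> f * g \<in> homogeneous (s + t)"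
  using graded_part_mult[of f "int s" g "int t"] by simp

lemma homogeneous_power: "f \<in> homogeneous s \<Longrightarrow> f ^ n \<in> homogeneous (s * n)"
proof (induction n)
  case 0 show ?case using graded_part_Const[of 1] by simp
next
  case (Suc n)
  then show ?case using homogeneous_mult[of f s "f ^ n" "s * n"] by simp
qed

lemma homogeneous_linear_form_power: "linear_form a ^ s \<in> homogeneous s"
  using homogeneous_power[of "linear_form a" 1 s] graded_part_linear_form[of a] by simp

abbreviation component :: "nat \<Rightarrow> ('n::finite, 'k::field) mpoly \<Rightarrow> ('n, 'k) mpoly" where
  "component t \<equiv> restrict_monomials (\<lambda>m. mdegree m = t)"

lemma component_homogeneous: "component t f \<in> homogeneous t"
  by (simp add: homogeneous_iff)

lemma component_of_homogeneous: "f \<in> homogeneous t \<Longrightarrow> component t f = f"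
  by (rule poly_mapping_eqI) (auto simp: homogeneous_iff)

lemma restrict_monomials_add:
  "restrict_monomials P (f + g) = restrict_monomials P f + restrict_monomials P (g :: 'a \<Rightarrow>\<^sub>0 'b::comm_ring_1)"
  by (rule poly_mapping_eqI) (simp add: lookup_add)

lemma restrict_monomials_diff:
  "restrict_monomials P (f - g) = restrict_monomials P f - restrict_monomials P (g :: 'a \<Rightarrow>\<^sub>0 'b::comm_ring_1)"
  by (rule poly_mapping_eqI) (simp add: lookup_minus)

lemma component_mult:
  assumes "p \<in> homogeneous d"
  shows "component t (p * g) = (if d \<le> t then p * component (t - d) g else 0)"
proof (induction g rule: poly_induct)
  case (monomial m c)
  have h: "p * single m c \<in> homogeneous (d + mdegree m)"
    by (rule homogeneous_mult[OF assms]) (auto simp: graded_part_def)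
  show ?case
  proof (cases "t = d + mdegree m")
    case True
    then have "component (t - d) (single m c) = single m c"
      by (auto intro!: poly_mapping_eqI simp: lookup_single when_def)
    then show ?thesis using True component_of_homogeneous[OF h] by simp
  next
    case False
    then have "component t (p * single m c) = 0"
      using h unfolding homogeneous_iff by (auto intro!: poly_mapping_eqI)
    moreover have "component (t - d) (single m c) = 0" if "d \<le> t"
      using False that by (auto intro!: poly_mapping_eqI simp: lookup_single when_def)
    ultimately show ?thesis by simp
  qed
qed (auto simp: distrib_left restrict_monomials_add)

section \<open>The ideal of the powers of the variables\<close>

text \<open>The ideal \<open>(x\<^sub>1\<^sup>d, \<dots>, x\<^sub>n\<^sup>d)\<close>, described by its monomials so that membership can be read off the
  coefficients.\<close>

definition power_ideal :: "nat \<Rightarrow> ('n::finite, 'k::field) mpoly set" where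
  "power_ideal d = {f. \<forall>m. (\<forall>i. lookup m i < d) \<longrightarrow> lookup f m = 0}"

lemma power_ideal_add: "f \<in> power_ideal d \<Longrightarrow> g \<in> power_ideal d \<Longrightarrow> f + g \<in> power_ideal d"
  and power_ideal_diff: "f \<in> power_ideal d \<Longrightarrow> g \<in> power_ideal d \<Longrightarrow> f - g \<in> power_ideal d"
  and power_ideal_uminus: "f \<in> power_ideal d \<Longrightarrow> - f \<in> power_ideal d"
  and power_ideal_0 [simp]: "0 \<in> power_ideal d"
  by (auto simp: power_ideal_def lookup_add lookup_minus)

lemma power_ideal_monomial_times:
  assumes "f \<in> power_ideal d"
  shows "single q c * f \<in> power_ideal d"
proof -
  have "lookup (single q c * f) m = 0" if m: "\<forall>i. lookup m i < d" for m
  proof (cases "\<exists>k. m = q + k")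
    case True
    then obtain k where k: "m = q + k" by blast
    have "\<forall>i. lookup k i < d" using m unfolding k lookup_add by (metis add_lessD1 add.commute)
    then show ?thesis using assms by (simp add: k lookup_monomial_times_add power_ideal_def)
  qed (auto simp: lookup_monomial_times_zero)
  then show ?thesis by (simp add: power_ideal_def)
qed

lemma power_ideal_mult:
  assumes "f \<in> power_ideal d"
  shows "p * f \<in> power_ideal d"
  by (induction p rule: poly_induct)
     (simp_all add: power_ideal_monomial_times assms distrib_right power_ideal_add)

lemma power_ideal_restrict: "f \<in> power_ideal d \<Longrightarrow> restrict_monomials P f \<in> power_ideal d"
  by (simp add: power_ideal_def)

lemma power_ideal_Const_times_cancel:
  "Const c * f \<in> power_ideal d \<Longrightarrow> c \<noteq> 0 \<Longrightarrow> f \<in> power_ideal d"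
  by (simp add: power_ideal_def)

abbreviation reduce :: "nat \<Rightarrow> ('n::finite, 'k::field) mpoly \<Rightarrow> ('n, 'k) mpoly" where
  "reduce d \<equiv> restrict_monomials (\<lambda>m. \<forall>i. lookup m i < d)"

lemma reduce_eq_0_iff: "reduce d f = 0 \<longleftrightarrow> f \<in> power_ideal d"
  by (auto simp: poly_mapping_eq_iff fun_eq_iff power_ideal_def)

lemma reduce_diff_in_power_ideal: "f - reduce d f \<in> power_ideal d"
  by (simp add: power_ideal_def lookup_minus)

section \<open>Partial derivatives\<close>

definition pderiv_at :: "'n::finite \<Rightarrow> ('n, 'k::field) mpoly \<Rightarrow> ('n, 'k) mpoly" where
  "pderiv_at i f = Abs_poly_mapping (\<lambda>m. of_nat (lookup m i + 1) * lookup f (m + unit_exp i))"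

lemma lookup_pderiv_at [simp]:
  "lookup (pderiv_at i f) m = of_nat (lookup m i + 1) * lookup f (m + unit_exp i)"
proof -
  have "{m. of_nat (lookup m i + 1) * lookup f (m + unit_exp i) \<noteq> 0}
      \<subseteq> (\<lambda>m. m - unit_exp i) ` keys f"
  proof
    fix m assume "m \<in> {m. of_nat (lookup m i + 1) * lookup f (m + unit_exp i) \<noteq> 0}"
    then have "m + unit_exp i \<in> keys f" by (auto simp: in_keys_iff)
    moreover have "m = (m + unit_exp i) - unit_exp i" by simp
    ultimately show "m \<in> (\<lambda>m. m - unit_exp i) ` keys f" by blast
  qed
  then have "finite {m. of_nat (lookup m i + 1) * lookup f (m + unit_exp i) \<noteq> 0}"
    by (rule finite_subset) simp
  then show ?thesis
    unfolding pderiv_at_def by simp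
qed

lemma pderiv_at_add: "pderiv_at i (f + g) = pderiv_at i f + pderiv_at i g"
  by (rule poly_mapping_eqI) (simp add: lookup_add distrib_left)

lemma pderiv_at_0 [simp]: "pderiv_at i 0 = 0"
  by (rule poly_mapping_eqI) simp

lemma pderiv_at_monomial:
  "pderiv_at i (single m c) = single (m - unit_exp i) (of_nat (lookup m i) * c)"
proof (rule poly_mapping_eqI)
  fix k
  show "lookup (pderiv_at i (single m c)) k
      = lookup (single (m - unit_exp i) (of_nat (lookup m i) * c)) k"
  proof (cases "m = k + unit_exp i")
    case True
    then show ?thesis by (simp add: lookup_add)
  next
    case False
    have "lookup m i = 0" if "k = m - unit_exp i"
    proof (rule ccontr)
      assume "lookup m i \<noteq> 0"
      then have "m = k + unit_exp i"
        using exponent_split[of m i] that by (simp add: add.commute)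
      then show False using False by blast
    qed
    then show ?thesis using False by (auto simp: lookup_single when_def)
  qed
qed

lemma minus_unit_exp_add: "lookup m i \<noteq> 0 \<Longrightarrow> (m + q) - unit_exp i = (m - unit_exp i) + q"
  by (rule poly_mapping_eqI) (auto simp: lookup_add lookup_minus lookup_single when_def)

lemma pderiv_at_mult: "pderiv_at i (f * g) = pderiv_at i f * g + f * pderiv_at i g"
proof (induction f rule: poly_induct)
  case (monomial m c)
  show ?case
  proof (induction g rule: poly_induct)
    case (monomial q c')
    consider "lookup m i = 0" | "lookup q i = 0" | "lookup m i \<noteq> 0" "lookup q i \<noteq> 0" by blast
    then show ?case
    proof cases
      case 1
      then show ?thesis
      proof (cases "lookup q i = 0")
        case False
        then have "(m + q) - unit_exp i = m + (q - unit_exp i)"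
          using minus_unit_exp_add[of q i m] by (simp add: add.commute)
        then show ?thesis using 1
          by (simp add: pderiv_at_monomial mult_single lookup_add mult_ac)
      qed (simp add: pderiv_at_monomial mult_single lookup_add)
    next
      case 2
      then show ?thesis
        by (cases "lookup m i = 0")
           (simp_all add: pderiv_at_monomial mult_single lookup_add minus_unit_exp_add mult_ac
             add.commute[of q "m - unit_exp i"])
    next
      case 3
      then have "(m + q) - unit_exp i = (m - unit_exp i) + q"
        "(m + q) - unit_exp i = m + (q - unit_exp i)"
        using minus_unit_exp_add[of q i m] minus_unit_exp_add[of m i q] by (simp_all add: add.commute)
      then show ?thesis
        by (simp add: pderiv_at_monomial mult_single lookup_add algebra_simps
            flip: single_add)
    qed
  qed (simp_all add: pderiv_at_add distrib_left)
qed (simp_all add: pderiv_at_add distrib_right)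

lemma pderiv_at_Const [simp]: "pderiv_at i (Const c) = 0"
  by (simp add: Const_def pderiv_at_monomial)

lemma pderiv_at_Const_times [simp]: "pderiv_at i (Const c * f) = Const c * pderiv_at i f"
  by (simp add: pderiv_at_mult)

lemma pderiv_at_Var: "pderiv_at i (Var j) = (if i = j then 1 else 0)"
  by (auto simp: Var_def pderiv_at_monomial lookup_single when_def)

lemma pderiv_at_sum: "pderiv_at i (sum f A) = (\<Sum>x\<in>A. pderiv_at i (f x))"
  by (induction A rule: infinite_finite_induct) (simp_all add: pderiv_at_add)

lemma pderiv_at_linear_form: "pderiv_at i (linear_form a) = Const (a i)"
  by (simp add: linear_form_def pderiv_at_sum pderiv_at_Var if_distrib cong: if_cong)

lemma Var_times_pderiv_at: "lookup (Var i * pderiv_at i f) m = of_nat (lookup m i) * lookup f m"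
  by (auto simp: lookup_Var_times lookup_minus exponent_split add.commute lookup_add)

section \<open>Linear algebra\<close>

text \<open>For families of monomials the separating subspaces are the coefficient hyperplanes.\<close>

lemma (in vector_space) independent_by_separation:
  assumes "\<And>x. x \<in> X \<Longrightarrow> \<exists>S. subspace S \<and> X - {x} \<subseteq> S \<and> x \<notin> S"
  shows "independent X"
  unfolding dependent_def using assms span_minimal by blast

lemma (in vector_space) span_Int_independent_Un:
  assumes "independent (C \<union> E)" "C \<inter> E = {}" "x \<in> span C" "x \<in> span E"
  shows "x = 0"
proof -
  have sub: "C \<subseteq> C \<union> E" "E \<subseteq> C \<union> E" by auto
  have "representation (C \<union> E) x = representation C x"
    "representation (C \<union> E) x = representation E x"
    using assms sub by (auto intro!: representation_extend)
  then have "representation (C \<union> E) x b = 0" for b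
    using representation_ne_zero[of C x b] representation_ne_zero[of E x b] assms(2) by auto
  then have "{b. representation (C \<union> E) x b \<noteq> 0} = {}" by simp
  moreover have "(\<Sum>b | representation (C \<union> E) x b \<noteq> 0. scale (representation (C \<union> E) x b) b) = x"
    using assms(1,3) span_mono[of C "C \<union> E"] by (intro sum_nonzero_representation_eq) auto
  ultimately show ?thesis by simp
qed

text \<open>A basis of the kernel of \<open>T\<close> on \<open>span X\<close>, of size at most \<open>card Z\<close>, is extended to a basis of
  \<open>span X\<close>. The added vectors have independent images, and these remain independent together with
  \<open>y0\<close>. Read backwards: a map that misses a vector and whose source is as large as its target has a
  kernel of the size that this forces.\<close>

lemma (in vector_space_pair) rank_nullity_bound:
  assumes T: "Vector_Spaces.linear s1 s2 T"
    and X: "vs1.independent X" "finite X"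
    and Y: "finite Y" "T ` X \<subseteq> vs2.span Y"
    and y0: "y0 \<in> vs2.span Y" "y0 \<notin> vs2.span (T ` X)"
    and Z: "finite Z" "\<And>x. x \<in> vs1.span X \<Longrightarrow> T x = 0 \<Longrightarrow> x \<in> vs1.span Z"
  shows "card X + 1 \<le> card Y + card Z"
proof -
  interpret T: Vector_Spaces.linear s1 s2 T by (rule T)
  define K where "K = {x \<in> vs1.span X. T x = 0}"
  obtain C where C: "C \<subseteq> K" "vs1.independent C" "K \<subseteq> vs1.span C"
    by (rule vs1.maximal_independent_subset)
  have "C \<subseteq> vs1.span Z" using C(1) Z(2) by (auto simp: K_def)
  then have fC: "finite C" "card C \<le> card Z" using vs1.independent_span_bound[OF Z(1) C(2)] by auto
  have "C \<subseteq> vs1.span X" using C(1) by (auto simp: K_def)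
  then obtain D where D: "C \<subseteq> D" "D \<subseteq> vs1.span X" "vs1.independent D" "vs1.span X \<subseteq> vs1.span D"
    using vs1.maximal_independent_subset_extend[OF _ C(2)] by blast
  have fD: "finite D" using vs1.independent_span_bound[OF X(2) D(3,2)] by simp
  have "X \<subseteq> vs1.span D" using D(4) vs1.span_superset by blast
  then have XD: "card X \<le> card D" using vs1.independent_span_bound[OF fD X(1)] by simp
  define E where "E = D - C"
  have DE: "D = C \<union> E" "C \<inter> E = {}" using D(1) by (auto simp: E_def)
  have "E \<subseteq> D" "E \<subseteq> vs1.span X" using D(2) by (auto simp: E_def)
  then have E: "vs1.independent E" "vs1.span E \<subseteq> vs1.span X"
    using vs1.independent_mono[OF D(3)] vs1.span_minimal[OF _ vs1.subspace_span] by blast+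
  have "inj_on T (vs1.span E)"
  proof (rule inj_onI)
    fix x y assume xy: "x \<in> vs1.span E" "y \<in> vs1.span E" "T x = T y"
    then have d: "x - y \<in> vs1.span E" "T (x - y) = 0" by (simp_all add: vs1.span_diff T.diff)
    then have "x - y \<in> vs1.span C" using E(2) C(3) by (auto simp: K_def)
    then have "x - y = 0" using vs1.span_Int_independent_Un[of C E "x - y"] D(3) DE d(1) by simp
    then show "x = y" by simp
  qed
  then have iE: "vs2.independent (T ` E)" "inj_on T E"
    using E(1) T.independent_injective_image inj_on_subset vs1.span_superset by blast+
  have TE: "T ` E \<subseteq> vs2.span (T ` X)"
    using E(2) vs1.span_superset[of E] T.span_image[of X] by blast
  then have "y0 \<notin> vs2.span (T ` E)"
    using y0(2) vs2.span_minimal[OF _ vs2.subspace_span] by blast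
  then have "vs2.independent (insert y0 (T ` E))" "y0 \<notin> T ` E"
    using iE(1) vs2.independent_insertI vs2.span_superset by blast+
  moreover have "insert y0 (T ` E) \<subseteq> vs2.span Y"
    using y0(1) TE vs2.span_minimal[OF Y(2) vs2.subspace_span] by blast
  ultimately have "card (insert y0 (T ` E)) \<le> card Y"
    using vs2.independent_span_bound[OF Y(1)] by blast
  moreover have "card (insert y0 (T ` E)) = card E + 1"
    using \<open>y0 \<notin> T ` E\<close> fD iE(2) by (simp add: card_image E_def)
  moreover have "card D = card C + card E"
    using DE fD by (metis card_Un_disjoint finite_Un)
  ultimately show ?thesis using XD fC(2) by linarith
qed

text \<open>A missed vector would contradict \<open>rank_nullity_bound\<close> with zero kernel.\<close>

lemma (in vector_space_pair) injective_imp_spanning: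
  assumes T: "Vector_Spaces.linear s1 s2 T"
    and X: "vs1.independent X" "finite X"
    and Y: "finite Y" "T ` X \<subseteq> vs2.span Y" "card Y \<le> card X"
    and inj: "\<And>x. x \<in> vs1.span X \<Longrightarrow> T x = 0 \<Longrightarrow> x = 0"
    and y: "y \<in> vs2.span Y"
  shows "y \<in> vs2.span (T ` X)"
proof (rule ccontr)
  assume n: "y \<notin> vs2.span (T ` X)"
  have "card X + 1 \<le> card Y + card ({} :: 'b set)"
    by (intro rank_nullity_bound[OF T X Y(1,2) y n]) (auto dest: inj simp: vs1.span_zero)
  then show False using Y(3) by simp
qed

section \<open>Polynomials as a vector space\<close>

lemma vector_space_poly: "vector_space (\<lambda>c f. Const c * f :: ('n::finite, 'k::field) mpoly)"
  by unfold_locales (simp_all add: distrib_left distrib_right mult.assoc Const_add Const_mult)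

lemma vector_space_poly_pairs: "vector_space (\<lambda>c (p :: ('n::finite, 'k::field) mpoly \<times> ('n, 'k) mpoly).
    (Const c * fst p, Const c * snd p))"
  by unfold_locales
    (simp_all add: distrib_left distrib_right mult.assoc Const_add Const_mult prod_eq_iff)

interpretation poly: vector_space "\<lambda>c f. Const c * f :: ('n::finite, 'k::field) mpoly"
  by (rule vector_space_poly)

interpretation poly2: vector_space
  "\<lambda>c (p :: ('n::finite, 'k::field) mpoly \<times> ('n, 'k) mpoly). (Const c * fst p, Const c * snd p)"
  by (rule vector_space_poly_pairs)

lemmas poly2_poly_rank_nullity_bound = vector_space_pair.rank_nullity_bound
  [OF vector_space_pair.intro, OF poly2.vector_space_axioms poly.vector_space_axioms]

lemmas poly_poly_injective_imp_spanning = vector_space_pair.injective_imp_spanning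
  [OF vector_space_pair.intro, OF poly.vector_space_axioms poly.vector_space_axioms]

abbreviation power_product :: "('n::finite \<Rightarrow>\<^sub>0 nat) \<Rightarrow> ('n, 'k::field) mpoly" where
  "power_product m \<equiv> single m 1"

lemma Const_times_power_product: "Const c * power_product m = single m c"
  by (simp add: Const_def mult_single)

lemma in_span_monomials:
  assumes "\<And>m. lookup f m \<noteq> 0 \<Longrightarrow> m \<in> M"
  shows "f \<in> poly.span (power_product ` M)"
proof -
  have "power_product m \<in> power_product ` M" if "m \<in> keys f" for m
    using that assms by (simp add: in_keys_iff)
  then have "(\<Sum>m\<in>keys f. Const (lookup f m) * power_product m) \<in> poly.span (power_product ` M)"
    by (intro poly.span_sum poly.span_scale poly.span_base)
  then show ?thesis by (simp only: Const_times_power_product sum_of_monomials)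
qed

lemma span_monomials_supported:
  fixes f :: "('n::finite, 'k::field) mpoly"
  assumes "f \<in> poly.span (power_product ` M)" "lookup f m \<noteq> 0"
  shows "m \<in> M"
proof (rule ccontr)
  assume m: "m \<notin> M"
  have "poly.subspace {f :: ('n, 'k) mpoly. lookup f m = 0}"
    by (rule poly.subspaceI) (simp_all add: lookup_add)
  moreover have "power_product ` M \<subseteq> {f :: ('n, 'k) mpoly. lookup f m = 0}"
    using m by (auto simp: lookup_single when_def)
  ultimately have "poly.span (power_product ` M) \<subseteq> {f :: ('n, 'k) mpoly. lookup f m = 0}"
    by (rule poly.span_minimal[rotated])
  then show False using assms by auto
qed

lemma inj_power_product: "inj (power_product :: _ \<Rightarrow> ('n::finite, 'k::field) mpoly)"
proof (rule injI)
  fix m m' assume "(power_product m :: ('n, 'k) mpoly) = power_product m'"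
  then have "lookup (power_product m :: ('n, 'k) mpoly) m = lookup (power_product m') m" by (rule arg_cong)
  then show "m = m'" by (simp add: lookup_single when_def split: if_splits)
qed

lemma independent_monomials:
  "poly.independent (power_product ` M :: ('n::finite, 'k::field) mpoly set)"
proof (rule poly.independent_by_separation)
  fix x :: "('n, 'k) mpoly" assume "x \<in> power_product ` M"
  then obtain m where m: "x = power_product m" by blast
  have "poly.subspace {f :: ('n, 'k) mpoly. lookup f m = 0}"
    by (rule poly.subspaceI) (auto simp: lookup_add)
  moreover have "power_product ` M - {x} \<subseteq> {f. lookup f m = 0}"
    by (auto simp: m lookup_single when_def)
  ultimately show "\<exists>S. poly.subspace S \<and> power_product ` M - {x} \<subseteq> S \<and> x \<notin> S"
    by (intro exI[of _ "{f. lookup f m = 0}"]) (simp add: m)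
qed

section \<open>The strong Lefschetz property of monomial complete intersections\<close>

text \<open>In characteristic zero, the monomials \<open>1, x\<^sub>i, \<dots>, x\<^sub>i\<^sup>d\<^sup>-\<^sup>1\<close> span an irreducible \<open>sl\<^sub>2\<close>-module on which \<open>a\<^sub>i x\<^sub>i\<close> raises and
  \<open>a\<^sub>i\<^sup>-\<^sup>1 ((d - 1) \<partial>\<^sub>i - x\<^sub>i \<partial>\<^sub>i\<^sup>2)\<close> lowers weights; it sends \<open>x\<^sub>i\<^sup>m\<close> to
  \<open>a\<^sub>i\<^sup>-\<^sup>1 m (d - m) x\<^sub>i\<^sup>m\<^sup>-\<^sup>1\<close>. The sum
  over \<open>i\<close> is the lowering operator of their tensor product, in which \<open>\<Sum> a\<^sub>i x\<^sub>i\<close> is the raising operator. As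
  \<open>inverse 0 = 0\<close>, the variables that do not occur in the linear form are left alone.\<close>

definition lowering :: "nat \<Rightarrow> ('n::finite \<Rightarrow> 'k::field) \<Rightarrow> ('n, 'k) mpoly \<Rightarrow> ('n, 'k) mpoly" where
  "lowering d a f = (\<Sum>i\<in>UNIV. Const (inverse (a i)) *
     (Const (of_nat d - 1) * pderiv_at i f - Var i * pderiv_at i (pderiv_at i f)))"

text \<open>The degree in those variables that occur in the linear form with coefficients \<open>a\<close>. Counting only
  these gives the strong Lefschetz property for a subset of the variables without a change of ring.\<close>

definition support_degree :: "('n::finite \<Rightarrow> 'k::zero) \<Rightarrow> ('n \<Rightarrow>\<^sub>0 nat) \<Rightarrow> nat" where
  "support_degree a m = (\<Sum>i | a i \<noteq> 0. lookup m i)"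

lemma lookup_lowering:
  "lookup (lowering d a f) m = (\<Sum>i\<in>UNIV. inverse (a i) * (of_nat d - 1 - of_nat (lookup m i))
     * of_nat (lookup m i + 1) * lookup f (m + unit_exp i))"
proof -
  have "lookup (Const (inverse (a i)) *
        (Const (of_nat d - 1) * pderiv_at i f - Var i * pderiv_at i (pderiv_at i f))) m
      = inverse (a i) * (of_nat d - 1 - of_nat (lookup m i))
     * of_nat (lookup m i + 1) * lookup f (m + unit_exp i)" for i
    by (simp add: lookup_minus Var_times_pderiv_at) (simp add: algebra_simps)
  then show ?thesis unfolding lowering_def lookup_sum by (intro sum.cong) simp_all
qed

text \<open>Lowering could leave the ideal only from exponent \<open>d\<close> to \<open>d - 1\<close>, and there the factor
  \<open>d - 1 - m\<^sub>i\<close> is zero.\<close>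

lemma lowering_power_ideal:
  assumes "f \<in> power_ideal d"
  shows "lowering d a f \<in> power_ideal d"
proof -
  have "lookup (lowering d a f) m = 0" if m: "\<forall>i. lookup m i < d" for m
  proof -
    have key: "(of_nat d - 1 - of_nat (lookup m i)) * lookup f (m + unit_exp i) = 0" for i
    proof (cases "lookup m i + 1 = d")
      case True
      then have "of_nat d = (of_nat (lookup m i + 1) :: 'b)" by simp
      then show ?thesis by simp
    next
      case False
      then have "\<forall>j. lookup (m + unit_exp i) j < d"
        using m by (auto simp: lookup_add lookup_single when_def le_less_Suc_eq Suc_lessI)
      then show ?thesis using assms by (simp add: power_ideal_def)
    qed
    have "inverse (a i) * (of_nat d - 1 - of_nat (lookup m i))
        * of_nat (lookup m i + 1) * lookup f (m + unit_exp i) = 0" for i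
      using key[of i] by auto
    then show ?thesis unfolding lookup_lowering by (intro sum.neutral ballI)
  qed
  then show ?thesis by (simp add: power_ideal_def)
qed

lemma support_degree_add_unit_exp:
  "support_degree a (m + unit_exp i) = support_degree a m + (if a i \<noteq> 0 then 1 else 0)"
  by (simp add: support_degree_def lookup_add sum.distrib lookup_single when_def)

lemma support_degree_lowering:
  assumes "lookup (lowering d a f) m \<noteq> 0"
  obtains i where "lookup f (m + unit_exp i) \<noteq> 0"
    "support_degree a (m + unit_exp i) = Suc (support_degree a m)"
proof -
  from assms obtain i where "inverse (a i) * (of_nat d - 1 - of_nat (lookup m i))
     * of_nat (lookup m i + 1) * lookup f (m + unit_exp i) \<noteq> 0"
    unfolding lookup_lowering by (meson sum.not_neutral_contains_not_neutral)
  then have "lookup f (m + unit_exp i) \<noteq> 0" "a i \<noteq> 0" by auto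
  then show ?thesis by (intro that[of i]) (auto simp: support_degree_add_unit_exp)
qed

lemma support_degree_linear_form_times:
  assumes "\<And>m. lookup f m \<noteq> 0 \<Longrightarrow> support_degree a m = e"
    and "lookup (linear_form a * f) m \<noteq> 0"
  shows "support_degree a m = Suc e"
proof -
  from assms(2) obtain i
    where "a i * (if lookup m i = 0 then 0 else lookup f (m - unit_exp i)) \<noteq> 0"
    unfolding lookup_linear_form_times by (meson sum.not_neutral_contains_not_neutral)
  then have i: "a i \<noteq> 0" "lookup m i \<noteq> 0" "lookup f (m - unit_exp i) \<noteq> 0"
    by (auto split: if_splits)
  then have "m = (m - unit_exp i) + unit_exp i"
    using exponent_split[of m i] by (simp add: add.commute)
  then show ?thesis
    using support_degree_add_unit_exp[of a "m - unit_exp i" i] i assms(1) by simp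
qed

lemma euler_identity:
  assumes "\<And>m. lookup f m \<noteq> 0 \<Longrightarrow> support_degree a m = e"
  shows "(\<Sum>i | a i \<noteq> 0. Var i * pderiv_at i f) = Const (of_nat e) * f"
proof (rule poly_mapping_eqI)
  fix m
  have "lookup (\<Sum>i | a i \<noteq> 0. Var i * pderiv_at i f) m = of_nat (support_degree a m) * lookup f m"
    by (simp add: lookup_sum Var_times_pderiv_at support_degree_def sum_distrib_right)
  then show "lookup (\<Sum>i | a i \<noteq> 0. Var i * pderiv_at i f) m = lookup (Const (of_nat e) * f) m"
    using assms[of m] by (cases "lookup f m = 0") (simp_all del: Const_of_nat)
qed

text \<open>The commutator of the lowering operator with multiplication by the linear form is the weight,
  a scalar in each degree.\<close>

lemma lowering_linear_form_times:
  fixes f :: "('n::finite, 'k::field) mpoly"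
  assumes "\<And>m. lookup f m \<noteq> 0 \<Longrightarrow> support_degree a m = e"
  shows "lowering d a (linear_form a * f) = linear_form a * lowering d a f
    + Const (of_nat (card {i. a i \<noteq> 0}) * (of_nat d - 1) - 2 * of_nat e) * f"
proof -
  let ?L = "linear_form a"
  define t where "t f i = Const (inverse (a i)) *
    (Const (of_nat d - 1) * pderiv_at i f - Var i * pderiv_at i (pderiv_at i f))"
    for f :: "('n, 'k) mpoly" and i
  have "t (?L * f) i = ?L * t f i
      + (if a i \<noteq> 0 then Const (of_nat d - 1) * f - 2 * (Var i * pderiv_at i f) else 0)" for i
  proof (cases "a i = 0")
    case False
    then have inv: "Const (inverse (a i)) * Const (a i) = 1"
      by (simp flip: Const_mult)
    have "t (?L * f) i = ?L * t f i + (Const (inverse (a i)) * Const (a i)) *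
        (Const (of_nat d - 1) * f - 2 * (Var i * pderiv_at i f))"
      by (simp add: t_def pderiv_at_mult pderiv_at_add pderiv_at_linear_form algebra_simps)
    then show ?thesis using False by (simp add: inv)
  qed (simp add: t_def)
  then have "lowering d a (?L * f) = ?L * lowering d a f
      + (\<Sum>i | a i \<noteq> 0. Const (of_nat d - 1) * f - 2 * (Var i * pderiv_at i f))"
    by (simp add: lowering_def t_def[symmetric] sum.distrib sum_distrib_left flip: sum.inter_filter)
  also have "(\<Sum>i | a i \<noteq> 0. Const (of_nat d - 1) * f - 2 * (Var i * pderiv_at i f))
      = of_nat (card {i. a i \<noteq> 0}) * (Const (of_nat d - 1) * f) - 2 * (Const (of_nat e) * f)"
    by (simp add: sum_subtractf euler_identity[OF assms] flip: sum_distrib_left)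
  also have "\<dots> = Const (of_nat (card {i. a i \<noteq> 0}) * (of_nat d - 1) - 2 * of_nat e) * f"
    by (simp add: Const_diff Const_mult Const_add algebra_simps)
  finally show ?thesis .
qed

lemma lowering_linear_form_power_times:
  fixes f :: "('n::finite, 'k::field) mpoly" and d :: nat
  assumes f: "\<And>m. lookup f m \<noteq> 0 \<Longrightarrow> support_degree a m = e"
  defines "N \<equiv> of_nat (card {i. a i \<noteq> 0}) * (of_nat d - 1)"
  shows "lowering d a (linear_form a ^ Suc s * f) = linear_form a ^ Suc s * lowering d a f
    + Const (of_nat (Suc s) * (N - 2 * of_nat e - of_nat s)) * (linear_form a ^ s * f)"
proof (induction s)
  case 0
  show ?case using lowering_linear_form_times[OF f, where d = d] by (simp add: N_def)
next
  case (Suc s)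
  let ?L = "linear_form a"
  have deg: "support_degree a m = e + r" if "lookup (?L ^ r * f) m \<noteq> 0" for m r
    using that
  proof (induction r arbitrary: m)
    case (Suc r)
    then show ?case
      using support_degree_linear_form_times[of "?L ^ r * f" a "e + r" m] by (simp add: mult.assoc)
  qed (use f in simp)
  have "lowering d a (?L ^ Suc (Suc s) * f) = lowering d a (?L * (?L ^ Suc s * f))"
    by (simp add: mult.assoc)
  also have "\<dots> = ?L * lowering d a (?L ^ Suc s * f)
      + Const (N - 2 * of_nat (e + Suc s)) * (?L ^ Suc s * f)"
    unfolding N_def by (rule lowering_linear_form_times) (rule deg)
  also have "\<dots> = ?L ^ Suc (Suc s) * lowering d a f
      + (Const (of_nat (Suc s) * (N - 2 * of_nat e - of_nat s)) + Const (N - 2 * of_nat (e + Suc s)))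
        * (?L ^ Suc s * f)"
    unfolding Suc.IH by (simp only: power_Suc distrib_left distrib_right mult.assoc mult.left_commute add.assoc)
  also have "Const (of_nat (Suc s) * (N - 2 * of_nat e - of_nat s)) + Const (N - 2 * of_nat (e + Suc s))
      = (Const (of_nat (Suc (Suc s)) * (N - 2 * of_nat e - of_nat (Suc s))) :: ('n, 'k) mpoly)"
    unfolding Const_add[symmetric] by (rule arg_cong[of _ _ Const]) (simp add: algebra_simps)
  finally show ?case .
qed

text \<open>If \<open>L\<^sup>s\<^sup>+\<^sup>1 f\<close> is in the ideal, then so is its image under the lowering operator, which is
  \<open>L\<^sup>s\<^sup>+\<^sup>1\<close> times the lowered \<open>f\<close> plus \<open>c L\<^sup>s f\<close>. Multiplying by \<open>L\<close> removes the second summand, so by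
  induction on the degree the lowered \<open>f\<close> is in the ideal, hence so is \<open>c L\<^sup>s f\<close>. The bound on
  \<open>2 e + s\<close> says that \<open>c \<noteq> 0\<close> all the way down to \<open>s = 0\<close>, and it is preserved when the degree drops by one
  and \<open>s\<close> grows by one.\<close>

theorem strong_lefschetz_monomial_complete_intersection:
  fixes f :: "('n::finite, 'k::field_char_0) mpoly"
  assumes "d > 0"
    and "\<And>m. lookup f m \<noteq> 0 \<Longrightarrow> support_degree a m = e"
    and "2 * e + s \<le> card {i. a i \<noteq> 0} * (d - 1)"
    and "linear_form a ^ s * f \<in> power_ideal d"
  shows "f \<in> power_ideal d"
  using assms(2-)
proof (induction e arbitrary: f s rule: less_induct)
  case (less e)
  let ?L = "linear_form a"
  show ?case using less.prems
  proof (induction s)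
    case 0
    then show ?case by simp
  next
    case (Suc s)
    let ?N = "card {i. a i \<noteq> 0} * (d - 1)"
    define c :: 'k where "c = of_nat (Suc s) * (of_nat (card {i. a i \<noteq> 0}) * (of_nat d - 1)
      - 2 * of_nat e - of_nat s)"
    have "of_nat ?N - 2 * of_nat e - of_nat s = (of_nat (?N - 2 * e - s) :: 'k)"
      using Suc.prems(2) by (simp add: of_nat_diff)
    moreover have "of_nat ?N = of_nat (card {i. a i \<noteq> 0}) * (of_nat d - 1 :: 'k)"
      using \<open>d > 0\<close> by (simp add: of_nat_diff)
    ultimately have "c = of_nat (Suc s * (?N - 2 * e - s))"
      unfolding c_def of_nat_mult[of "Suc s"] by metis
    moreover have "Suc s * (?N - 2 * e - s) \<noteq> 0" using Suc.prems(2) by simp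
    ultimately have c: "c \<noteq> 0" by (simp only: of_nat_eq_0_iff not_False_eq_True)
    have eq: "lowering d a (?L ^ Suc s * f) = ?L ^ Suc s * lowering d a f + Const c * (?L ^ s * f)"
      unfolding c_def by (rule lowering_linear_form_power_times) (rule Suc.prems(1))
    have "lowering d a (?L ^ Suc s * f) \<in> power_ideal d"
      by (rule lowering_power_ideal) (rule Suc.prems)
    then have "?L * lowering d a (?L ^ Suc s * f) - Const c * (?L ^ Suc s * f) \<in> power_ideal d"
      by (intro power_ideal_diff power_ideal_mult Suc.prems)
    then have *: "?L ^ Suc (Suc s) * lowering d a f \<in> power_ideal d"
      unfolding eq by (simp add: algebra_simps)
    have "lowering d a f \<in> power_ideal d"
    proof (cases "e = 0")
      case True
      have "lookup (lowering d a f) m = 0" for m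
        using support_degree_lowering[of d a f m] Suc.prems(1) True by (metis nat.distinct(1))
      then show ?thesis by (simp add: power_ideal_def)
    next
      case False
      show ?thesis
      proof (rule less.IH[OF _ _ _ *])
        show "e - 1 < e" using False by simp
        show "support_degree a m = e - 1" if "lookup (lowering d a f) m \<noteq> 0" for m
          using support_degree_lowering[OF that] Suc.prems(1) by (metis diff_Suc_1)
        show "2 * (e - 1) + Suc (Suc s) \<le> ?N" using Suc.prems(2) False by linarith
      qed
    qed
    then have "lowering d a (?L ^ Suc s * f) - ?L ^ Suc s * lowering d a f \<in> power_ideal d"
      using lowering_power_ideal[OF Suc.prems(3)] by (intro power_ideal_diff power_ideal_mult)
    then have "Const c * (?L ^ s * f) \<in> power_ideal d" unfolding eq by simp
    then have "?L ^ s * f \<in> power_ideal d" using c power_ideal_Const_times_cancel by blast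
    then show ?case using Suc.IH Suc.prems by simp
  qed
qed

lemma support_degree_full: "(\<And>i. a i \<noteq> 0) \<Longrightarrow> support_degree a m = mdegree m"
  by (simp add: support_degree_def mdegree_def)

section \<open>Counting monomials\<close>

definition box_monomials :: "nat \<Rightarrow> nat \<Rightarrow> ('n::finite \<Rightarrow>\<^sub>0 nat) set" where
  "box_monomials d e = {m. mdegree m = e \<and> (\<forall>i. lookup m i < d)}"

lemma inj_lookup: "inj lookup"
  by (simp add: inj_def poly_mapping_eqI)

lemma finite_bounded_exponents: "finite {m :: 'n::finite \<Rightarrow>\<^sub>0 nat. \<forall>i. lookup m i \<le> b}"
proof (rule finite_imageD)
  have "lookup ` {m :: 'n \<Rightarrow>\<^sub>0 nat. \<forall>i. lookup m i \<le> b} \<subseteq> PiE UNIV (\<lambda>_. {..b})"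
    by auto
  then show "finite (lookup ` {m :: 'n \<Rightarrow>\<^sub>0 nat. \<forall>i. lookup m i \<le> b})"
    by (rule finite_subset) (simp add: finite_PiE)
  show "inj_on lookup {m :: 'n \<Rightarrow>\<^sub>0 nat. \<forall>i. lookup m i \<le> b}"
    using inj_lookup inj_on_subset by blast
qed

lemma lookup_le_mdegree: "lookup m i \<le> mdegree m"
  unfolding mdegree_def by (rule member_le_sum) simp_all

lemma finite_mdegree: "finite {m :: 'n::finite \<Rightarrow>\<^sub>0 nat. mdegree m = e}"
  by (rule finite_subset[OF _ finite_bounded_exponents[of e]]) (auto simp: lookup_le_mdegree)

lemma finite_box_monomials: "finite (box_monomials d e)"
  unfolding box_monomials_def by (rule finite_subset[OF _ finite_mdegree[of e]]) auto

text \<open>The generating function of the Hilbert function of \<open>R/(x\<^sub>1\<^sup>d, \<dots>, x\<^sub>n\<^sup>d)\<close>.\<close>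

lemma card_box_monomials:
  "(of_nat (card (box_monomials d e :: ('n::finite \<Rightarrow>\<^sub>0 nat) set)) :: real)
    = fps_nth ((\<Sum>r<d. fps_X ^ r) ^ CARD('n)) e"
proof -
  let ?G = "PiE (UNIV :: 'n set) (\<lambda>_. {..<d})"
  have img: "lookup ` (box_monomials d e :: ('n \<Rightarrow>\<^sub>0 nat) set) = {g \<in> ?G. (\<Sum>i\<in>UNIV. g i) = e}"
  proof -
    have "g \<in> lookup ` box_monomials d e" if "g \<in> ?G" "(\<Sum>i\<in>UNIV. g i) = e" for g :: "'n \<Rightarrow> nat"
    proof -
      have "lookup (Abs_poly_mapping g) = g" by simp
      then show ?thesis using that
        by (intro image_eqI[of _ _ "Abs_poly_mapping g"])
           (auto simp: box_monomials_def mdegree_def PiE_iff)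
    qed
    then show ?thesis by (auto simp: box_monomials_def mdegree_def)
  qed
  have "card (box_monomials d e :: ('n \<Rightarrow>\<^sub>0 nat) set) = card {g \<in> ?G. (\<Sum>i\<in>UNIV. g i) = e}"
    unfolding img[symmetric] using inj_lookup by (intro card_image[symmetric]) (auto intro: inj_on_subset)
  moreover have "(\<Sum>r<d. fps_X ^ r) ^ CARD('n) = (\<Prod>i\<in>(UNIV :: 'n set). \<Sum>r<d. fps_X ^ r :: real fps)"
    by simp
  moreover have "\<dots> = (\<Sum>g\<in>?G. \<Prod>i\<in>UNIV. fps_X ^ g i)"
    by (rule prod_sum_PiE) auto
  moreover have "\<dots> = (\<Sum>g\<in>?G. fps_X ^ (\<Sum>i\<in>UNIV. g i))"
    by (simp add: power_sum)
  moreover have "fps_nth \<dots> e = (\<Sum>g\<in>?G. if (\<Sum>i\<in>UNIV. g i) = e then 1 else 0)"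
    by (auto simp: fps_sum_nth fps_X_power_nth intro!: sum.cong)
  moreover have "\<dots> = of_nat (card {g \<in> ?G. (\<Sum>i\<in>UNIV. g i) = e})"
    by (simp add: sum.inter_filter[symmetric] finite_PiE)
  ultimately show ?thesis by simp
qed

lemma choose_5: "real (n choose 5) = n * (n - 1 :: real) * (n - 2) * (n - 3) * (n - 4) / 120"
  by (simp add: binomial_gbinomial gbinomial_prod_rev eval_nat_numeral algebra_simps fact_numeral)

text \<open>The left-hand side is the coefficient of \<open>X\<^sup>j\<close> in
  \<open>(1 - X) (1 - X\<^sup>d) (1 + X + \<dots> + X\<^sup>d\<^sup>-\<^sup>1)\<^sup>7 = (1 - X\<^sup>d)\<^sup>8 / (1 - X)\<^sup>6\<close>, and the right-hand side is its
  binomial expansion. It expresses \<open>dim [A]\<^sub>j - dim [A]\<^sub>j\<^sub>-\<^sub>1\<close> as long as \<open>L\<^sup>d\<close> acts injectively.\<close>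

lemma second_difference_card_box_monomials:
  fixes d j :: nat
  defines "n \<equiv> \<lambda>e. real (card (box_monomials d e :: (7 \<Rightarrow>\<^sub>0 nat) set))"
  assumes "d < j" "j < 4 * d"
  shows "n j - n (j - 1) - n (j - d) + n (j - d - 1)
    = (\<Sum>k<4. if k * d \<le> j then (-1) ^ k * real (8 choose k) * real ((j - k * d + 5) choose 5) else 0)"
proof -
  let ?X = "fps_X :: real fps"
  define P where "P = (\<Sum>r<d. ?X ^ r)"
  define Q where "Q = (1 - ?X) * (1 - ?X ^ d) * P ^ 7"
  have P: "(1 - ?X) * P = 1 - ?X ^ d"
    unfolding P_def by (simp add: one_diff_power_eq)
  have n: "n e = fps_nth (P ^ 7) e" for e
    unfolding n_def P_def by (subst card_box_monomials) simp
  have "fps_nth Q j = n j - n (j - 1) - n (j - d) + n (j - d - 1)"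
  proof -
    have "Q = P ^ 7 - ?X * P ^ 7 - ?X ^ d * P ^ 7 + ?X ^ (Suc d) * P ^ 7"
      by (simp add: Q_def algebra_simps)
    then show ?thesis using assms(2)
      by (simp add: n fps_X_power_mult_nth del: power_Suc)
  qed
  moreover have "fps_nth Q j = (\<Sum>k<4. if k * d \<le> j then
      (-1) ^ k * real (8 choose k) * real ((j - k * d + 5) choose 5) else 0)"
  proof -
    have choose_symmetric': "(5 + n) choose n = (n + 5) choose 5" for n
      using binomial_symmetric[of 5 "n + 5"] by (simp add: add.commute)
    define S where "S = Abs_fps (\<lambda>n. real ((n + 5) choose 5))"
    have "(1 - ?X) ^ 6 * S = 1"
    proof -
      have "inverse ((1 - ?X) ^ 6) = S"
        using one_minus_const_fps_X_neg_power'[of 6 "1::real"]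
        by (simp add: S_def fps_eq_iff choose_symmetric')
      moreover have "(1 - ?X) ^ 6 * inverse ((1 - ?X) ^ 6) = 1"
        by (rule inverse_mult_eq_1') (simp add: fps_nth_power_0)
      ultimately show ?thesis by simp
    qed
    then have "Q = S * ((1 - ?X) ^ 6 * Q)"
      by (metis mult.assoc mult.commute mult_1)
    also have "(1 - ?X) ^ 6 * Q = (1 - ?X ^ d) * ((1 - ?X) * P) ^ 7"
    proof -
      have "y ^ 7 = y * y ^ 6" for y :: "real fps"
        by (simp flip: power_Suc)
      then have "y ^ 6 * (y * z * p ^ 7) = z * (y * p) ^ 7" for y z p :: "real fps"
        by (simp add: power_mult_distrib mult_ac)
      then show ?thesis unfolding Q_def .
    qed
    also have "S * \<dots> = (1 - ?X ^ d) ^ 8 * S"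
      unfolding P by (simp add: mult.commute flip: power_Suc)
    also have "(1 - ?X ^ d) ^ 8 = (\<Sum>k\<le>8. fps_const ((-1) ^ k * real (8 choose k)) * ?X ^ (k * d))"
    proof -
      have "(1 - ?X ^ d) ^ 8 = (- (?X ^ d) + 1) ^ 8" by simp
      also have "\<dots> = (\<Sum>k\<le>8. of_nat (8 choose k) * (- (?X ^ d)) ^ k * 1 ^ (8 - k))"
        by (rule binomial_ring)
      also have "\<dots> = (\<Sum>k\<le>8. fps_const ((-1) ^ k * real (8 choose k)) * ?X ^ (k * d))"
      proof (rule sum.cong)
        fix k
        have "(- (?X ^ d)) ^ k = fps_const ((-1) ^ k) * ?X ^ (k * d)"
          by (subst power_minus) (simp add: power_mult[symmetric] mult.commute fps_const_power[symmetric] fps_const_neg[symmetric] del: fps_const_power fps_const_neg)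
        then show "of_nat (8 choose k) * (- (?X ^ d)) ^ k * 1 ^ (8 - k)
            = fps_const ((-1) ^ k * real (8 choose k)) * ?X ^ (k * d)"
          by (simp add: fps_of_nat[symmetric] fps_const_mult[symmetric] mult_ac del: fps_const_mult)
      qed simp
      finally show ?thesis .
    qed
    finally have "fps_nth Q j = (\<Sum>k\<le>8. if k * d \<le> j then
        (-1) ^ k * real (8 choose k) * real ((j - k * d + 5) choose 5) else 0)"
      by (auto simp: sum_distrib_right fps_sum_nth mult.assoc fps_X_power_mult_nth S_def intro!: sum.cong)
    also have "\<dots> = (\<Sum>k<4. if k * d \<le> j then
        (-1) ^ k * real (8 choose k) * real ((j - k * d + 5) choose 5) else 0)"
    proof (rule sum.mono_neutral_right)
      have "\<not> k * d \<le> j" if "k \<in> {..8} - {..<4}" for k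
      proof -
        have "4 * d \<le> k * d" using that by (intro mult_right_mono) auto
        then show ?thesis using assms by linarith
      qed
      then show "\<forall>k\<in>{..8} - {..<4}. (if k * d \<le> j then
          (-1) ^ k * real (8 choose k) * real ((j - k * d + 5) choose 5) else 0) = 0"
        by simp
    qed auto
    finally show ?thesis .
  qed
  ultimately show ?thesis by simp
qed

text \<open>The degree \<open>j\<close> has to be large enough for the Hilbert function to have stopped growing, which happens
  near \<open>3.14 d\<close> for large \<open>d\<close>, and small enough for the form of \<open>exists_form_with_high_multiplicities\<close>
  to exist; \<open>j = 10 q + 3 r\<close>, about \<open>10 (d - 1) / 3\<close>, satisfies both.\<close>

lemma second_difference_nonpos:
  fixes q r :: nat
  assumes "q \<ge> 1" "r \<le> 2"
  defines "d \<equiv> 3 * q + r + 1" and "j \<equiv> 10 * q + 3 * r"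
  defines "n \<equiv> \<lambda>e. card (box_monomials d e :: (7 \<Rightarrow>\<^sub>0 nat) set)"
  shows "n j + n (j - d - 1) \<le> n (j - 1) + n (j - d)"
proof -
  have dj: "d < j" "j < 4 * d" using assms by auto
  have s: "real (n j) - real (n (j - 1)) - real (n (j - d)) + real (n (j - d - 1))
    = (\<Sum>k<4. if k * d \<le> j then (-1) ^ k * real (8 choose k) * real ((j - k * d + 5) choose 5) else 0)"
    unfolding n_def by (rule second_difference_card_box_monomials[OF dj])
  have k3: "(if 3 * d \<le> j then real ((j - 3 * d + 5) choose 5) else 0) = real ((q + 2) choose 5)"
    using assms(1,2) by (auto simp: d_def j_def)
  have "(\<Sum>k<4. if k * d \<le> j then (-1) ^ k * real (8 choose k) * real ((j - k * d + 5) choose 5) else 0)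
    = real ((10 * q + 3 * r + 5) choose 5) - 8 * real ((7 * q + 2 * r + 4) choose 5)
      + 28 * real ((4 * q + r + 3) choose 5) - 56 * real ((q + 2) choose 5)"
  proof -
    have "j - 2 * d + 5 = 4 * q + r + 3" "2 * d \<le> j" "j - d + 5 = 7 * q + 2 * r + 4" "d \<le> j"
      using assms(1,2) by (auto simp: d_def j_def)
    moreover have "(\<Sum>k<4. g k) = g 0 + g 1 + g 2 + g 3" for g :: "nat \<Rightarrow> real"
      by (simp add: eval_nat_numeral)
    moreover have "8 choose 2 = 28" "8 choose 3 = 56"
      by (simp_all add: eval_nat_numeral)
    moreover have "j + 5 = 10 * q + 3 * r + 5" by (simp add: j_def)
    ultimately show ?thesis using k3 by (simp split: if_splits)
  qed
  also have "\<dots> \<le> 0"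
  proof -
    \<comment> \<open>As a polynomial in \<open>p = q - 1\<close> the quintic has only negative coefficients, for each of the three \<open>r\<close>.\<close>
    obtain p where p: "q = Suc p" using assms(1) by (cases q) auto
    have "r = 0 \<or> r = 1 \<or> r = 2" using assms(2) by auto
    then show ?thesis
      by (elim disjE) (simp_all add: p choose_5 field_simps, (rule order_trans[of _ 0], simp, simp)+)
  qed
  finally show ?thesis using s by linarith
qed

section \<open>Maximal rank in terms of ideal membership\<close>

abbreviation powers_ideal :: "nat \<Rightarrow> ('n::finite, 'k::field) mpoly \<Rightarrow> ('n, 'k) mpoly set" where
  "powers_ideal d L \<equiv> ideal_gen (range (\<lambda>i. Var i ^ d) \<union> {L ^ d})"

lemma Var_power: "Var i ^ d = power_product (single i d)"
  by (induction d) (simp_all add: Var_def mult_single flip: single_add)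

text \<open>The ideal is \<open>(x\<^sub>1\<^sup>d, \<dots>, x\<^sub>n\<^sup>d) + (L\<^sup>d)\<close>, and the first summand is visible on coefficients.\<close>

lemma mem_powers_ideal_iff:
  fixes f :: "('n::finite, 'k::field) mpoly"
  shows "f \<in> powers_ideal d L \<longleftrightarrow> (\<exists>g. f - L ^ d * g \<in> power_ideal d)"
proof -
  interpret M: module "(*) :: ('n, 'k) mpoly \<Rightarrow> _ \<Rightarrow> _" by (rule module_self)
  let ?G = "range (\<lambda>i. Var i ^ d) \<union> {L ^ d} :: ('n, 'k) mpoly set"
  show ?thesis
  proof
    assume "f \<in> powers_ideal d L"
    then have "f \<in> M.span ?G" by (simp add: ideal_gen_def)
    then show "\<exists>g. f - L ^ d * g \<in> power_ideal d"
    proof (induction f rule: M.span_induct_alt)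
      case base
      show ?case by (intro exI[of _ 0]) simp
    next
      case (step p x f)
      then obtain g where g: "f - L ^ d * g \<in> power_ideal d" by blast
      from step(1) show ?case
      proof
        assume "x \<in> range (\<lambda>i. Var i ^ d)"
        then obtain i where "x = Var i ^ d" by blast
        then have "x \<in> power_ideal d"
          by (auto simp: Var_power power_ideal_def lookup_single when_def)
        then have "p * x + (f - L ^ d * g) \<in> power_ideal d"
          by (intro power_ideal_add power_ideal_mult g)
        then show ?thesis by (intro exI[of _ g]) (simp add: algebra_simps)
      next
        assume "x \<in> {L ^ d}"
        then show ?thesis using g
          by (intro exI[of _ "g + p"]) (simp add: algebra_simps)
      qed
    qed
  next
    assume "\<exists>g. f - L ^ d * g \<in> power_ideal d"
    then obtain g where g: "f - L ^ d * g \<in> power_ideal d" by blast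
    have "single m (lookup h m) \<in> M.span ?G" if h: "h \<in> power_ideal d" and m: "m \<in> keys h" for h m
    proof -
      have "\<not> (\<forall>i. lookup m i < d)" using h m by (auto simp: power_ideal_def in_keys_iff)
      then obtain i where i: "lookup m i \<ge> d" by (auto simp: not_less)
      have "(m - single i d) + single i d = m"
        by (rule poly_mapping_eqI) (use i in \<open>auto simp: lookup_add lookup_minus lookup_single when_def\<close>)
      then have "single m (lookup h m) = single (m - single i d) (lookup h m) * Var i ^ d"
        by (simp add: Var_power mult_single)
      then show ?thesis by (auto intro: M.span_scale M.span_base)
    qed
    then have "f - L ^ d * g \<in> M.span ?G"
      by (subst sum_of_monomials[symmetric]) (intro M.span_sum, use g in blast)
    moreover have "g * L ^ d \<in> M.span ?G"
      by (intro M.span_scale M.span_base) simp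
    ultimately have "(f - L ^ d * g) + g * L ^ d \<in> M.span ?G" by (rule M.span_add)
    then show "f \<in> powers_ideal d L" by (simp add: ideal_gen_def algebra_simps)
  qed
qed

lemma coset_eq_iff: "f +o ideal_gen G = g +o ideal_gen G \<longleftrightarrow> f - g \<in> ideal_gen G"
  for f g :: "'a::comm_ring_1"
proof -
  interpret M: module "(*) :: 'a \<Rightarrow> 'a \<Rightarrow> 'a" by (rule module_self)
  have mem: "h \<in> f +o ideal_gen G \<longleftrightarrow> h - f \<in> ideal_gen G" for f h
    by (force simp: elt_set_plus_def)
  have "0 \<in> ideal_gen G" by (simp add: ideal_gen_def M.span_zero)
  then have "f \<in> f +o ideal_gen G" by (simp add: mem)
  moreover have "h - g \<in> ideal_gen G \<longleftrightarrow> h - f \<in> ideal_gen G" if "f - g \<in> ideal_gen G" for h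
    using that M.span_add[of "h - f" G "f - g"] M.span_diff[of "h - g" G "f - g"]
    by (auto simp: ideal_gen_def)
  ultimately show ?thesis using mem by blast
qed

lemma inj_on_quot_mult_iff:
  "inj_on (quot_mult (ideal_gen G) l) (quot_part (ideal_gen G) t)
    \<longleftrightarrow> (\<forall>f\<in>graded_part t. l * f \<in> ideal_gen G \<longrightarrow> f \<in> ideal_gen G)"
proof
  assume inj: "inj_on (quot_mult (ideal_gen G) l) (quot_part (ideal_gen G) t)"
  show "\<forall>f\<in>graded_part t. l * f \<in> ideal_gen G \<longrightarrow> f \<in> ideal_gen G"
  proof (intro ballI impI)
    fix f assume f: "f \<in> graded_part t" "l * f \<in> ideal_gen G"
    then have "quot_mult (ideal_gen G) l (f +o ideal_gen G) = quot_mult (ideal_gen G) l (0 +o ideal_gen G)"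
      by (simp add: quot_mult_coset coset_eq_iff del: set_zero_plus)
    moreover have "f +o ideal_gen G \<in> quot_part (ideal_gen G) t" "0 +o ideal_gen G \<in> quot_part (ideal_gen G) t"
      using f(1) graded_part_0 by (auto simp: quot_part_def simp del: set_zero_plus)
    ultimately have "f +o ideal_gen G = 0 +o ideal_gen G" by (rule inj_onD[OF inj])
    then show "f \<in> ideal_gen G" by (simp add: coset_eq_iff del: set_zero_plus)
  qed
next
  assume *: "\<forall>f\<in>graded_part t. l * f \<in> ideal_gen G \<longrightarrow> f \<in> ideal_gen G"
  show "inj_on (quot_mult (ideal_gen G) l) (quot_part (ideal_gen G) t)"
  proof (rule inj_onI)
    fix C D assume "C \<in> quot_part (ideal_gen G) t" "D \<in> quot_part (ideal_gen G) t"
      and eq: "quot_mult (ideal_gen G) l C = quot_mult (ideal_gen G) l D"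
    then obtain f g where fg: "f \<in> graded_part t" "g \<in> graded_part t"
      "C = f +o ideal_gen G" "D = g +o ideal_gen G" by (auto simp: quot_part_def)
    then have "l * (f - g) \<in> ideal_gen G"
      using eq by (simp add: quot_mult_coset coset_eq_iff right_diff_distrib)
    then show "C = D" using * fg by (simp add: coset_eq_iff graded_part_diff)
  qed
qed

lemma quot_mult_image_eq_iff:
  assumes "l \<in> graded_part 1"
  shows "quot_mult (ideal_gen G) l ` quot_part (ideal_gen G) t = quot_part (ideal_gen G) (t + 1)
    \<longleftrightarrow> (\<forall>h\<in>graded_part (t + 1). \<exists>f\<in>graded_part t. h - l * f \<in> ideal_gen G)"
proof -
  have "l * f \<in> graded_part (t + 1)" if "f \<in> graded_part t" for f
    using graded_part_mult[OF assms that] by (simp add: add.commute)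
  then have "quot_mult (ideal_gen G) l ` quot_part (ideal_gen G) t \<subseteq> quot_part (ideal_gen G) (t + 1)"
    by (auto simp: quot_part_def quot_mult_coset)
  moreover have "quot_part (ideal_gen G) (t + 1) \<subseteq> quot_mult (ideal_gen G) l ` quot_part (ideal_gen G) t
    \<longleftrightarrow> (\<forall>h\<in>graded_part (t + 1). \<exists>f\<in>graded_part t. h +o ideal_gen G = (l * f) +o ideal_gen G)"
    by (auto simp: quot_part_def quot_mult_coset subset_iff image_iff)
  ultimately have "quot_mult (ideal_gen G) l ` quot_part (ideal_gen G) t = quot_part (ideal_gen G) (t + 1)
    \<longleftrightarrow> (\<forall>h\<in>graded_part (t + 1). \<exists>f\<in>graded_part t. h +o ideal_gen G = (l * f) +o ideal_gen G)"
    by blast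
  then show ?thesis by (simp only: coset_eq_iff)
qed

text \<open>Taking homogeneous components, the cofactor of \<open>L\<^sup>d\<close> can be chosen homogeneous.\<close>

lemma mem_powers_ideal_homogeneous:
  assumes "f \<in> homogeneous t" "L \<in> homogeneous 1" "f \<in> powers_ideal d L"
  obtains g where "f - L ^ d * g \<in> power_ideal d" "g \<in> homogeneous (t - d)" "t < d \<Longrightarrow> g = 0"
proof -
  obtain g where "f - L ^ d * g \<in> power_ideal d"
    using assms(3) mem_powers_ideal_iff by blast
  then have "component t (f - L ^ d * g) \<in> power_ideal d" by (rule power_ideal_restrict)
  moreover have "component t (L ^ d * g) = (if d \<le> t then L ^ d * component (t - d) g else 0)"
    using homogeneous_power[OF assms(2), of d] by (intro component_mult) simp
  ultimately have *: "f - (if d \<le> t then L ^ d * component (t - d) g else 0) \<in> power_ideal d"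
    using assms(1) by (simp add: restrict_monomials_diff component_of_homogeneous)
  show ?thesis
  proof (rule that[of "if d \<le> t then component (t - d) g else 0"])
    show "(if d \<le> t then component (t - d) g else 0) \<in> homogeneous (t - d)"
      using component_homogeneous[of "t - d" g] by (cases "d \<le> t") (simp_all del: of_nat_diff)
  qed (use * in \<open>auto split: if_splits\<close>)
qed

section \<open>Apolarity\<close>

definition directional :: "('n::finite \<Rightarrow> 'k::field) \<Rightarrow> ('n, 'k) mpoly \<Rightarrow> ('n, 'k) mpoly" where
  "directional v f = (\<Sum>i\<in>UNIV. Const (v i) * pderiv_at i f)"

lemma directional_add: "directional v (f + g) = directional v f + directional v g"
  by (simp add: directional_def pderiv_at_add distrib_left sum.distrib)

lemma directional_0 [simp]: "directional v 0 = 0"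
  by (simp add: directional_def)

lemma directional_mult: "directional v (f * g) = directional v f * g + f * directional v g"
  by (simp add: directional_def pderiv_at_mult distrib_left sum.distrib sum_distrib_left
      sum_distrib_right algebra_simps)

lemma directional_Const [simp]: "directional v (Const c) = 0"
  by (simp add: directional_def)

lemma directional_1 [simp]: "directional v 1 = 0"
  using directional_Const[of v 1] by simp

lemma directional_numeral [simp]: "directional v (numeral n) = 0"
  using directional_Const[of v "numeral n"] by (simp del: directional_Const)

lemma directional_diff: "directional v (f - g) = directional v f - directional v g"
  using directional_add[of v "f - g" g] by simp

lemma Const_sum: "Const (sum h A) = (\<Sum>i\<in>A. Const (h i))"
  by (induction A rule: infinite_finite_induct) (simp_all add: Const_add)

lemma directional_linear_form: "directional v (linear_form c) = Const (\<Sum>i\<in>UNIV. v i * c i)"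
  by (simp add: directional_def pderiv_at_linear_form Const_mult Const_sum)

lemma directional_unit: "directional (\<lambda>j. if j = i then 1 else 0) f = pderiv_at i f"
  by (simp add: directional_def if_distrib[of Const] if_distrib[of "\<lambda>x. x * _"] cong: if_cong)

definition exponent_factorial :: "('n::finite \<Rightarrow>\<^sub>0 nat) \<Rightarrow> 'k::field_char_0" where
  "exponent_factorial m = (\<Prod>i\<in>UNIV. fact (lookup m i))"

text \<open>The pairing of degree \<open>j\<close> polynomials in which the monomials act on each other by differentiation.
  Multiplication by a linear form is adjoint to the derivative in its direction.\<close>

definition apolar :: "nat \<Rightarrow> ('n::finite, 'k::field_char_0) mpoly \<Rightarrow> ('n, 'k) mpoly \<Rightarrow> 'k" where
  "apolar j f F = (\<Sum>m | mdegree m = j. lookup f m * lookup F m * exponent_factorial m)"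

lemma exponent_factorial_add_unit_exp:
  "exponent_factorial (m + unit_exp i) = of_nat (lookup m i + 1) * (exponent_factorial m :: 'k::field_char_0)"
proof -
  have "(exponent_factorial (m + unit_exp i) :: 'k)
      = fact (lookup (m + unit_exp i) i) * (\<Prod>j\<in>UNIV - {i}. fact (lookup (m + unit_exp i) j))"
    unfolding exponent_factorial_def by (rule prod.remove) simp_all
  also have "(\<Prod>j\<in>UNIV - {i}. fact (lookup (m + unit_exp i) j)) = (\<Prod>j\<in>UNIV - {i}. fact (lookup m j) :: 'k)"
    by (rule prod.cong) (auto simp: lookup_add lookup_single when_def)
  also have "fact (lookup (m + unit_exp i) i) = of_nat (lookup m i + 1) * (fact (lookup m i) :: 'k)"
    by (simp add: lookup_add algebra_simps)
  also have "of_nat (lookup m i + 1) * fact (lookup m i) * (\<Prod>j\<in>UNIV - {i}. fact (lookup m j) :: 'k)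
      = of_nat (lookup m i + 1) * exponent_factorial m"
    unfolding exponent_factorial_def by (subst (2) prod.remove[of _ i]) (simp_all add: mult.assoc)
  finally show ?thesis .
qed

lemma apolar_Var_times:
  fixes f F :: "('n::finite, 'k::field_char_0) mpoly"
  shows "apolar (Suc j) (Var i * f) F = apolar j f (pderiv_at i F)"
proof -
  let ?t = "\<lambda>m. lookup (Var i * f) m * lookup F m * exponent_factorial m"
  have "apolar (Suc j) (Var i * f) F = (\<Sum>m\<in>(\<lambda>m. m + unit_exp i) ` {m. mdegree m = j}. ?t m)"
    unfolding apolar_def
  proof (rule sum.mono_neutral_right)
    show "finite {m :: 'n \<Rightarrow>\<^sub>0 nat. mdegree m = Suc j}" by (rule finite_mdegree)
    show "(\<lambda>m. m + unit_exp i) ` {m. mdegree m = j} \<subseteq> {m. mdegree m = Suc j}"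
      by (auto simp: mdegree_add)
    show "\<forall>m\<in>{m. mdegree m = Suc j} - (\<lambda>m. m + unit_exp i) ` {m. mdegree m = j}. ?t m = 0"
    proof
      fix m assume m: "m \<in> {m. mdegree m = Suc j} - (\<lambda>m. m + unit_exp i) ` {m. mdegree m = j}"
      have "lookup m i = 0"
      proof (rule ccontr)
        assume "lookup m i \<noteq> 0"
        then have eq: "m = (m - unit_exp i) + unit_exp i"
          using exponent_split[of m i] by (simp add: add.commute)
        then have "mdegree m = mdegree (m - unit_exp i) + 1"
          using mdegree_add[of "m - unit_exp i" "unit_exp i"] by simp
        then show False using m eq by auto
      qed
      then show "?t m = 0" by (simp add: lookup_Var_times)
    qed
  qed
  also have "\<dots> = (\<Sum>m | mdegree m = j. ?t (m + unit_exp i))"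
    by (subst sum.reindex) (auto intro: inj_onI)
  also have "\<dots> = apolar j f (pderiv_at i F)"
    unfolding apolar_def by (rule sum.cong) (simp_all only: exponent_factorial_add_unit_exp lookup_Var_times_add lookup_pderiv_at, simp only: mult_ac)
  finally show ?thesis .
qed

lemma apolar_add: "apolar j (f + g) F = apolar j f F + apolar j g F"
  by (simp add: apolar_def lookup_add distrib_right sum.distrib)

lemma apolar_diff: "apolar j (f - g) F = apolar j f F - apolar j g F"
  by (simp add: apolar_def lookup_minus left_diff_distrib sum_subtractf)

lemma apolar_0_left [simp]: "apolar j 0 F = 0"
  and apolar_0_right [simp]: "apolar j f 0 = 0"
  by (simp_all add: apolar_def)

lemma apolar_Const_times: "apolar j (Const c * f) F = c * apolar j f F"
  and apolar_times_Const: "apolar j f (Const c * F) = c * apolar j f F"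
  by (auto simp: apolar_def sum_distrib_left intro!: sum.cong)

lemma apolar_sum: "apolar j (sum f A) F = (\<Sum>i\<in>A. apolar j (f i) F)"
  by (induction A rule: infinite_finite_induct) (simp_all add: apolar_add)

lemma apolar_sum_right: "apolar j F (sum f A) = (\<Sum>i\<in>A. apolar j F (f i))"
  by (induction A rule: infinite_finite_induct)
     (simp_all add: apolar_def lookup_add distrib_left distrib_right sum.distrib)

lemma apolar_linear_form_times:
  "apolar (Suc j) (linear_form v * f) F = apolar j f (directional v F)"
  by (simp add: linear_form_def directional_def sum_distrib_right apolar_sum apolar_sum_right
      mult.assoc apolar_Const_times apolar_times_Const apolar_Var_times)

lemma apolar_linear_form_power_times:
  "apolar (j + s) (linear_form v ^ s * f) F = apolar j f ((directional v ^^ s) F)"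
proof (induction s arbitrary: F)
  case (Suc s)
  then show ?case
    using apolar_linear_form_times[of "j + s" v "linear_form v ^ s * f" F]
    by (simp add: mult.assoc funpow_swap1)
qed simp

lemma apolar_power_ideal:
  assumes "f \<in> power_ideal d" "\<And>m. lookup F m \<noteq> 0 \<Longrightarrow> \<forall>i. lookup m i < d"
  shows "apolar j f F = 0"
  unfolding apolar_def
proof (intro sum.neutral ballI)
  fix m show "lookup f m * lookup F m * exponent_factorial m = 0"
    using assms by (cases "lookup F m = 0") (auto simp: power_ideal_def)
qed

text \<open>In characteristic zero, \<open>\<partial>\<^sub>i\<^sup>d\<close> multiplies a monomial with exponent at least \<open>d\<close> by a nonzero number.\<close>

lemma exponents_lt_of_pderiv_power_eq_0:
  fixes F :: "('n::finite, 'k::field_char_0) mpoly"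
  assumes "(pderiv_at i ^^ d) F = 0" "lookup F m \<noteq> 0"
  shows "lookup m i < d"
proof (rule ccontr)
  assume "\<not> ?thesis"
  then have "d \<le> lookup m i" by simp
  moreover have "lookup ((pderiv_at i ^^ s) F) (m - single i s) \<noteq> 0" if "s \<le> lookup m i" for s
    using that
  proof (induction s)
    case 0
    then show ?case using assms(2) by simp
  next
    case (Suc s)
    then have "m - single i (Suc s) + unit_exp i = m - single i s"
      by (intro poly_mapping_eqI) (auto simp: lookup_add lookup_minus lookup_single when_def)
    moreover have "(of_nat (lookup (m - single i (Suc s)) i + 1) :: 'k) \<noteq> 0"
      by (simp only: of_nat_eq_0_iff)
    ultimately show ?case using Suc by (simp del: of_nat_add)
  qed
  ultimately have "lookup ((pderiv_at i ^^ d) F) (m - single i d) \<noteq> 0" by blast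
  then show False using assms(1) by simp
qed

section \<open>Degree of a form along a direction\<close>

text \<open>In characteristic zero, for the directional derivative \<open>\<delta>\<close> along \<open>v\<close>, vanishing of \<open>\<delta>\<^sup>p\<^sup>+\<^sup>1 f\<close> says that \<open>f\<close> has degree at most
  \<open>p\<close> along every line in direction \<open>v\<close>. For \<open>f\<close> homogeneous of degree \<open>j\<close> this means that the
  hypersurface \<open>f = 0\<close> has multiplicity at least \<open>j - p\<close> at the point \<open>v\<close>. These degrees add up in products.\<close>

definition degree_along :: "('n::finite \<Rightarrow> 'k::field) \<Rightarrow> nat \<Rightarrow> ('n, 'k) mpoly \<Rightarrow> bool" where
  "degree_along v p f \<longleftrightarrow> (directional v ^^ Suc p) f = 0"

lemma directional_funpow_0 [simp]: "(directional v ^^ s) 0 = 0"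
  by (induction s) simp_all

lemma directional_funpow_add:
  "(directional v ^^ s) (f + g) = (directional v ^^ s) f + (directional v ^^ s) g"
  by (induction s) (simp_all add: directional_add)

lemma degree_along_mono: "degree_along v p f \<Longrightarrow> p \<le> q \<Longrightarrow> degree_along v q f"
proof -
  assume f: "degree_along v p f" and "p \<le> q"
  then have "Suc q = (q - p) + Suc p" by simp
  then have "(directional v ^^ Suc q) f = (directional v ^^ (q - p)) ((directional v ^^ Suc p) f)"
    by (metis comp_apply funpow_add)
  then show ?thesis using f by (simp add: degree_along_def)
qed

lemma degree_along_directional: "degree_along v (Suc p) f \<longleftrightarrow> degree_along v p (directional v f)"
  by (simp add: degree_along_def funpow_swap1)

lemma degree_along_0_iff: "degree_along v 0 f \<longleftrightarrow> directional v f = 0"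
  by (simp add: degree_along_def)

lemma degree_along_zero [simp]: "degree_along v p 0"
  unfolding degree_along_def by (rule directional_funpow_0)

lemma degree_along_add: "degree_along v p f \<Longrightarrow> degree_along v p g \<Longrightarrow> degree_along v p (f + g)"
  unfolding degree_along_def directional_funpow_add by simp

text \<open>By the Leibniz rule, differentiating the product lowers one of the two degrees.\<close>

lemma degree_along_mult:
  "degree_along v p f \<Longrightarrow> degree_along v q g \<Longrightarrow> degree_along v (p + q) (f * g)"
proof (induction "p + q" arbitrary: p q f g rule: less_induct)
  case less
  have A: "degree_along v (p + q - 1) (directional v f * g)" if "p + q \<noteq> 0"
  proof (cases p)
    case 0
    then show ?thesis using less.prems(1) by (simp add: degree_along_0_iff)
  next
    case (Suc p')
    then show ?thesis using less.hyps[of p' q "directional v f" g] less.prems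
      by (simp add: degree_along_directional)
  qed
  have B: "degree_along v (p + q - 1) (f * directional v g)" if "p + q \<noteq> 0"
  proof (cases q)
    case 0
    then show ?thesis using less.prems(2) by (simp add: degree_along_0_iff)
  next
    case (Suc q')
    then show ?thesis using less.hyps[of p q' f "directional v g"] less.prems
      by (simp add: degree_along_directional)
  qed
  show ?case
  proof (cases "p + q")
    case 0
    then show ?thesis using less.prems by (simp add: degree_along_0_iff directional_mult)
  next
    case (Suc r)
    then have "degree_along v r (directional v (f * g))"
      using degree_along_add[OF A B] by (simp add: directional_mult)
    then show ?thesis using Suc by (simp add: degree_along_directional)
  qed
qed

lemma degree_along_power: "degree_along v p f \<Longrightarrow> degree_along v (p * n) (f ^ n)"
proof (induction n)
  case 0
  show ?case by (simp add: degree_along_0_iff)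
next
  case (Suc n)
  then show ?case using degree_along_mult[of v p f "p * n" "f ^ n"] by simp
qed

section \<open>Hankel determinants\<close>

text \<open>The determinant of the Hankel matrix \<open>(\<mu>\<^sub>p\<^sub>+\<^sub>q)\<close> with \<open>0 \<le> p, q \<le> 2\<close>. As a cubic in the five
  coordinates \<open>\<mu>\<^sub>0, \<dots>, \<mu>\<^sub>4\<close> it is the equation of the secant variety of the rational normal quartic.\<close>

definition hankel :: "(nat \<Rightarrow> 'a::comm_ring_1) \<Rightarrow> 'a" where
  "hankel \<mu> = \<mu> 0 * (\<mu> 2 * \<mu> 4 - \<mu> 3 * \<mu> 3) - \<mu> 1 * (\<mu> 1 * \<mu> 4 - \<mu> 2 * \<mu> 3)
     + \<mu> 2 * (\<mu> 1 * \<mu> 3 - \<mu> 2 * \<mu> 2)"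

lemma hankel_homogeneous:
  assumes "\<And>p. \<mu> p \<in> homogeneous 1"
  shows "hankel \<mu> \<in> homogeneous 3"
proof -
  have *: "\<mu> p * (\<mu> q * \<mu> r) \<in> homogeneous 3" for p q r
    using homogeneous_mult[OF assms[of p] homogeneous_mult[OF assms[of q] assms[of r]]] by simp
  show ?thesis unfolding hankel_def right_diff_distrib
    by (intro graded_part_add graded_part_diff *)
qed

text \<open>Moving along a point of the rational normal curve changes the Hankel matrix by a matrix of
  rank one, so the determinant changes linearly.\<close>

lemma hankel_degree_along_curve_point:
  assumes "\<And>p. p \<le> 4 \<Longrightarrow> directional v (\<mu> p) = Const (c * x ^ (4 - p) * y ^ p)"
  shows "degree_along v 1 (hankel \<mu>)"
proof -
  define C where "C = (\<lambda>p. Const (c * x ^ (4 - p) * y ^ p) :: ('a, 'b) mpoly)"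
  have d: "directional v (\<mu> p) = C p" if "p \<le> 4" for p
    using assms[OF that] by (simp add: C_def)
  have C0: "directional v (C p) = 0" for p by (simp add: C_def)
  \<comment> \<open>The derivatives form a Hankel matrix of rank one, so its \<open>2 \<times> 2\<close> minors vanish.\<close>
  have minors: "C 2 * C 4 = C 3 * C 3" "C 1 * C 4 = C 2 * C 3" "C 1 * C 3 = C 2 * C 2"
    "C 0 * C 4 = C 2 * C 2" "C 0 * C 3 = C 1 * C 2" "C 0 * C 2 = C 1 * C 1"
    unfolding C_def Const_mult[symmetric]
    by (rule arg_cong[of _ _ Const]; simp add: eval_nat_numeral)+
  have "directional v (directional v (hankel \<mu>))
      = 2 * (\<mu> 0 * (C 2 * C 4 - C 3 * C 3) - 2 * \<mu> 1 * (C 1 * C 4 - C 2 * C 3)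
        + \<mu> 2 * (2 * (C 1 * C 3 - C 2 * C 2) + (C 0 * C 4 - C 2 * C 2))
        - 2 * \<mu> 3 * (C 0 * C 3 - C 1 * C 2) + \<mu> 4 * (C 0 * C 2 - C 1 * C 1))"
    unfolding hankel_def
    by (simp add: directional_add directional_diff directional_mult d C0) (simp add: algebra_simps)
  also have "\<dots> = 0" unfolding minors by simp
  finally show ?thesis by (simp add: degree_along_def)
qed

lemma hankel_degree_along_vertex:
  assumes "\<And>p. p \<le> 4 \<Longrightarrow> directional v (\<mu> p) = 0"
  shows "degree_along v 0 (hankel \<mu>)"
  using assms by (simp add: degree_along_0_iff hankel_def directional_add directional_diff directional_mult)

section \<open>Evaluation\<close>

lemma eval_mpoly_superset:
  assumes "finite S" "keys f \<subseteq> S"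
  shows "eval_mpoly a f = (\<Sum>m\<in>S. lookup f m * (\<Prod>i\<in>UNIV. a i ^ lookup m i))"
  unfolding eval_mpoly_def using assms by (intro sum.mono_neutral_left) (auto simp: in_keys_iff)

lemma eval_mpoly_add: "eval_mpoly a (f + g) = eval_mpoly a f + eval_mpoly a g"
proof -
  have "keys (f + g) \<subseteq> keys f \<union> keys g" by (rule keys_add)
  then show ?thesis
    using eval_mpoly_superset[of "keys f \<union> keys g" _ a]
    by (simp add: lookup_add distrib_right sum.distrib)
qed

lemma eval_mpoly_monomial:
  "eval_mpoly a (single m c) = c * (\<Prod>i\<in>UNIV. a i ^ lookup m i)"
  using eval_mpoly_superset[of "{m}" "single m c" a] by (simp split: if_splits)

lemma eval_mpoly_mult: "eval_mpoly a (f * g) = eval_mpoly a f * eval_mpoly a g"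
proof (induction f rule: poly_induct)
  case (monomial m c)
  show ?case
  proof (induction g rule: poly_induct)
    case (monomial m' c')
    show ?case
      by (simp add: mult_single eval_mpoly_monomial lookup_add power_add prod.distrib)
  qed (simp add: distrib_left eval_mpoly_add)
qed (simp add: distrib_right eval_mpoly_add)

lemma eval_mpoly_Const [simp]: "eval_mpoly a (Const c) = c"
  by (simp add: Const_def eval_mpoly_monomial)

lemma eval_mpoly_0 [simp]: "eval_mpoly a 0 = 0" and eval_mpoly_1 [simp]: "eval_mpoly a 1 = 1"
  using eval_mpoly_Const[of a 0] eval_mpoly_Const[of a 1] by simp_all

lemma eval_mpoly_Var [simp]: "eval_mpoly a (Var i) = a i"
proof -
  have "(\<Prod>j\<in>UNIV. a j ^ lookup (unit_exp i) j) = (\<Prod>j\<in>UNIV. if j = i then a j else 1)"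
    by (rule prod.cong) (auto simp: lookup_single when_def)
  then show ?thesis by (simp add: Var_def eval_mpoly_monomial)
qed

lemma eval_mpoly_diff: "eval_mpoly a (f - g) = eval_mpoly a f - eval_mpoly a g"
  using eval_mpoly_add[of a "f - g" g] by simp

lemma eval_mpoly_sum: "eval_mpoly a (sum f A) = (\<Sum>x\<in>A. eval_mpoly a (f x))"
  by (induction A rule: infinite_finite_induct) (simp_all add: eval_mpoly_add)

lemma eval_mpoly_prod: "eval_mpoly a (prod f A) = (\<Prod>x\<in>A. eval_mpoly a (f x))"
  by (induction A rule: infinite_finite_induct) (simp_all add: eval_mpoly_mult)

lemma eval_mpoly_linear_form: "eval_mpoly a (linear_form c) = (\<Sum>i\<in>UNIV. c i * a i)"
  by (simp add: linear_form_def eval_mpoly_sum eval_mpoly_mult)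

lemma eval_mpoly_hankel: "eval_mpoly a (hankel \<mu>) = hankel (\<lambda>p. eval_mpoly a (\<mu> p))"
  by (simp add: hankel_def eval_mpoly_add eval_mpoly_diff eval_mpoly_mult)

text \<open>A Hankel matrix built from three points is \<open>V\<^sup>T D V\<close> with \<open>V\<close> a Vandermonde matrix and \<open>D\<close> diagonal.\<close>

lemma hankel_three_points:
  fixes A B C \<alpha> \<beta> \<gamma> :: "'a::comm_ring_1"
  shows "hankel (\<lambda>p. A * \<alpha> ^ p + B * \<beta> ^ p + C * \<gamma> ^ p)
    = A * B * C * ((\<alpha> - \<beta>) * (\<beta> - \<gamma>) * (\<alpha> - \<gamma>)) ^ 2"
  unfolding hankel_def by (simp add: eval_nat_numeral algebra_simps)

lemma hankel_neq_0:
  fixes c s :: "'n::finite \<Rightarrow> 'k::field"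
  assumes "inj s" "card {i. c i \<noteq> 0} \<ge> 3"
  shows "hankel (\<lambda>p. linear_form (\<lambda>i. c i * s i ^ p)) \<noteq> 0"
proof -
  obtain T where T: "T \<subseteq> {i. c i \<noteq> 0}" "card T = 3"
    using assms(2) by (meson obtain_subset_with_card_n)
  then obtain i j k where ijk: "T = {i, j, k}" "i \<noteq> j" "j \<noteq> k" "i \<noteq> k"
    by (auto simp: card_3_iff)
  define y where "y = (\<lambda>l. if l \<in> T then 1 else 0 :: 'k)"
  have "(\<Sum>l\<in>UNIV. f l * y l) = f i + f j + f k" for f
  proof -
    have "(\<Sum>l\<in>UNIV. f l * y l) = (\<Sum>l\<in>T. f l)"
      unfolding y_def by (simp add: if_distrib[of "\<lambda>x. _ * x"] sum.If_cases)
    then show ?thesis using ijk by (simp add: add.assoc)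
  qed
  then have "eval_mpoly y (hankel (\<lambda>p. linear_form (\<lambda>i. c i * s i ^ p)))
      = hankel (\<lambda>p. c i * s i ^ p + c j * s j ^ p + c k * s k ^ p)"
    by (simp add: eval_mpoly_hankel eval_mpoly_linear_form)
  also have "\<dots> \<noteq> 0"
    unfolding hankel_three_points using T ijk injD[OF assms(1)] by auto
  finally show ?thesis by auto
qed

section \<open>Power sums of partial fractions\<close>

text \<open>The barycentric weights of Lagrange interpolation at the nodes \<open>t\<^sub>i\<close>.\<close>

definition node_weight :: "('n::finite \<Rightarrow> 'k::field) \<Rightarrow> 'n \<Rightarrow> 'k" where
  "node_weight t i = inverse (\<Prod>j\<in>UNIV - {i}. t i - t j)"

lemma node_weight_neq_0: "inj t \<Longrightarrow> node_weight t i \<noteq> 0"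
  by (auto simp: node_weight_def dest: injD)

text \<open>The sum is the leading coefficient of the Lagrange interpolant of \<open>X\<^sup>p\<close>, which is \<open>X\<^sup>p\<close> itself.\<close>

lemma sum_node_weight_powers:
  fixes t :: "'n::finite \<Rightarrow> 'k::field"
  assumes t: "inj t" and p: "p < CARD('n)"
  shows "(\<Sum>i\<in>UNIV. node_weight t i * t i ^ p) = (if p = CARD('n) - 1 then 1 else 0)"
proof -
  define N where "N i = (\<Prod>j\<in>UNIV - {i}. [:- t j, 1:])" for i
  define P where "P = (\<Sum>i\<in>UNIV. Polynomial.smult (node_weight t i * t i ^ p) (N i))"
  have degN: "degree (N i) = CARD('n) - 1" for i
    unfolding N_def by (subst degree_prod_sum_eq) (simp_all add: card_Diff_singleton)
  have leadN: "Polynomial.coeff (N i) (CARD('n) - 1) = 1" for i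
    using degN[of i] lead_coeff_prod[of "\<lambda>j. [:- t j, 1:]" "UNIV - {i}"] by (simp add: N_def)
  have polyN: "poly (N i) (t k) = (if i = k then inverse (node_weight t k) else 0)" for i k
    by (auto simp: N_def poly_prod node_weight_def)
  have "P = Polynomial.monom 1 p"
  proof (rule poly_eqI_degree[where A = "range t"])
    have "poly P (t k) = poly (Polynomial.monom 1 p) (t k)" for k
    proof -
      have "poly P (t k) = (\<Sum>i\<in>UNIV. if i = k then node_weight t k * t k ^ p * inverse (node_weight t k) else 0)"
        unfolding P_def poly_sum by (rule sum.cong) (auto simp: polyN)
      then show ?thesis using node_weight_neq_0[OF t, of k] by (simp add: poly_monom)
    qed
    then show "\<And>x. x \<in> range t \<Longrightarrow> poly P x = poly (Polynomial.monom 1 p) x" by auto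
    have "degree P \<le> CARD('n) - 1"
      unfolding P_def by (intro degree_sum_le) (auto intro!: order_trans[OF degree_smult_le] simp: degN)
    then show "card (range t) > degree P" using card_image[OF t] p by simp
    show "card (range t) > degree (Polynomial.monom (1::'k) p)"
      using card_image[OF t] p by (simp add: degree_monom_eq)
  qed
  then have "Polynomial.coeff P (CARD('n) - 1) = (if p = CARD('n) - 1 then 1 else 0)"
    by (simp add: coeff_monom)
  then show ?thesis
    by (simp add: P_def coeff_sum leadN del: One_nat_def)
qed

section \<open>A form with high multiplicity at eight points\<close>

abbreviation unit_vector :: "'n \<Rightarrow> 'n \<Rightarrow> 'k::zero_neq_one" where
  "unit_vector i \<equiv> (\<lambda>j. if j = i then 1 else 0)"

text \<open>The linear forms \<open>\<nu>\<^sub>0, \<dots>, \<nu>\<^sub>5\<close> below vanish on \<open>b\<close> and are coordinates on the quotient by \<open>b\<close>. In these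
  coordinates the \<open>i\<close>-th unit vector becomes a multiple of \<open>(1, t\<^sub>i, \<dots>, t\<^sub>i\<^sup>5)\<close> with \<open>t\<^sub>i = a\<^sub>i / b\<^sub>i\<close>, and \<open>a\<close> becomes
  \<open>(0, \<dots>, 0, 1)\<close>. All eight points lie on the rational normal curve, with \<open>a\<close> at infinity.\<close>

lemma exists_form_with_high_multiplicities:
  fixes a b :: "7 \<Rightarrow> 'k::field_char_0" and q r :: nat
  assumes b: "\<And>i. b i \<noteq> 0" and ab: "\<And>i j. i \<noteq> j \<Longrightarrow> a i * b j \<noteq> a j * b i"
  obtains F where "F \<in> homogeneous (10 * q + 3 * r)" "F \<noteq> 0" "directional b F = 0"
    "(directional a ^^ (3 * q + r + 1)) F = 0" "\<And>i. (pderiv_at i ^^ (3 * q + r + 1)) F = 0"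
proof -
  define t where "t i = a i / b i" for i
  have t: "inj t"
  proof (rule injI)
    fix i j assume "t i = t j"
    then have "a i * b j = a j * b i" using b by (simp add: t_def field_simps)
    then show "i = j" using ab by blast
  qed
  define lam where "lam i = node_weight t i / b i" for i
  have lam: "lam i \<noteq> 0" for i using node_weight_neq_0[OF t] b by (simp add: lam_def)
  define nu where "nu p = linear_form (\<lambda>i. lam i * t i ^ p)" for p
  \<comment> \<open>The cubic cone with vertex \<open>a\<close>: dropping \<open>\<nu>\<^sub>5\<close> is the projection from \<open>a\<close>.\<close>
  define Ca where "Ca = hankel nu"
  \<comment> \<open>The projection from the \<open>i\<close>-th unit vector has coordinates \<open>\<nu>\<^sub>p\<^sub>+\<^sub>1 - t\<^sub>i \<nu>\<^sub>p\<close>, and \<open>C i\<close> is the cone with that vertex.\<close>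
  define mu where "mu i p = linear_form (\<lambda>k. (lam k * (t k - t i)) * t k ^ p)" for i p
  define C where "C i = hankel (mu i)" for i
  \<comment> \<open>The hyperplane through the five unit vectors other than the vertices of \<open>C 0\<close> and \<open>C 1\<close>.\<close>
  define u :: "(7, 'k) mpoly" where "u = linear_form (\<lambda>j. if j = 0 then 1 / b 0 else if j = 1 then - (1 / b 1) else 0)"
  have mu: "mu i p = nu (Suc p) - Const (t i) * nu p" for i p
  proof -
    have coeff: "lam k * (t k - t i) * t k ^ p = lam k * t k ^ Suc p - t i * (lam k * t k ^ p)" for k
      by (simp add: algebra_simps)
    show ?thesis
      unfolding mu_def nu_def linear_form_def coeff sum_distrib_left sum_subtractf[symmetric]
      by (simp only: Const_diff Const_mult[of "t i"] left_diff_distrib mult.assoc)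
  qed
  have nu_b: "directional b (nu p) = 0" if "p \<le> 5" for p
  proof -
    have "(\<Sum>i\<in>UNIV. b i * (lam i * t i ^ p)) = (\<Sum>i\<in>UNIV. node_weight t i * t i ^ p)"
      using b by (intro sum.cong) (auto simp: lam_def)
    then show ?thesis using sum_node_weight_powers[OF t, of p] that
      by (simp add: nu_def directional_linear_form)
  qed
  have nu_a: "directional a (nu p) = (if p = 5 then 1 else 0)" if "p \<le> 5" for p
  proof -
    have "(\<Sum>i\<in>UNIV. a i * (lam i * t i ^ p)) = (\<Sum>i\<in>UNIV. node_weight t i * t i ^ Suc p)"
      using b by (intro sum.cong) (auto simp: lam_def t_def)
    then show ?thesis using sum_node_weight_powers[OF t, of "Suc p"] that
      by (simp add: nu_def directional_linear_form)
  qed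
  have unit: "directional (unit_vector k) (linear_form c) = Const (c k)" for k :: 7 and c :: "7 \<Rightarrow> 'k"
    unfolding directional_unit by (rule pderiv_at_linear_form)
  have Ca_b: "degree_along b 0 Ca" and Ca_a: "degree_along a 0 Ca"
    unfolding Ca_def by (rule hankel_degree_along_vertex; simp add: nu_b nu_a)+
  have Ca_unit: "degree_along (unit_vector k) 1 Ca" for k
    unfolding Ca_def
    by (rule hankel_degree_along_curve_point[where c = "lam k" and x = 1 and y = "t k"])
       (simp add: nu_def unit)
  have C_b: "degree_along b 0 (C i)" for i
    unfolding C_def by (rule hankel_degree_along_vertex)
      (simp add: mu directional_diff directional_mult nu_b)
  have C_a: "degree_along a 1 (C i)" for i
    unfolding C_def
    by (rule hankel_degree_along_curve_point[where c = 1 and x = 0 and y = 1])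
       (simp add: mu directional_diff directional_mult nu_a power_0_left)
  have C_unit: "degree_along (unit_vector k) 1 (C i)" for i k
    unfolding C_def
    by (rule hankel_degree_along_curve_point[where c = "lam k * (t k - t i)" and x = 1 and y = "t k"])
       (simp add: mu_def unit)
  have C_self: "degree_along (unit_vector i) 0 (C i)" for i
    unfolding C_def by (rule hankel_degree_along_vertex) (simp add: mu_def unit)
  have u1: "degree_along v 1 u" for v
    by (simp add: degree_along_def u_def directional_linear_form)
  have u_b: "degree_along b 0 u"
  proof -
    have "(\<Sum>i\<in>UNIV. b i * (if i = 0 then 1 / b 0 else if i = 1 then - (1 / b 1) else 0))
        = (\<Sum>i\<in>(UNIV :: 7 set). (if i = 0 then 1 else 0) - (if i = 1 then 1 else 0))"
      using b by (intro sum.cong) auto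
    also have "\<dots> = 0" by (simp add: sum_subtractf)
    finally show ?thesis by (simp add: degree_along_0_iff u_def directional_linear_form)
  qed
  have u_unit: "degree_along (unit_vector k) 0 u" if "k \<noteq> 0" "k \<noteq> 1" for k
    using that by (simp add: degree_along_0_iff u_def unit)
  \<comment> \<open>Degree 10, and along each of the eight points the degrees of the factors add up to three: a cone contributes nothing along its vertex, and the hyperplane nothing along the points on it.\<close>
  define G where "G = Ca * (C 0 * (C 1 * u))"
  have G_b: "degree_along b 0 G"
    using degree_along_mult[OF Ca_b degree_along_mult[OF C_b degree_along_mult[OF C_b u_b]]]
    by (simp add: G_def)
  have G_a: "degree_along a 3 G"
    using degree_along_mult[OF Ca_a degree_along_mult[OF C_a degree_along_mult[OF C_a u1]]]
    by (simp add: G_def eval_nat_numeral)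
  have G_unit: "degree_along (unit_vector k) 3 G" for k
  proof -
    consider "k = 0" | "k = 1" | "k \<noteq> 0" "k \<noteq> 1" by blast
    then show ?thesis
    proof cases
      case 1
      then show ?thesis
        using degree_along_mult[OF Ca_unit degree_along_mult[OF C_self degree_along_mult[OF C_unit u1]], of 0 1]
        by (simp add: G_def eval_nat_numeral)
    next
      case 2
      then show ?thesis
        using degree_along_mult[OF Ca_unit degree_along_mult[OF C_unit degree_along_mult[OF C_self u1]], of 1 0]
        by (simp add: G_def eval_nat_numeral)
    next
      case 3
      then show ?thesis
        using degree_along_mult[OF Ca_unit degree_along_mult[OF C_unit degree_along_mult[OF C_unit u_unit]], of k 0 1]
        by (simp add: G_def eval_nat_numeral)
    qed
  qed
  define F where "F = G ^ q * Ca ^ r"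
  have F: "degree_along v (3 * q + r) F" if "degree_along v 3 G" "degree_along v 1 Ca" for v
    unfolding F_def
    using degree_along_mult[OF degree_along_power[OF that(1)] degree_along_power[OF that(2)], of q r]
    by simp
  have nu1: "nu p \<in> homogeneous 1" and mu1: "mu i p \<in> homogeneous 1" and u_h: "u \<in> homogeneous 1" for i p
    using graded_part_linear_form by (simp_all add: nu_def mu_def u_def)
  have Ca_h: "Ca \<in> homogeneous 3" and C_h: "C i \<in> homogeneous 3" for i
    unfolding Ca_def C_def by (rule hankel_homogeneous; rule nu1 mu1)+
  have "G \<in> homogeneous 10"
    using homogeneous_mult[OF Ca_h homogeneous_mult[OF C_h homogeneous_mult[OF C_h u_h]]]
    by (simp add: G_def)
  then have "F \<in> homogeneous (10 * q + 3 * r)"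
    unfolding F_def by (intro homogeneous_mult homogeneous_power Ca_h)
  moreover have "F \<noteq> 0"
  proof -
    have "{i. lam i \<noteq> 0} = UNIV" using lam by auto
    then have "Ca \<noteq> 0" unfolding Ca_def nu_def using t by (intro hankel_neq_0) simp_all
    moreover have "C i \<noteq> 0" for i
    proof -
      have "{k. lam k * (t k - t i) \<noteq> 0} = UNIV - {i}" using lam injD[OF t] by auto
      then show ?thesis unfolding C_def mu_def
        using t by (intro hankel_neq_0) (simp_all add: card_Diff_singleton)
    qed
    moreover have "u \<noteq> 0"
    proof
      assume "u = 0"
      moreover have "directional (unit_vector 0) u = Const (1 / b 0)" by (simp add: u_def unit)
      ultimately have "lookup (Const (1 / b 0) :: (7, 'k) mpoly) 0 = 0" by simp
      then show False using b[of 0] by (simp add: Const_def)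
    qed
    ultimately show ?thesis by (simp add: F_def G_def)
  qed
  moreover have "directional b F = 0"
    using degree_along_mult[OF degree_along_power[OF G_b] degree_along_power[OF Ca_b], of q r]
    by (simp add: F_def degree_along_0_iff)
  moreover have "(directional a ^^ (3 * q + r + 1)) F = 0"
    using F[OF G_a degree_along_mono[OF Ca_a]] by (simp add: degree_along_def)
  moreover have "(pderiv_at i ^^ (3 * q + r + 1)) F = 0" for i
  proof -
    have "directional (unit_vector i) = pderiv_at i" by (rule ext) (rule directional_unit)
    then show ?thesis using F[OF G_unit Ca_unit, of i] unfolding degree_along_def by (metis Suc_eq_plus1)
  qed
  ultimately show ?thesis using that by blast
qed

section \<open>Failure of maximal rank\<close>

text \<open>Pairing with \<open>F\<close> is a nonzero functional that vanishes on multiples of \<open>l\<close> and on the ideal, so a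
  monomial on which it does not vanish is not in the image of \<open>\<times>l\<close>.\<close>

lemma apolar_form_annihilates_multiples:
  fixes F :: "('n::finite, 'k::field_char_0) mpoly"
  assumes F: "F \<in> homogeneous (Suc t)" "F \<noteq> 0" "directional b F = 0" "(directional a ^^ d) F = 0"
      "\<And>i. (pderiv_at i ^^ d) F = 0"
    and d: "d \<le> Suc t"
  obtains m where "m \<in> box_monomials d (Suc t)" "apolar (Suc t) (power_product m) F \<noteq> 0"
    "\<And>f g p. p \<in> power_ideal d \<Longrightarrow>
      apolar (Suc t) (linear_form b * f - linear_form a ^ d * g + p) F = 0"
proof -
  have lt: "\<forall>i. lookup m i < d" if "lookup F m \<noteq> 0" for m
    using exponents_lt_of_pderiv_power_eq_0[OF F(5) that] by blast
  obtain m where m: "lookup F m \<noteq> 0" using F(2) by (metis lookup_zero poly_mapping_eqI)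
  have deg: "mdegree m = Suc t" using F(1) m unfolding homogeneous_iff by blast
  have "apolar (Suc t) (power_product m) F = (\<Sum>k | mdegree k = Suc t. if k = m then lookup F m * exponent_factorial m else 0)"
    unfolding apolar_def by (rule sum.cong) (auto simp: lookup_single when_def)
  then have "apolar (Suc t) (power_product m) F = lookup F m * exponent_factorial m"
    using deg by (simp add: finite_mdegree)
  moreover have "exponent_factorial m \<noteq> (0 :: 'k)" by (simp add: exponent_factorial_def)
  ultimately have 1: "apolar (Suc t) (power_product m) F \<noteq> 0" using m by simp
  have 2: "apolar (Suc t) (linear_form b * f - linear_form a ^ d * g + p) F = 0"
    if "p \<in> power_ideal d" for f g p
  proof -
    have "apolar (Suc t) (linear_form b * f) F = 0"
      by (simp add: apolar_linear_form_times F(3))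
    moreover have "apolar (Suc t) (linear_form a ^ d * g) F = 0"
      using apolar_linear_form_power_times[of "Suc t - d" d a g F] d by (simp add: F(4))
    moreover have "apolar (Suc t) p F = 0" using that lt by (rule apolar_power_ideal)
    ultimately show ?thesis by (simp add: apolar_add apolar_diff)
  qed
  show ?thesis
    by (rule that[OF _ 1 2]) (use deg lt[OF m] in \<open>auto simp: box_monomials_def\<close>)
qed

text \<open>With \<open>B = R/(x\<^sub>1\<^sup>d, \<dots>, x\<^sub>n\<^sup>d)\<close> consider \<open>(f, g) \<mapsto> l f - L\<^sup>d g\<close> from \<open>[B]\<^sub>t \<oplus> [B]\<^sub>t\<^sub>+\<^sub>1\<^sub>-\<^sub>d\<close> to \<open>[B]\<^sub>t\<^sub>+\<^sub>1\<close>. It is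
  not surjective because of \<open>F\<close>. If \<open>\<times>l\<close> were injective on \<open>[A]\<^sub>t\<close>, a kernel element would have
  \<open>f = L\<^sup>d h\<close>, and then \<open>g = l h\<close> because \<open>L\<^sup>d\<close> is injective on \<open>[B]\<^sub>t\<^sub>+\<^sub>1\<^sub>-\<^sub>d\<close>. So the kernel would have
  dimension at most that of \<open>[B]\<^sub>t\<^sub>-\<^sub>d\<close>, which contradicts the dimension hypothesis on the
  four spaces.\<close>

lemma multiplication_not_injective:
  fixes a b :: "'n::finite \<Rightarrow> 'k::field_char_0" and F :: "('n, 'k) mpoly" and d :: nat
  defines "n \<equiv> \<lambda>e. card (box_monomials d e :: ('n \<Rightarrow>\<^sub>0 nat) set)"
  assumes F: "F \<in> homogeneous (Suc t)" "F \<noteq> 0" "directional b F = 0" "(directional a ^^ d) F = 0"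
      "\<And>i. (pderiv_at i ^^ d) F = 0"
    and d: "0 < d" "d \<le> t" "2 * (Suc t - d) + d \<le> CARD('n) * (d - 1)"
    and n: "n (Suc t) + n (t - d) \<le> n t + n (Suc t - d)"
    and a: "\<And>i. a i \<noteq> 0"
  shows "\<exists>f\<in>homogeneous t. linear_form b * f \<in> powers_ideal d (linear_form a)
    \<and> f \<notin> powers_ideal d (linear_form a)"
proof (rule ccontr)
  assume "\<not> ?thesis"
  then have inj: "f \<in> powers_ideal d (linear_form a)"
    if "f \<in> homogeneous t" "linear_form b * f \<in> powers_ideal d (linear_form a)" for f
    using that by blast
  let ?l = "linear_form b" and ?L = "linear_form a"
  let ?M = "box_monomials d :: nat \<Rightarrow> ('n \<Rightarrow>\<^sub>0 nat) set"
  obtain m0 where m0: "m0 \<in> ?M (Suc t)" "apolar (Suc t) (power_product m0) F \<noteq> 0"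
    and annihilates: "\<And>f g p. p \<in> power_ideal d \<Longrightarrow>
      apolar (Suc t) (?l * f - ?L ^ d * g + p) F = 0"
    using apolar_form_annihilates_multiples[OF F] d(2) by (metis le_SucI)
  \<comment> \<open>Elements of \<open>B\<close> are represented by their reduced polynomials. \<open>S\<close> parametrises the kernel of \<open>T\<close>.\<close>
  define T where "T x = reduce d (?l * fst x - ?L ^ d * snd x)" for x
  define X :: "(('n, 'k) mpoly \<times> ('n, 'k) mpoly) set" where "X = (\<lambda>m. (power_product m, 0)) ` ?M t \<union> (\<lambda>m. (0, power_product m)) ` ?M (Suc t - d)"
  define S where "S h = (reduce d (?L ^ d * h), reduce d (?l * h))" for h
  have restrict_Const: "restrict_monomials P (Const c * f) = Const c * restrict_monomials P f"
    for P c and f :: "('n, 'k) mpoly"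
    by (rule poly_mapping_eqI) simp
  have T: "Vector_Spaces.linear (\<lambda>c p. (Const c * fst p, Const c * snd p)) (\<lambda>c. (*) (Const c)) T"
  proof (rule Vector_Spaces.linear_iff[THEN iffD2], intro conjI allI)
    show "T (x + y) = T x + T y" for x y
      by (simp add: T_def distrib_left restrict_monomials_add restrict_monomials_diff)
    show "T (Const c * fst x, Const c * snd x) = Const c * T x" for c x
      by (simp add: T_def restrict_monomials_diff mult.left_commute[of _ "Const c"] restrict_Const right_diff_distrib)
  qed (rule vector_space_poly_pairs vector_space_poly)+
  have monom_neq_0: "power_product m \<noteq> (0 :: ('n, 'k) mpoly)" for m :: "'n \<Rightarrow>\<^sub>0 nat"
    by (metis lookup_single_eq lookup_zero one_neq_zero)
  have X_indep: "poly2.independent X"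
  proof (rule poly2.independent_by_separation)
    fix x assume "x \<in> X"
    then consider m where "x = (power_product m, 0)" | m where "x = (0, power_product m)" unfolding X_def by blast
    then show "\<exists>S. poly2.subspace S \<and> X - {x} \<subseteq> S \<and> x \<notin> S"
    proof cases
      case 1
      have "poly2.subspace {y. lookup (fst y) m = 0}"
        by (rule poly2.subspaceI) (auto simp: lookup_add)
      moreover have "X - {x} \<subseteq> {y. lookup (fst y) m = 0}"
        by (auto simp: X_def 1 lookup_single when_def split: if_splits)
      ultimately show ?thesis
        by (intro exI[of _ "{y. lookup (fst y) m = 0}"]) (simp add: 1)
    next
      case 2
      have "poly2.subspace {y. lookup (snd y) m = 0}"
        by (rule poly2.subspaceI) (auto simp: lookup_add)
      moreover have "X - {x} \<subseteq> {y. lookup (snd y) m = 0}"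
        by (auto simp: X_def 2 lookup_single when_def split: if_splits)
      ultimately show ?thesis
        by (intro exI[of _ "{y. lookup (snd y) m = 0}"]) (simp add: 2)
    qed
  qed
  have X_card: "finite X" "card X = n t + n (Suc t - d)"
  proof -
    have "inj_on (\<lambda>m. (power_product m, 0) :: ('n, 'k) mpoly \<times> ('n, 'k) mpoly) (?M t)"
      "inj_on (\<lambda>m. (0, power_product m) :: ('n, 'k) mpoly \<times> ('n, 'k) mpoly) (?M (Suc t - d))"
      using inj_power_product[where 'n = 'n and 'k = 'k] by (auto simp: inj_on_def)
    then show "finite X" "card X = n t + n (Suc t - d)"
      unfolding X_def n_def
      by (auto simp: finite_box_monomials card_image monom_neq_0 intro!: card_Un_disjoint[THEN trans])
  qed
  have span_X: "fst x \<in> poly.span (power_product ` ?M t) \<and> snd x \<in> poly.span (power_product ` ?M (Suc t - d))"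
    if "x \<in> poly2.span X" for x
  proof -
    have "poly2.subspace {x. fst x \<in> poly.span (power_product ` ?M t) \<and> snd x \<in> poly.span (power_product ` ?M (Suc t - d))}"
      by (rule poly2.subspaceI)
         (auto simp: poly.span_zero intro: poly.span_add poly.span_scale)
    moreover have "X \<subseteq> {x. fst x \<in> poly.span (power_product ` ?M t) \<and> snd x \<in> poly.span (power_product ` ?M (Suc t - d))}"
      by (auto simp: X_def poly.span_zero intro: poly.span_base)
    ultimately show ?thesis using that poly2.span_minimal by blast
  qed
  have L_hom: "?L ^ d \<in> homogeneous d" and l_hom: "?l \<in> homogeneous 1"
    using homogeneous_linear_form_power graded_part_linear_form by simp_all
  have in_Y: "reduce d h \<in> poly.span (power_product ` ?M e)" if "h \<in> homogeneous e" for h e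
    by (rule in_span_monomials)
       (use that in \<open>auto simp: homogeneous_iff box_monomials_def split: if_splits\<close>)
  have monom_hom: "power_product m \<in> homogeneous e" if "m \<in> ?M e" for m e
    using that by (auto simp: homogeneous_iff box_monomials_def lookup_single when_def split: if_splits)
  have span_hom: "h \<in> homogeneous e" if "h \<in> poly.span (power_product ` ?M e)" for h :: "('n, 'k) mpoly" and e
    unfolding homogeneous_iff using span_monomials_supported[OF that] by (auto simp: box_monomials_def)
  have span_reduced: "reduce d h = h" if "h \<in> poly.span (power_product ` ?M e)" for h :: "('n, 'k) mpoly" and e
    using span_monomials_supported[OF that]
    by (intro poly_mapping_eqI) (auto simp: box_monomials_def)
  have T_Y: "T ` X \<subseteq> poly.span (power_product ` ?M (Suc t))"
  proof -
    have "?l * power_product m \<in> homogeneous (Suc t)" if "m \<in> ?M t" for m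
      using homogeneous_mult[OF l_hom monom_hom[OF that]] by simp
    moreover have "- (?L ^ d * power_product m) \<in> homogeneous (Suc t)" if "m \<in> ?M (Suc t - d)" for m
      using homogeneous_mult[OF L_hom monom_hom[OF that]] d(2) by (intro graded_part_uminus) simp
    ultimately show ?thesis by (auto simp: X_def T_def intro!: in_Y)
  qed
  have notin: "power_product m0 \<notin> poly.span (T ` X)"
  proof
    assume "power_product m0 \<in> poly.span (T ` X)"
    moreover have "T ` X \<subseteq> {h. apolar (Suc t) h F = 0}"
    proof -
      have "apolar (Suc t) (T x) F = 0" for x
      proof -
        have "- (?l * fst x - ?L ^ d * snd x - T x) \<in> power_ideal d"
          unfolding T_def by (intro power_ideal_uminus reduce_diff_in_power_ideal)
        from annihilates[OF this, of "fst x" "snd x"] show ?thesis by simp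
      qed
      then show ?thesis by auto
    qed
    moreover have "poly.subspace {h. apolar (Suc t) h F = 0}"
      by (rule poly.subspaceI) (auto simp: apolar_add apolar_Const_times)
    ultimately show False using m0(2) poly.span_minimal by blast
  qed
  have kernel: "x \<in> poly2.span ((\<lambda>m. S (power_product m)) ` ?M (t - d))"
    if x: "x \<in> poly2.span X" and Tx: "T x = 0" for x
  proof -
    obtain f g where fg: "x = (f, g)" by force
    have f: "f \<in> poly.span (power_product ` ?M t)" and g: "g \<in> poly.span (power_product ` ?M (Suc t - d))"
      using span_X[OF x] by (simp_all add: fg)
    have rel: "?l * f - ?L ^ d * g \<in> power_ideal d"
      using Tx reduce_eq_0_iff by (auto simp: T_def fg)
    then have "f \<in> powers_ideal d ?L"
      by (intro inj[OF span_hom[OF f]]) (unfold mem_powers_ideal_iff, blast)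
    moreover have "?L \<in> homogeneous 1" using graded_part_linear_form by simp
    ultimately obtain h where h: "f - ?L ^ d * h \<in> power_ideal d" "h \<in> homogeneous (t - d)"
      using mem_powers_ideal_homogeneous[OF span_hom[OF f]] by blast
    have "?L ^ d * (?l * h - g) = (?l * f - ?L ^ d * g) - ?l * (f - ?L ^ d * h)"
      by (simp add: algebra_simps)
    also have "\<dots> \<in> power_ideal d" by (intro power_ideal_diff power_ideal_mult rel h(1))
    finally have *: "?L ^ d * (?l * h - g) \<in> power_ideal d" .
    have hom: "?l * h - g \<in> homogeneous (Suc t - d)"
      using homogeneous_mult[OF l_hom h(2)] span_hom[OF g] d(2)
      by (intro graded_part_diff) (simp_all add: Suc_diff_le)
    have "?l * h - g \<in> power_ideal d"
    proof (rule strong_lefschetz_monomial_complete_intersection[OF d(1) _ _ *])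
      show "support_degree a m = Suc t - d" if "lookup (?l * h - g) m \<noteq> 0" for m
        using hom that support_degree_full[of a m] a unfolding homogeneous_iff by simp
      show "2 * (Suc t - d) + d \<le> card {i. a i \<noteq> 0} * (d - 1)" using d(3) a by simp
    qed
    then have "reduce d (?l * h - g) = 0" by (simp add: reduce_eq_0_iff)
    then have "reduce d (?l * h) = g"
      using span_reduced[OF g] by (simp add: restrict_monomials_diff)
    moreover have "reduce d (f - ?L ^ d * h) = 0" using h(1) by (simp add: reduce_eq_0_iff)
    then have "reduce d (?L ^ d * h) = f"
      using span_reduced[OF f] by (simp add: restrict_monomials_diff)
    ultimately have "x = S h" by (simp add: S_def fg)
    also have "S h = S (reduce d h)"
    proof -
      have "reduce d (p * h) = reduce d (p * reduce d h)" for p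
      proof -
        have "p * (h - reduce d h) \<in> power_ideal d"
          by (intro power_ideal_mult reduce_diff_in_power_ideal)
        then have "reduce d (p * h - p * reduce d h) = 0"
          by (simp add: reduce_eq_0_iff right_diff_distrib)
        then show ?thesis by (simp add: restrict_monomials_diff)
      qed
      then show ?thesis unfolding S_def by blast
    qed
    also have "\<dots> \<in> poly2.span ((\<lambda>m. S (power_product m)) ` ?M (t - d))"
    proof -
      let ?W = "{h. S h \<in> poly2.span ((\<lambda>m. S (power_product m)) ` ?M (t - d))}"
      have "S 0 = 0" "S (h + h') = S h + S h'" "S (Const c * h) = (Const c * fst (S h), Const c * snd (S h))"
        for h h' c
        by (simp_all add: S_def zero_prod_def distrib_left restrict_monomials_add
            restrict_Const[symmetric] mult.left_commute)
          (rule poly_mapping_eqI, simp)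
      then have "poly.subspace ?W"
        by (intro poly.subspaceI)
           (auto simp: poly2.span_zero intro: poly2.span_add poly2.span_scale)
      moreover have "power_product ` ?M (t - d) \<subseteq> ?W" by (auto intro: poly2.span_base)
      ultimately have "poly.span (power_product ` ?M (t - d)) \<subseteq> ?W" by (rule poly.span_minimal[rotated])
      then show ?thesis using in_Y[OF h(2)] by blast
    qed
    finally show ?thesis .
  qed
  have "card X + 1 \<le> card (power_product ` ?M (Suc t) :: ('n, 'k) mpoly set)
      + card ((\<lambda>m. S (power_product m)) ` ?M (t - d))"
    by (rule poly2_poly_rank_nullity_bound[OF T X_indep X_card(1) _ T_Y _ notin _ kernel])
       (auto simp: finite_box_monomials intro: poly.span_base m0(1))
  also have "\<dots> \<le> n (Suc t) + n (t - d)"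
    unfolding n_def by (intro add_mono card_image_le finite_box_monomials)
  finally show False using n X_card(2) by linarith
qed

theorem fails_maximal_rank:
  fixes a b :: "7 \<Rightarrow> 'k::field_char_0"
  assumes a: "\<And>i. a i \<noteq> 0" and b: "\<And>i. b i \<noteq> 0"
    and ab: "\<And>i j. i \<noteq> j \<Longrightarrow> a i * b j \<noteq> a j * b i" and d: "d \<ge> 4"
  defines "I \<equiv> powers_ideal d (linear_form a)" and "l \<equiv> linear_form b"
  shows "\<exists>t. \<not> inj_on (quot_mult I l) (quot_part I t)
    \<and> quot_mult I l ` quot_part I t \<noteq> quot_part I (t + 1)"
proof -
  define q where "q = (d - 1) div 3"
  define r where "r = (d - 1) mod 3"
  define t where "t = 10 * q + 3 * r - 1"
  have "d - 1 = 3 * q + r" by (simp add: q_def r_def)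
  then have dqr: "d = 3 * q + r + 1" using d by linarith
  have q: "q \<ge> 1" and r: "r \<le> 2" using d by (auto simp: q_def r_def)
  have j: "10 * q + 3 * r = Suc t" using q by (simp add: t_def)
  obtain F where "F \<in> homogeneous (10 * q + 3 * r)" "F \<noteq> 0" "directional b F = 0"
    "(directional a ^^ (3 * q + r + 1)) F = 0" "\<And>i. (pderiv_at i ^^ (3 * q + r + 1)) F = 0"
    using exists_form_with_high_multiplicities[of b a q r] b ab by blast
  then have F: "F \<in> homogeneous (Suc t)" "F \<noteq> 0" "directional b F = 0"
    "(directional a ^^ d) F = 0" "\<And>i. (pderiv_at i ^^ d) F = 0"
    unfolding j dqr[symmetric] by simp_all
  have dt: "d \<le> t" using q unfolding dqr t_def by linarith
  have "\<exists>f\<in>homogeneous t. l * f \<in> I \<and> f \<notin> I"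
    unfolding I_def l_def
  proof (rule multiplication_not_injective[OF F])
    show "0 < d" "d \<le> t" using d dt by simp_all
    show "2 * (Suc t - d) + d \<le> CARD(7) * (d - 1)"
      using q unfolding j[symmetric] dqr by simp
    show "card (box_monomials d (Suc t) :: (7 \<Rightarrow>\<^sub>0 nat) set) + card (box_monomials d (t - d) :: (7 \<Rightarrow>\<^sub>0 nat) set)
        \<le> card (box_monomials d t :: (7 \<Rightarrow>\<^sub>0 nat) set) + card (box_monomials d (Suc t - d) :: (7 \<Rightarrow>\<^sub>0 nat) set)"
      using second_difference_nonpos[OF q r] unfolding j dqr[symmetric] by (simp add: diff_right_commute)
  qed (rule a)
  then have "\<not> inj_on (quot_mult I l) (quot_part I (int t))"
    unfolding I_def inj_on_quot_mult_iff by blast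
  moreover have "quot_mult I l ` quot_part I (int t) \<noteq> quot_part I (int t + 1)"
  proof
    have l: "l \<in> graded_part 1" unfolding l_def by (rule graded_part_linear_form)
    assume "quot_mult I l ` quot_part I (int t) = quot_part I (int t + 1)"
    then have surj: "\<forall>h\<in>graded_part (int t + 1). \<exists>f\<in>graded_part (int t). h - l * f \<in> I"
      unfolding I_def quot_mult_image_eq_iff[OF l] .
    obtain m where m: "m \<in> box_monomials d (Suc t)" "apolar (Suc t) (power_product m) F \<noteq> 0"
      and annihilates: "\<And>f g p. p \<in> power_ideal d \<Longrightarrow>
        apolar (Suc t) (l * f - linear_form a ^ d * g + p) F = 0"
      unfolding l_def using apolar_form_annihilates_multiples[OF F] dt by (metis le_SucI)
    have "(power_product m :: (7, 'k) mpoly) \<in> graded_part (int t + 1)"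
      using m(1) by (auto simp: graded_part_def box_monomials_def)
    then obtain f where "power_product m - l * f \<in> I" using surj by blast
    then obtain g where "power_product m - l * f - linear_form a ^ d * g \<in> power_ideal d"
      unfolding I_def mem_powers_ideal_iff by blast
    from annihilates[OF this, of f "- g"] m(2) show False by simp
  qed
  ultimately show ?thesis by blast
qed

section \<open>A linear system on pairs and triples\<close>

text \<open>For a quadratic \<open>u\<close>, the divided difference at \<open>s, t\<close> is \<open>c1 + c2 (s + t)\<close>, so the two sums of divided
  differences agree; an error at the fourth point would be divided by two different numbers.\<close>

lemma quadratic_fourth_point:
  fixes x y z w :: "'k::field"
  assumes ne: "x \<noteq> y" "x \<noteq> z" "x \<noteq> w" "y \<noteq> z" "y \<noteq> w" "z \<noteq> w"
    and u: "ux = c0 + c1 * x + c2 * x\<^sup>2" "uy = c0 + c1 * y + c2 * y\<^sup>2" "uz = c0 + c1 * z + c2 * z\<^sup>2"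
    and eq: "(ux - uy) / (x - y) + (uz - uw) / (z - w) = (ux - uz) / (x - z) + (uy - uw) / (y - w)"
  shows "uw = c0 + c1 * w + c2 * w\<^sup>2"
proof -
  define e where "e = uw - (c0 + c1 * w + c2 * w\<^sup>2)"
  have q: "(c0 + c1 * s + c2 * s\<^sup>2 - (c0 + c1 * t + c2 * t\<^sup>2)) / (s - t) = c1 + c2 * (s + t)"
    if "s \<noteq> t" for s t
    using that by (simp add: divide_eq_eq power2_eq_square algebra_simps)
  have uw: "uw = (c0 + c1 * w + c2 * w\<^sup>2) + e" by (simp add: e_def)
  have d: "(c0 + c1 * s + c2 * s\<^sup>2 - uw) / (s - w) = c1 + c2 * (s + w) - e / (s - w)" if "s \<noteq> w" for s
  proof -
    have "c0 + c1 * s + c2 * s\<^sup>2 - uw = (c0 + c1 * s + c2 * s\<^sup>2 - (c0 + c1 * w + c2 * w\<^sup>2)) - e"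
      unfolding uw by simp
    then show ?thesis using q[OF that] by (simp only: diff_divide_distrib[of _ e])
  qed
  have "c1 + c2 * (x + y) + (c1 + c2 * (z + w) - e / (z - w))
      = c1 + c2 * (x + z) + (c1 + c2 * (y + w) - e / (y - w))"
    using eq unfolding u q[OF ne(1)] q[OF ne(2)] d[OF ne(6)] d[OF ne(5)] .
  then have "e / (z - w) = e / (y - w)" by (simp add: distrib_left)
  then have "e * (y - z) = 0" using ne by (simp add: field_simps)
  then have "e = 0" using ne by simp
  then show ?thesis by (simp add: uw)
qed

lemma quadratic_interpolation:
  fixes x y z :: "'k::field"
  assumes "x \<noteq> y" "x \<noteq> z" "y \<noteq> z"
  obtains c0 c1 c2 where "ux = c0 + c1 * x + c2 * x\<^sup>2" "uy = c0 + c1 * y + c2 * y\<^sup>2"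
    "uz = c0 + c1 * z + c2 * z\<^sup>2"
proof -
  define s where "s = (uy - ux) / (y - x)"
  define D where "D = ((uz - ux) / (z - x) - s) / (z - y)"
  have s: "s * (y - x) = uy - ux" using assms by (simp add: s_def)
  have D: "D * (z - y) * (z - x) = (uz - ux) - s * (z - x)"
  proof -
    have "D * (z - y) = (uz - ux) / (z - x) - s" using assms by (simp add: D_def)
    moreover have "(uz - ux) / (z - x) * (z - x) = uz - ux" using assms by simp
    ultimately show ?thesis by (simp only: left_diff_distrib)
  qed
  have newton: "(ux - s * x + D * x * y) + (s - D * (x + y)) * v + D * v\<^sup>2
      = ux + s * (v - x) + D * (v - y) * (v - x)" for v
    by (simp add: power2_eq_square algebra_simps)
  show ?thesis
    by (rule that[of "ux - s * x + D * x * y" "s - D * (x + y)" D])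
       (unfold newton, use s D in \<open>simp_all add: algebra_simps\<close>)
qed

text \<open>Eliminating \<open>w\<close> from the equations gives \<open>i (u[m,n] + u[j,p]) + u i = 0\<close> for every splitting of
  the five points into \<open>i\<close> and two pairs, with divided differences \<open>u[m,n]\<close>. Comparing the splittings with
  the same \<open>i\<close> shows that \<open>u\<close> is quadratic on any four points, hence on all five, and substituting
  a quadratic polynomial leaves only one parameter.\<close>

lemma five_point_system:
  fixes x1 x2 x3 x4 x5 :: "'k::field_char_0"
  assumes ne: "distinct [x1, x2, x3, x4, x5]" and n0: "0 \<notin> {x1, x2, x3, x4, x5}"
    and T: "\<And>i j m. distinct [i, j, m] \<Longrightarrow> {i, j, m} \<subseteq> {x1, x2, x3, x4, x5} \<Longrightarrow>
      w i + w j + w m = - 2 * (i * j * u m + i * m * u j + j * m * u i)"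
  obtains \<gamma> where "\<And>i. i \<in> {x1, x2, x3, x4, x5} \<Longrightarrow> u i = \<gamma> * i * (x1 + x2 + x3 + x4 + x5 - 3 * i)"
proof -
  have star: "i * ((u m - u n) / (m - n) + (u j - u p) / (j - p)) + u i = 0"
    if "distinct [i, m, n, j, p]" "{i, m, n, j, p} \<subseteq> {x1, x2, x3, x4, x5}" for i m n j p
  proof -
    have "w x + w i + w y = - 2 * (x * i * u y + x * y * u i + i * y * u x)"
      if "x \<in> {m, n}" "y \<in> {j, p}" for x y
      by (rule T) (use that \<open>distinct [i, m, n, j, p]\<close> \<open>{i, m, n, j, p} \<subseteq> _\<close> in auto)
    from this[of m j] this[of n j] this[of m p] this[of n p]
    have e: "w m + w i + w j = - 2 * (m * i * u j + m * j * u i + i * j * u m)"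
      "w n + w i + w j = - 2 * (n * i * u j + n * j * u i + i * j * u n)"
      "w m + w i + w p = - 2 * (m * i * u p + m * p * u i + i * p * u m)"
      "w n + w i + w p = - 2 * (n * i * u p + n * p * u i + i * p * u n)"
      by simp_all
    have "0 = (w m + w i + w j) - (w n + w i + w j) - (w m + w i + w p) + (w n + w i + w p)"
      by simp
    also have "\<dots> = - (2 * (i * (j - p) * (u m - u n) + (m - n) * (i * (u j - u p) + (j - p) * u i)))"
      unfolding e by (simp add: algebra_simps)
    finally have "2 * (i * (j - p) * (u m - u n) + (m - n) * (i * (u j - u p) + (j - p) * u i)) = 0"
      by (simp add: algebra_simps)
    then have "i * (j - p) * (u m - u n) + (m - n) * (i * (u j - u p) + (j - p) * u i) = 0"
      by (simp only: mult_eq_0_iff) simp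
    moreover have "m - n \<noteq> 0" "j - p \<noteq> 0" using that by auto
    ultimately show ?thesis by (simp add: divide_simps) (simp add: algebra_simps)
  qed
  have exch: "(u m - u n) / (m - n) + (u j - u p) / (j - p) = (u m - u j) / (m - j) + (u n - u p) / (n - p)"
    if "distinct [i, m, n, j, p]" "{i, m, n, j, p} \<subseteq> {x1, x2, x3, x4, x5}" for i m n j p
  proof -
    have "i \<noteq> 0" using that n0 by auto
    moreover have "distinct [i, m, j, n, p]" "{i, m, j, n, p} \<subseteq> {x1, x2, x3, x4, x5}" using that by auto
    then have "i * ((u m - u n) / (m - n) + (u j - u p) / (j - p))
        = i * ((u m - u j) / (m - j) + (u n - u p) / (n - p))"
      using star[OF that] star[of i m j n p] by (metis add_right_cancel)
    ultimately show ?thesis by simp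
  qed
  obtain c0 c1 c2 where c: "u x1 = c0 + c1 * x1 + c2 * x1\<^sup>2" "u x2 = c0 + c1 * x2 + c2 * x2\<^sup>2"
    "u x3 = c0 + c1 * x3 + c2 * x3\<^sup>2"
    by (rule quadratic_interpolation[of x1 x2 x3 "u x1" "u x2" "u x3"]) (use ne in auto)
  have c4: "u x4 = c0 + c1 * x4 + c2 * x4\<^sup>2"
    by (rule quadratic_fourth_point[OF _ _ _ _ _ _ c exch[of x5]]) (use ne in auto)
  have c5: "u x5 = c0 + c1 * x5 + c2 * x5\<^sup>2"
    by (rule quadratic_fourth_point[OF _ _ _ _ _ _ c exch[of x4]]) (use ne in auto)
  define e where "e = x1 + x2 + x3 + x4 + x5"
  have q: "(c0 + c1 * s + c2 * s\<^sup>2 - (c0 + c1 * t + c2 * t\<^sup>2)) / (s - t) = c1 + c2 * (s + t)"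
    if "s \<noteq> t" for s t
    using that by (simp add: divide_eq_eq power2_eq_square algebra_simps)
  have "x2 \<noteq> x3" "x1 \<noteq> x3" "x4 \<noteq> x5" using ne by auto
  note q = q[OF \<open>x2 \<noteq> x3\<close>] q[OF \<open>x1 \<noteq> x3\<close>] q[OF \<open>x4 \<noteq> x5\<close>]
  have 1: "x1 * (3 * c1 + c2 * e) + c0 = 0"
  proof -
    have "x1 * ((c1 + c2 * (x2 + x3)) + (c1 + c2 * (x4 + x5))) + (c0 + c1 * x1 + c2 * x1\<^sup>2) = 0"
      using star[of x1 x2 x3 x4 x5] ne unfolding c c4 c5 q by simp
    then show ?thesis by (simp add: e_def power2_eq_square algebra_simps)
  qed
  have 2: "x2 * (3 * c1 + c2 * e) + c0 = 0"
  proof -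
    have "x2 * ((c1 + c2 * (x1 + x3)) + (c1 + c2 * (x4 + x5))) + (c0 + c1 * x2 + c2 * x2\<^sup>2) = 0"
      using star[of x2 x1 x3 x4 x5] ne unfolding c c4 c5 q by auto
    then show ?thesis by (simp add: e_def power2_eq_square algebra_simps)
  qed
  have "(x1 - x2) * (3 * c1 + c2 * e) = 0"
    using 1 2 by (simp add: left_diff_distrib eq_neg_iff_add_eq_0[symmetric])
  then have A: "3 * c1 + c2 * e = 0" using ne by simp
  then have "c0 = 0" using 1 by simp
  have "c1 = - (c2 * e) / 3" using A by (simp add: field_simps add_eq_0_iff)
  then have q3: "c0 + c1 * i + c2 * i\<^sup>2 = (- c2 / 3) * i * (e - 3 * i)" for i
    unfolding \<open>c0 = 0\<close> \<open>c1 = _\<close> by (simp add: power2_eq_square field_simps)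
  have "u i = (- c2 / 3) * i * (e - 3 * i)" if "i \<in> {x1, x2, x3, x4, x5}" for i
    using that c c4 c5 unfolding q3 by blast
  then show ?thesis using that[of "- c2 / 3"] unfolding e_def by blast
qed

lemma set_of_size_5:
  assumes "card A = 5"
  obtains i1 i2 i3 i4 i5 where "distinct [i1, i2, i3, i4, i5]" "A = {i1, i2, i3, i4, i5}"
proof -
  have "finite A" using assms by (metis card.infinite zero_neq_numeral)
  then obtain xs where xs: "distinct xs" "set xs = A" using finite_distinct_list by blast
  then have "length xs = 5" using assms distinct_card by metis
  then obtain i1 i2 i3 i4 i5 where "xs = [i1, i2, i3, i4, i5]"
    by (auto simp: eval_nat_numeral length_Suc_conv)
  then show ?thesis using xs that by auto
qed

text \<open>The system \<open>l f = L\<^sup>2 g\<close> in the squarefree algebra, with \<open>f\<close> a quadric and \<open>g\<close> a linear form: one unknown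
  \<open>f i j\<close> for each edge and one unknown \<open>h i\<close> for each vertex of the complete graph on seven vertices,
  one equation for each triangle, after rescaling the variables so that \<open>L = \<Sum> x\<^sub>i\<close>. Its obvious solutions
  \<open>f = c\<close>, \<open>h = c \<beta>\<close> come from \<open>f = L\<^sup>2\<close>, \<open>g = l\<close> up to a scalar.\<close>

locale triangle_system =
  fixes f :: "'n::finite \<Rightarrow> 'n \<Rightarrow> 'k::field_char_0" and \<beta> h :: "'n \<Rightarrow> 'k"
  assumes seven: "CARD('n) = 7"
    and inj: "inj \<beta>" and nonzero: "\<And>i. \<beta> i \<noteq> 0"
    and sym: "\<And>i j. f i j = f j i"
    and eq: "\<And>i j m. distinct [i, j, m] \<Longrightarrow>
      \<beta> i * f j m + \<beta> j * f i m + \<beta> m * f i j = h i + h j + h m"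
begin

text \<open>Subtracting the equations of \<open>x, y, k\<close> and \<open>x, y, l\<close> expresses \<open>f x y\<close> through the differences
  \<open>u x = f x k - f x l\<close>. Inserting this into the equations of the triangles that avoid \<open>k\<close> and \<open>l\<close> gives a
  system on the five other vertices that \<open>five_point_system\<close> solves up to a scalar.\<close>

lemma difference_of_columns:
  assumes kl: "k \<noteq> l"
  obtains \<gamma> where "\<And>x. x \<notin> {k, l} \<Longrightarrow>
    f x k - f x l = \<gamma> * \<beta> x * ((\<Sum>i\<in>UNIV. \<beta> i) - \<beta> k - \<beta> l - 3 * \<beta> x)"
proof -
  have "card (UNIV - {k, l} :: 'n set) = 5" using kl seven by (simp add: card_Diff_subset)
  then obtain i1 i2 i3 i4 i5 where i: "distinct [i1, i2, i3, i4, i5]" "UNIV - {k, l} = {i1, i2, i3, i4, i5}"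
    by (rule set_of_size_5)
  define \<delta> where "\<delta> = \<beta> k - \<beta> l"
  define \<eta> where "\<eta> = h k - h l"
  define u where "u x = f x k - f x l" for x
  have pair: "\<delta> * f x y = \<eta> - \<beta> x * u y - \<beta> y * u x" if "distinct [x, y, k]" "distinct [x, y, l]" for x y
  proof -
    have "(\<beta> x * f y k + \<beta> y * f x k + \<beta> k * f x y) - (\<beta> x * f y l + \<beta> y * f x l + \<beta> l * f x y)
      = (h x + h y + h k) - (h x + h y + h l)"
      unfolding eq[OF that(1)] eq[OF that(2)] ..
    then show ?thesis by (simp add: \<delta>_def \<eta>_def u_def algebra_simps)
  qed
  have triple: "(\<delta> * h x - \<eta> * \<beta> x) + (\<delta> * h y - \<eta> * \<beta> y) + (\<delta> * h z - \<eta> * \<beta> z)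
      = - 2 * (\<beta> x * \<beta> y * u z + \<beta> x * \<beta> z * u y + \<beta> y * \<beta> z * u x)"
    if "distinct [x, y, z]" "{x, y, z} \<inter> {k, l} = {}" for x y z
  proof -
    have "\<delta> * (h x + h y + h z) = \<beta> x * (\<delta> * f y z) + \<beta> y * (\<delta> * f x z) + \<beta> z * (\<delta> * f x y)"
      unfolding eq[OF that(1), symmetric] by (simp add: algebra_simps)
    also have "\<dots> = \<beta> x * (\<eta> - \<beta> y * u z - \<beta> z * u y) + \<beta> y * (\<eta> - \<beta> x * u z - \<beta> z * u x)
        + \<beta> z * (\<eta> - \<beta> x * u y - \<beta> y * u x)"
    proof -
      have "distinct [y, z, k]" "distinct [y, z, l]" "distinct [x, z, k]" "distinct [x, z, l]"
        "distinct [x, y, k]" "distinct [x, y, l]" using that by auto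
      then show ?thesis by (simp only: pair)
    qed
    finally show ?thesis by (simp add: algebra_simps)
  qed
  have inv: "inv \<beta> (\<beta> x) = x" for x using inj by simp
  have bd: "distinct [\<beta> i1, \<beta> i2, \<beta> i3, \<beta> i4, \<beta> i5]" using i(1) inj by (auto dest: injD)
  obtain \<gamma> where \<gamma>: "\<And>v. v \<in> {\<beta> i1, \<beta> i2, \<beta> i3, \<beta> i4, \<beta> i5} \<Longrightarrow>
      u (inv \<beta> v) = \<gamma> * v * (\<beta> i1 + \<beta> i2 + \<beta> i3 + \<beta> i4 + \<beta> i5 - 3 * v)"
  proof (rule five_point_system[OF bd, where u = "\<lambda>v. u (inv \<beta> v)" and w = "\<lambda>v. \<delta> * h (inv \<beta> v) - \<eta> * v"])
    show "0 \<notin> {\<beta> i1, \<beta> i2, \<beta> i3, \<beta> i4, \<beta> i5}" using nonzero by (auto simp: eq_commute[of 0])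
    fix v v' v'' assume v: "distinct [v, v', v'']" "{v, v', v''} \<subseteq> {\<beta> i1, \<beta> i2, \<beta> i3, \<beta> i4, \<beta> i5}"
    have "{\<beta> i1, \<beta> i2, \<beta> i3, \<beta> i4, \<beta> i5} = \<beta> ` (UNIV - {k, l})" unfolding i(2) by simp
    then obtain x y z where xyz: "v = \<beta> x" "v' = \<beta> y" "v'' = \<beta> z" "{x, y, z} \<inter> {k, l} = {}"
      using v(2) by auto
    then have "distinct [x, y, z]" using v(1) by auto
    from triple[OF this xyz(4)]
    show "\<delta> * h (inv \<beta> v) - \<eta> * v + (\<delta> * h (inv \<beta> v') - \<eta> * v') + (\<delta> * h (inv \<beta> v'') - \<eta> * v'')
        = - 2 * (v * v' * u (inv \<beta> v'') + v * v'' * u (inv \<beta> v') + v' * v'' * u (inv \<beta> v))"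
      unfolding xyz(1-3) inv .
  qed (rule that)
  have "(\<Sum>i\<in>UNIV. \<beta> i) = (\<Sum>i\<in>{k, l}. \<beta> i) + (\<Sum>i\<in>UNIV - {k, l}. \<beta> i)"
    by (metis sum.subset_diff[of "{k, l}" UNIV \<beta>] add.commute finite subset_UNIV)
  also have "(\<Sum>i\<in>UNIV - {k, l}. \<beta> i) = \<beta> i1 + \<beta> i2 + \<beta> i3 + \<beta> i4 + \<beta> i5"
    unfolding i(2) using i(1) by (simp add: add.assoc)
  finally have "(\<Sum>i\<in>UNIV. \<beta> i) - \<beta> k - \<beta> l = \<beta> i1 + \<beta> i2 + \<beta> i3 + \<beta> i4 + \<beta> i5"
    using kl by simp
  then have "f x k - f x l = \<gamma> * \<beta> x * ((\<Sum>i\<in>UNIV. \<beta> i) - \<beta> k - \<beta> l - 3 * \<beta> x)"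
    if "x \<notin> {k, l}" for x
  proof -
    have "x \<in> {i1, i2, i3, i4, i5}" using that i(2) by blast
    then have "\<beta> x \<in> {\<beta> i1, \<beta> i2, \<beta> i3, \<beta> i4, \<beta> i5}" by auto
    from \<gamma>[OF this] show ?thesis
      using \<open>(\<Sum>i\<in>UNIV. \<beta> i) - \<beta> k - \<beta> l = _\<close> by (simp only: inv u_def)
  qed
  then show ?thesis by (rule that)
qed

lemma vandermonde_3:
  fixes x y z :: 'k
  assumes "distinct [x, y, z]" and "g1 + g2 + g3 = 0" "g1 * x + g2 * y + g3 * z = 0"
    "g1 * (x * x) + g2 * (y * y) + g3 * (z * z) = 0"
  shows "g1 = 0"
proof -
  have "g1 * ((x - y) * (x - z)) = (g1 * (x * x) + g2 * (y * y) + g3 * (z * z))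
      - (y + z) * (g1 * x + g2 * y + g3 * z) + y * z * (g1 + g2 + g3)"
    by (simp add: algebra_simps)
  then show ?thesis using assms by auto
qed

text \<open>The scalars \<open>g1, g2, g3\<close> of \<open>difference_of_columns\<close> for the three pairs in \<open>{i, k, l}\<close> are related, since
  the differences add up to zero around the triangle. Evaluated at vertices outside the triangle this gives
  \<open>\<Sum> g = 0\<close> and \<open>\<Sum> g \<beta> = 0\<close>; at its own vertices, where the symmetry of \<open>f\<close> enters, it gives
  \<open>\<Sum> g \<beta>\<^sup>2 = 0\<close>. The Vandermonde matrix of three distinct values is invertible.\<close>

lemma columns_agree:
  assumes "distinct [i, k, l]"
  shows "f i k = f i l"
proof -
  let ?E = "\<Sum>i\<in>UNIV. \<beta> i"
  have ne: "k \<noteq> l" "l \<noteq> i" "i \<noteq> k" using assms by auto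
  obtain g1 where g1: "\<And>x. x \<notin> {k, l} \<Longrightarrow> f x k - f x l = g1 * \<beta> x * (?E - \<beta> k - \<beta> l - 3 * \<beta> x)"
    using difference_of_columns[OF ne(1)] by blast
  obtain g2 where g2: "\<And>x. x \<notin> {l, i} \<Longrightarrow> f x l - f x i = g2 * \<beta> x * (?E - \<beta> l - \<beta> i - 3 * \<beta> x)"
    using difference_of_columns[OF ne(2)] by blast
  obtain g3 where g3: "\<And>x. x \<notin> {i, k} \<Longrightarrow> f x i - f x k = g3 * \<beta> x * (?E - \<beta> i - \<beta> k - 3 * \<beta> x)"
    using difference_of_columns[OF ne(3)] by blast
  \<comment> \<open>The weights of the three pairs are \<open>c\<close> plus the value of \<open>\<beta>\<close> at the opposite vertex.\<close>
  define c where "c = ?E - \<beta> i - \<beta> k - \<beta> l"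
  have c: "?E - \<beta> k - \<beta> l = c + \<beta> i" "?E - \<beta> l - \<beta> i = c + \<beta> k" "?E - \<beta> i - \<beta> k = c + \<beta> l"
    by (simp_all add: c_def algebra_simps)
  define s0 where "s0 = g1 + g2 + g3"
  define s1 where "s1 = g1 * \<beta> i + g2 * \<beta> k + g3 * \<beta> l"
  define s2 where "s2 = g1 * (\<beta> i * \<beta> i) + g2 * (\<beta> k * \<beta> k) + g3 * (\<beta> l * \<beta> l)"
  have other: "c * s0 + s1 - 3 * \<beta> x * s0 = 0" if "x \<notin> {i, k, l}" for x
  proof -
    have "0 = (f x k - f x l) + (f x l - f x i) + (f x i - f x k)" by simp
    also have "\<dots> = g1 * \<beta> x * (c + \<beta> i - 3 * \<beta> x) + g2 * \<beta> x * (c + \<beta> k - 3 * \<beta> x)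
        + g3 * \<beta> x * (c + \<beta> l - 3 * \<beta> x)"
      using that by (simp only: g1 g2 g3 c insert_iff empty_iff de_Morgan_disj simp_thms)
    also have "\<dots> = \<beta> x * (c * s0 + s1 - 3 * \<beta> x * s0)"
      by (simp add: s0_def s1_def algebra_simps)
    finally show ?thesis using nonzero[of x] by (metis mult_eq_0_iff)
  qed
  have "card (UNIV - {i, k, l} :: 'n set) = 4"
    using assms seven by (simp add: card_Diff_subset)
  then obtain T where "T \<subseteq> UNIV - {i, k, l}" "card T = 2"
    by (metis obtain_subset_with_card_n numeral_le_iff semiring_norm(68) semiring_norm(71))
  then obtain x y where xy: "x \<noteq> y" "x \<notin> {i, k, l}" "y \<notin> {i, k, l}"
    by (auto simp: card_2_iff)
  have "3 * (\<beta> y - \<beta> x) * s0 = (c * s0 + s1 - 3 * \<beta> x * s0) - (c * s0 + s1 - 3 * \<beta> y * s0)"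
    by (simp add: algebra_simps)
  also have "\<dots> = 0" unfolding other[OF xy(2)] other[OF xy(3)] by simp
  finally have s0: "s0 = 0" using xy(1) injD[OF inj, of x y] by auto
  then have s1: "s1 = 0" using other[OF xy(2)] by simp
  have "0 = (f i k - f i l) + (f k l - f k i) + (f l i - f l k)"
    using sym[of i k] sym[of i l] sym[of k l] by simp
  also have "\<dots> = g1 * \<beta> i * (c + \<beta> i - 3 * \<beta> i) + g2 * \<beta> k * (c + \<beta> k - 3 * \<beta> k)
      + g3 * \<beta> l * (c + \<beta> l - 3 * \<beta> l)"
  proof -
    have "i \<notin> {k, l}" "k \<notin> {l, i}" "l \<notin> {i, k}" using assms by auto
    from g1[OF this(1)] g2[OF this(2)] g3[OF this(3)] show ?thesis by (simp only: c)
  qed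
  also have "\<dots> = c * s1 - 2 * s2"
    by (simp add: s1_def s2_def algebra_simps)
  finally have s2: "s2 = 0" using s1 by simp
  have "distinct [\<beta> i, \<beta> k, \<beta> l]" using assms inj by (auto dest: injD)
  then have "g1 = 0" using vandermonde_3 s0 s1 s2 unfolding s0_def s1_def s2_def by blast
  then show ?thesis using g1[of i] assms by simp
qed

lemma constant_off_diagonal: obtains c where "\<And>i j. i \<noteq> j \<Longrightarrow> f i j = c"
proof -
  have "\<exists>i j :: 'n. i \<noteq> j"
  proof -
    have "\<not> card (UNIV :: 'n set) \<le> Suc 0" using seven by simp
    then show ?thesis unfolding card_le_Suc0_iff_eq[OF finite] by blast
  qed
  then obtain p q :: 'n where pq: "p \<noteq> q" by blast
  have "f i j = f p q" if "i \<noteq> j" for i j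
  proof -
    have 1: "f i k = f i l" if "i \<noteq> k" "i \<noteq> l" for i k l
      using that columns_agree[of i k l] by (cases "k = l") auto
    show ?thesis
    proof (cases "i = p")
      case True
      then show ?thesis using 1[of p j q] that pq by simp
    next
      case False
      then show ?thesis
        using 1[of i j p] 1[of p i q] sym[of i p] that pq by simp
    qed
  qed
  then show ?thesis by (rule that)
qed

end

section \<open>Injectivity for squares\<close>

lemma lookup_linear_form_times_pair:
  assumes "i \<noteq> j"
  shows "lookup (linear_form a * g) (unit_exp i + unit_exp j)
    = a i * lookup g (unit_exp j) + a j * lookup g (unit_exp i)"
proof -
  let ?m = "unit_exp i + unit_exp j"
  have "lookup (linear_form a * g) ?m
      = (\<Sum>s\<in>{i, j}. a s * (if lookup ?m s = 0 then 0 else lookup g (?m - unit_exp s)))"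
    unfolding lookup_linear_form_times
    by (rule sum.mono_neutral_right) (auto simp: lookup_add lookup_single when_def)
  moreover have "?m - unit_exp i = unit_exp j" "?m - unit_exp j = unit_exp i" by simp_all
  ultimately show ?thesis using assms by (simp add: lookup_add)
qed

lemma lookup_linear_form_times_triple:
  assumes "distinct [i, j, k]"
  shows "lookup (linear_form a * g) (unit_exp i + unit_exp j + unit_exp k)
    = a i * lookup g (unit_exp j + unit_exp k) + a j * lookup g (unit_exp i + unit_exp k)
      + a k * lookup g (unit_exp i + unit_exp j)"
proof -
  let ?m = "unit_exp i + unit_exp j + unit_exp k"
  have "lookup (linear_form a * g) ?m
      = (\<Sum>s\<in>{i, j, k}. a s * (if lookup ?m s = 0 then 0 else lookup g (?m - unit_exp s)))"
    unfolding lookup_linear_form_times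
    by (rule sum.mono_neutral_right) (auto simp: lookup_add lookup_single when_def)
  moreover have "?m - unit_exp i = unit_exp j + unit_exp k"
    using add_diff_cancel_left'[of "unit_exp i" "unit_exp j + unit_exp k"] by (simp only: add.assoc)
  moreover have "?m - unit_exp j = unit_exp i + unit_exp k"
    using add_diff_cancel_left'[of "unit_exp j" "unit_exp i + unit_exp k"]
    by (simp only: add.assoc add.left_commute)
  moreover have "?m - unit_exp k = unit_exp i + unit_exp j" by simp
  ultimately show ?thesis using assms by (simp add: lookup_add add.assoc)
qed

lemma mdegree_SucE:
  assumes "mdegree m = Suc t"
  obtains i m' where "m = m' + unit_exp i" "mdegree m' = t"
proof -
  have "\<exists>i. lookup m i \<noteq> 0"
  proof (rule ccontr)
    assume "\<not> ?thesis"
    then have "mdegree m = 0" by (simp add: mdegree_def)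
    then show False using assms by simp
  qed
  then obtain i where "lookup m i \<noteq> 0" by blast
  then have eq: "m = (m - unit_exp i) + unit_exp i"
    using exponent_split[of m i] by (simp add: add.commute)
  then have "mdegree m = mdegree (m - unit_exp i) + 1"
    using mdegree_add[of "m - unit_exp i" "unit_exp i"] by simp
  then show ?thesis using assms by (intro that[OF eq]) simp
qed

lemma mdegree_0E: "mdegree m = 0 \<Longrightarrow> m = 0"
  by (rule poly_mapping_eqI) (simp add: mdegree_def)

lemma squarefree_degree_2E:
  assumes "mdegree m = 2" "\<forall>i. lookup m i < 2"
  obtains i j where "i \<noteq> j" "m = unit_exp i + unit_exp j"
proof -
  obtain i m' where i: "m = m' + unit_exp i" "mdegree m' = Suc 0"
    using assms(1) by (metis mdegree_SucE numeral_2_eq_2)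
  then obtain j m'' where "m' = m'' + unit_exp j" "mdegree m'' = 0" using mdegree_SucE by metis
  then have m: "m = unit_exp i + unit_exp j" using i mdegree_0E by (auto simp: add.commute)
  moreover have "i \<noteq> j"
  proof
    assume "i = j"
    then have "lookup m i = 2" unfolding m by (simp add: lookup_add)
    then show False using assms(2) by (metis less_irrefl)
  qed
  ultimately show ?thesis using that by blast
qed

lemma powers_ideal_mult: "f \<in> powers_ideal d L \<Longrightarrow> p * f \<in> powers_ideal d L"
  and powers_ideal_add: "f \<in> powers_ideal d L \<Longrightarrow> g \<in> powers_ideal d L \<Longrightarrow> f + g \<in> powers_ideal d L"
  and powers_ideal_0: "0 \<in> powers_ideal d L"
proof -
  interpret M: module "(*) :: ('a, 'b) mpoly \<Rightarrow> _ \<Rightarrow> _" by (rule module_self)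
  show "f \<in> powers_ideal d L \<Longrightarrow> p * f \<in> powers_ideal d L"
    "f \<in> powers_ideal d L \<Longrightarrow> g \<in> powers_ideal d L \<Longrightarrow> f + g \<in> powers_ideal d L"
    "0 \<in> powers_ideal d L"
    unfolding ideal_gen_def by (rule M.span_scale M.span_add M.span_zero; assumption?)+
qed

lemma power_ideal_subset: "f \<in> power_ideal d \<Longrightarrow> f \<in> powers_ideal d L"
  unfolding mem_powers_ideal_iff by (intro exI[of _ 0]) simp

text \<open>In terms of the eight points in \<open>P\<^sup>5\<close>: the parameters \<open>a\<^sub>i / b\<^sub>i\<close> on the rational normal curve are finite,
  nonzero and pairwise distinct.\<close>

definition general_pair :: "('n \<Rightarrow> 'k::field) \<Rightarrow> ('n \<Rightarrow> 'k) \<Rightarrow> bool" where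
  "general_pair a b \<longleftrightarrow> (\<forall>i. a i \<noteq> 0) \<and> (\<forall>i. b i \<noteq> 0) \<and> (\<forall>i j. i \<noteq> j \<longrightarrow> a i * b j \<noteq> a j * b i)"

text \<open>The coefficients of the squarefree cubic monomials in \<open>l f = L\<^sup>2 g\<close>, divided by the coefficients
  of \<open>L\<close>, form a \<open>triangle_system\<close>.\<close>

lemma quadrics_killed_by_general_form:
  fixes a b :: "'n::finite \<Rightarrow> 'k::field_char_0"
  assumes n: "CARD('n) = 7" and gen: "general_pair a b"
    and f: "f \<in> homogeneous 2" "linear_form b * f \<in> powers_ideal 2 (linear_form a)"
  obtains c where "\<And>i j. i \<noteq> j \<Longrightarrow> lookup f (unit_exp i + unit_exp j) = c * a i * a j"
proof -
  have a: "a i \<noteq> 0" and b: "b i \<noteq> 0" for i using gen by (auto simp: general_pair_def)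
  let ?L = "linear_form a"
  obtain g where g: "linear_form b * f - ?L ^ 2 * g \<in> power_ideal 2"
    using f(2) mem_powers_ideal_iff by blast
  define f' where "f' i j = lookup f (unit_exp i + unit_exp j) / (a i * a j)" for i j
  define h where "h i = 2 * lookup g (unit_exp i) / a i" for i
  have "triangle_system f' (\<lambda>i. b i / a i) h"
  proof
    show "inj (\<lambda>i. b i / a i)"
    proof (rule injI)
      fix i j assume "b i / a i = b j / a j"
      then have "a i * b j = a j * b i" using a by (simp add: field_simps)
      then show "i = j" using gen unfolding general_pair_def by blast
    qed
    show "f' i j = f' j i" for i j by (simp add: f'_def add.commute mult.commute)
    fix i j m :: 'n assume d: "distinct [i, j, m]"
    let ?e = "unit_exp i + unit_exp j + unit_exp m"
    have "\<forall>s. lookup ?e s < 2" using d by (auto simp: lookup_add lookup_single when_def)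
    then have "lookup (linear_form b * f) ?e = lookup (?L * (?L * g)) ?e"
      using g by (auto simp: power_ideal_def lookup_minus power2_eq_square mult.assoc)
    also have "\<dots> = 2 * (a i * a j * lookup g (unit_exp m) + a i * a m * lookup g (unit_exp j)
        + a j * a m * lookup g (unit_exp i))"
    proof -
      have ne: "j \<noteq> m" "i \<noteq> m" "i \<noteq> j" using d by auto
      show ?thesis
        unfolding lookup_linear_form_times_triple[OF d] lookup_linear_form_times_pair[OF ne(1)]
          lookup_linear_form_times_pair[OF ne(2)] lookup_linear_form_times_pair[OF ne(3)]
        by (simp add: algebra_simps)
    qed
    finally have "b i * lookup f (unit_exp j + unit_exp m) + b j * lookup f (unit_exp i + unit_exp m)
        + b m * lookup f (unit_exp i + unit_exp j)
        = 2 * (a i * a j * lookup g (unit_exp m) + a i * a m * lookup g (unit_exp j)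
        + a j * a m * lookup g (unit_exp i))"
      using d by (simp add: lookup_linear_form_times_triple)
    then show "b i / a i * f' j m + b j / a j * f' i m + b m / a m * f' i j = h i + h j + h m"
      using a[of i] a[of j] a[of m] by (simp add: f'_def h_def divide_simps) (simp add: algebra_simps)
  qed (use n a b in auto)
  then interpret triangle_system f' "\<lambda>i. b i / a i" h .
  obtain c where "\<And>i j. i \<noteq> j \<Longrightarrow> f' i j = c" by (rule constant_off_diagonal) blast
  then have "lookup f (unit_exp i + unit_exp j) = c * a i * a j" if "i \<noteq> j" for i j
  proof -
    have "lookup f (unit_exp i + unit_exp j) / (a i * a j) = c"
      using \<open>\<And>i j. i \<noteq> j \<Longrightarrow> f' i j = c\<close>[OF that] unfolding f'_def .
    then show ?thesis using a[of i] a[of j] by (simp add: divide_eq_eq mult.assoc)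
  qed
  then show ?thesis by (rule that)
qed

lemma injective_in_degree_2:
  fixes a b :: "'n::finite \<Rightarrow> 'k::field_char_0"
  assumes n: "CARD('n) = 7" and gen: "general_pair a b"
    and f: "f \<in> homogeneous 2" "linear_form b * f \<in> powers_ideal 2 (linear_form a)"
  shows "f \<in> powers_ideal 2 (linear_form a)"
proof -
  obtain c where c: "\<And>i j. i \<noteq> j \<Longrightarrow> lookup f (unit_exp i + unit_exp j) = c * a i * a j"
    by (rule quadrics_killed_by_general_form[OF n gen f]) blast
  have L: "lookup (linear_form a) (unit_exp i) = a i" for i
  proof -
    have "lookup (linear_form a * 1) (unit_exp i)
      = (\<Sum>s\<in>UNIV. if s = i then a i else 0)"
      unfolding lookup_linear_form_times by (rule sum.cong) (auto simp: lookup_single when_def lookup_one)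
    then show ?thesis by simp
  qed
  have "f - linear_form a ^ 2 * Const (c / 2) \<in> power_ideal 2"
    unfolding power_ideal_def
  proof (intro CollectI allI impI)
    fix m :: "'n \<Rightarrow>\<^sub>0 nat" assume m: "\<forall>i. lookup m i < 2"
    have "linear_form a ^ 2 * Const (c / 2) \<in> homogeneous 2"
      using homogeneous_mult[OF homogeneous_linear_form_power[of a 2], of "Const (c / 2)" 0] graded_part_Const[of "c / 2"]
      by simp
    then have hom: "f - linear_form a ^ 2 * Const (c / 2) \<in> homogeneous 2" by (intro graded_part_diff f(1))
    show "lookup (f - linear_form a ^ 2 * Const (c / 2)) m = 0"
    proof (cases "mdegree m = 2")
      case True
      then obtain i j where ij: "i \<noteq> j" "m = unit_exp i + unit_exp j" using squarefree_degree_2E m by metis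
      have "lookup (Const (c / 2) * (linear_form a * linear_form a)) m = c * a i * a j"
        unfolding ij(2) lookup_Const_times lookup_linear_form_times_pair[OF ij(1)] L by simp
      then show ?thesis
        using c[OF ij(1)] by (simp add: lookup_minus ij(2) power2_eq_square mult.commute mult.left_commute)
    next
      case False
      then show ?thesis using hom unfolding homogeneous_iff by blast
    qed
  qed
  then show ?thesis unfolding mem_powers_ideal_iff by blast
qed

text \<open>A linear form killed by \<open>l\<close> gives quadrics \<open>x\<^sub>k f\<close> killed by \<open>l\<close>. The squarefree monomials
  without \<open>x\<^sub>k\<close> do not occur in them, so the constant \<open>c\<close> of \<open>quadrics_killed_by_general_form\<close> is zero.\<close>

lemma injective_in_degree_1:
  fixes a b :: "'n::finite \<Rightarrow> 'k::field_char_0"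
  assumes n: "CARD('n) = 7" and gen: "general_pair a b"
    and f: "f \<in> homogeneous 1" "linear_form b * f \<in> powers_ideal 2 (linear_form a)"
  shows "f = 0"
proof -
  have a: "a i \<noteq> 0" for i using gen by (auto simp: general_pair_def)
  have zero: "lookup f (unit_exp j) = 0" for j
  proof -
    have "card (UNIV - {j}) = 6" using n by (simp add: card_Diff_singleton)
    then obtain T where "T \<subseteq> UNIV - {j}" "card T = 2"
      using obtain_subset_with_card_n[of 2 "UNIV - {j}"] by auto
    then obtain k i where ki: "k \<noteq> j" "i \<noteq> j" "k \<noteq> i" by (auto simp: card_2_iff)
    have "Var k * f \<in> homogeneous 2"
      using homogeneous_mult[OF _ f(1), of "Var k" 1] graded_part_Var[of k] by (simp add: eval_nat_numeral)
    moreover have "linear_form b * (Var k * f) \<in> powers_ideal 2 (linear_form a)"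
      using powers_ideal_mult[OF f(2), of "Var k"] by (simp add: mult.left_commute)
    ultimately obtain c where c: "\<And>i j. i \<noteq> j \<Longrightarrow> lookup (Var k * f) (unit_exp i + unit_exp j) = c * a i * a j"
      by (rule quadrics_killed_by_general_form[OF n gen]) blast
    have "lookup (Var k * f) (unit_exp i + unit_exp j) = 0"
      using ki by (simp add: lookup_Var_times lookup_add lookup_single when_def)
    then have "c = 0" using c[OF ki(2)] a by simp
    then show ?thesis using c[of j k] ki by simp
  qed
  show ?thesis
  proof (rule poly_mapping_eqI, rule ccontr)
    fix m assume "lookup f m \<noteq> lookup 0 m"
    then have "mdegree m = Suc 0" "lookup f m \<noteq> 0" using f(1) unfolding homogeneous_iff by auto
    then show False using zero mdegree_0E mdegree_SucE by (metis add_0)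
  qed
qed

lemma injective_in_degree_0:
  fixes a b :: "'n::finite \<Rightarrow> 'k::field_char_0"
  assumes gen: "general_pair a b"
    and f: "f \<in> homogeneous 0" "linear_form b * f \<in> powers_ideal 2 (linear_form a)"
  shows "f = 0"
proof -
  have hom: "linear_form b * f \<in> homogeneous 1"
    using homogeneous_mult[OF _ f(1), of "linear_form b" 1] graded_part_linear_form[of b] by simp
  moreover have "linear_form a \<in> homogeneous 1" using graded_part_linear_form[of a] by simp
  ultimately have J: "linear_form b * f \<in> power_ideal 2"
    using mem_powers_ideal_homogeneous[OF _ _ f(2)] by (metis diff_zero mult_zero_right one_less_numeral_iff semiring_norm(76))
  fix i :: 'n
  have "lookup (linear_form b * f) (unit_exp i) = (\<Sum>s\<in>UNIV. if s = i then b i * lookup f 0 else 0)"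
    unfolding lookup_linear_form_times by (rule sum.cong) (auto simp: lookup_single when_def)
  then have "b i * lookup f 0 = 0"
    using J by (auto simp: power_ideal_def lookup_single when_def)
  then have "lookup f 0 = 0" using gen by (auto simp: general_pair_def)
  then show ?thesis
    using f(1) unfolding homogeneous_iff by (intro poly_mapping_eqI) (metis lookup_zero mdegree_0E)
qed

section \<open>Surjectivity for squares\<close>

text \<open>Taking complements in the six remaining variables.\<close>

lemma card_squarefree_complement:
  fixes s :: "'n::finite"
  assumes "CARD('n) = 7"
  shows "card {m \<in> box_monomials 2 4. lookup m s = 0} \<le> card {m \<in> box_monomials 2 2. lookup m s = 0}"
proof -
  define \<nu> :: "'n \<Rightarrow>\<^sub>0 nat" where "\<nu> = (\<Sum>i\<in>UNIV - {s}. unit_exp i)"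
  have \<nu>: "lookup \<nu> i = (if i = s then 0 else 1)" for i
    unfolding \<nu>_def by (simp add: lookup_sum lookup_single when_def)
  have le: "lookup m i \<le> lookup \<nu> i" if "m \<in> box_monomials 2 4" "lookup m s = 0" for m i
  proof -
    have "lookup m i < 2" using that(1) by (auto simp: box_monomials_def)
    then show ?thesis using that(2) by (auto simp: \<nu>)
  qed
  show ?thesis
  proof (rule card_inj_on_le)
    show "inj_on (\<lambda>m. \<nu> - m) {m \<in> box_monomials 2 4. lookup m s = 0}"
    proof (rule inj_onI, rule poly_mapping_eqI)
      fix m m' :: "'n \<Rightarrow>\<^sub>0 nat" and i
      assume "m \<in> {m \<in> box_monomials 2 4. lookup m s = 0}" "m' \<in> {m \<in> box_monomials 2 4. lookup m s = 0}"
        and eq: "\<nu> - m = \<nu> - m'"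
      then have "lookup m i \<le> lookup \<nu> i" "lookup m' i \<le> lookup \<nu> i" using le by auto
      moreover have "lookup \<nu> i - lookup m i = lookup \<nu> i - lookup m' i"
        using arg_cong[OF eq, of "\<lambda>x. lookup x i"] by (simp add: lookup_minus)
      ultimately show "lookup m i = lookup m' i" by linarith
    qed
    show "(\<lambda>m. \<nu> - m) ` {m \<in> box_monomials 2 4. lookup m s = 0} \<subseteq> {m \<in> box_monomials 2 2. lookup m s = 0}"
    proof (rule image_subsetI)
      fix m :: "'n \<Rightarrow>\<^sub>0 nat" assume m: "m \<in> {m \<in> box_monomials 2 4. lookup m s = 0}"
      have "(\<nu> - m) + m = \<nu>"
        by (rule poly_mapping_eqI) (use le m in \<open>auto simp: lookup_add lookup_minus\<close>)
      then have "mdegree (\<nu> - m) + mdegree m = mdegree \<nu>" using mdegree_add by metis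
      moreover have "mdegree \<nu> = 6"
        using assms by (simp add: mdegree_def \<nu> sum.If_cases Compl_eq_Diff_UNIV card_Diff_singleton)
      moreover have "mdegree m = 4" using m by (auto simp: box_monomials_def)
      ultimately have "mdegree (\<nu> - m) = 2" by simp
      then show "\<nu> - m \<in> {m \<in> box_monomials 2 2. lookup m s = 0}"
        by (auto simp: box_monomials_def lookup_minus \<nu>)
    qed
    show "finite {m \<in> box_monomials 2 2. lookup m s = 0}"
      using finite_box_monomials by (rule finite_subset[rotated]) auto
  qed
qed

lemma homogeneous_component_of_multiple:
  assumes "h \<in> homogeneous (Suc t)" "h - linear_form b * f \<in> powers_ideal d (linear_form a)"
  shows "h - linear_form b * component t f \<in> powers_ideal d (linear_form a)"
proof -
  obtain g where "h - linear_form b * f - linear_form a ^ d * g \<in> power_ideal d"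
    using assms(2) mem_powers_ideal_iff by blast
  then have *: "component (Suc t) (h - linear_form b * f - linear_form a ^ d * g) \<in> power_ideal d"
    by (rule power_ideal_restrict)
  have "component (Suc t) (linear_form b * f) = linear_form b * component t f"
    using component_mult[OF homogeneous_linear_form_power[of b 1], of "Suc t" f] by simp
  moreover have "component (Suc t) (linear_form a ^ d * g)
      = linear_form a ^ d * (if d \<le> Suc t then component (Suc t - d) g else 0)"
    using component_mult[OF homogeneous_linear_form_power[of a d], of "Suc t" g] by simp
  ultimately show ?thesis
    using * assms(1) unfolding mem_powers_ideal_iff
    by (auto simp: restrict_monomials_diff component_of_homogeneous)
qed

text \<open>The preimage in \<open>R\<close> of the ideal generated by \<open>l\<close> in \<open>A\<close>. It is an ideal, so the question
  whether it contains all forms of some degree reduces to monomials.\<close>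

definition multiples_mod :: "('n::finite, 'k::field) mpoly \<Rightarrow> ('n, 'k) mpoly \<Rightarrow> ('n, 'k) mpoly set" where
  "multiples_mod l L = {h. \<exists>f. h - l * f \<in> powers_ideal 2 L}"

lemma multiples_mod_add: "h \<in> multiples_mod l L \<Longrightarrow> h' \<in> multiples_mod l L \<Longrightarrow> h + h' \<in> multiples_mod l L"
proof -
  assume "h \<in> multiples_mod l L" "h' \<in> multiples_mod l L"
  then obtain f f' where "h - l * f \<in> powers_ideal 2 L" "h' - l * f' \<in> powers_ideal 2 L"
    unfolding multiples_mod_def by blast
  from powers_ideal_add[OF this] have "(h + h') - l * (f + f') \<in> powers_ideal 2 L"
    by (simp add: algebra_simps)
  then show ?thesis unfolding multiples_mod_def by blast
qed

lemma multiples_mod_mult: "h \<in> multiples_mod l L \<Longrightarrow> p * h \<in> multiples_mod l L"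
proof -
  assume "h \<in> multiples_mod l L"
  then obtain f where "h - l * f \<in> powers_ideal 2 L" unfolding multiples_mod_def by blast
  from powers_ideal_mult[OF this, of p] have "p * h - l * (p * f) \<in> powers_ideal 2 L"
    by (simp add: algebra_simps)
  then show ?thesis unfolding multiples_mod_def by blast
qed

lemma ideal_subset_multiples_mod: "h \<in> powers_ideal 2 L \<Longrightarrow> h \<in> multiples_mod l L"
  unfolding multiples_mod_def by (intro CollectI exI[of _ 0]) simp

lemma multiple_in_multiples_mod: "l * f \<in> multiples_mod l L"
  unfolding multiples_mod_def by (intro CollectI exI[of _ f]) (unfold diff_self, rule powers_ideal_0)

lemma multiples_mod_sum: "(\<And>i. i \<in> A \<Longrightarrow> f i \<in> multiples_mod l L) \<Longrightarrow> sum f A \<in> multiples_mod l L"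
  by (induction A rule: infinite_finite_induct)
     (auto intro: multiples_mod_add ideal_subset_multiples_mod powers_ideal_0)

lemma power_in_powers_ideal: "L ^ d \<in> powers_ideal d L"
  unfolding mem_powers_ideal_iff by (intro exI[of _ 1]) simp

text \<open>Subtracting a multiple of \<open>l\<close> from \<open>L\<close> gives a linear form \<open>c\<close> in the variables other than \<open>x\<^sub>s\<close>, all
  of whose coefficients are nonzero, and \<open>c\<^sup>2\<close> is zero modulo \<open>l\<close> and \<open>L\<^sup>2\<close>. By the strong Lefschetz property in
  six variables \<open>c\<^sup>2\<close> maps the span of the squarefree quadratic monomials injectively to that of the
  squarefree quartic ones. Both have dimension 15, so every quartic is hit.\<close>

lemma squarefree_quartic_without_variable:
  fixes a b :: "'n::finite \<Rightarrow> 'k::field_char_0"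
  assumes n: "CARD('n) = 7" and gen: "general_pair a b"
    and m: "m \<in> box_monomials 2 4" "lookup m s = 0"
  shows "power_product m \<in> multiples_mod (linear_form b) (linear_form a)"
proof -
  define c where "c i = a i - a s / b s * b i" for i
  have c_eq: "linear_form c = linear_form a - Const (a s / b s) * linear_form b"
    by (simp add: linear_form_def c_def Const_diff Const_mult sum_subtractf left_diff_distrib
        sum_distrib_left mult.assoc)
  have c: "c i \<noteq> 0 \<longleftrightarrow> i \<noteq> s" for i
    using gen by (cases "i = s") (auto simp: c_def general_pair_def field_simps)
  have supp: "support_degree c m + lookup m s = mdegree m" for m
  proof -
    have "mdegree m = (\<Sum>i\<in>UNIV - {s}. lookup m i) + lookup m s"
      unfolding mdegree_def by (subst sum.remove[of _ s]) auto
    moreover have "{i. c i \<noteq> 0} = UNIV - {s}" using c by auto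
    ultimately show ?thesis by (simp add: support_degree_def)
  qed
  have card_c: "card {i. c i \<noteq> 0} = 6"
  proof -
    have "{i. c i \<noteq> 0} = UNIV - {s}" using c by auto
    then show ?thesis using n by (simp add: card_Diff_singleton)
  qed
  let ?X = "{m \<in> box_monomials 2 2. lookup m s = 0} :: ('n \<Rightarrow>\<^sub>0 nat) set"
  let ?Y = "{m \<in> box_monomials 2 4. lookup m s = 0} :: ('n \<Rightarrow>\<^sub>0 nat) set"
  define T where "T h = reduce 2 (linear_form c ^ 2 * h)" for h
  have restrict_Const: "restrict_monomials P (Const c * f) = Const c * restrict_monomials P f"
    for P c and f :: "('n, 'k) mpoly"
    by (rule poly_mapping_eqI) simp
  have lin: "Vector_Spaces.linear (\<lambda>c. (*) (Const c)) (\<lambda>c. (*) (Const c)) T"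
  proof (rule Vector_Spaces.linear_iff[THEN iffD2], intro conjI allI)
    show "T (x + y) = T x + T y" for x y
      by (simp add: T_def distrib_left restrict_monomials_add)
    show "T (Const c * x) = Const c * T x" for c x
      by (simp add: T_def mult.left_commute[of _ "Const c"] restrict_Const)
  qed (rule vector_space_poly)+
  have fin: "finite ?X" "finite ?Y"
    using finite_box_monomials by (auto intro: finite_subset[rotated])
  have deg: "support_degree c k = Suc (Suc e)"
    if "\<And>m. lookup h m \<noteq> 0 \<Longrightarrow> support_degree c m = e" "lookup (linear_form c ^ 2 * h) k \<noteq> 0" for h k e
    using support_degree_linear_form_times[of "linear_form c * h" c "Suc e" k]
      support_degree_linear_form_times[of h c e] that by (simp add: power2_eq_square mult.assoc)
  have TY: "T ` power_product ` ?X \<subseteq> poly.span (power_product ` ?Y)"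
  proof (clarsimp, rule in_span_monomials)
    fix x k assume x: "x \<in> box_monomials 2 2" "lookup x s = 0" and k: "lookup (T (power_product x)) k \<noteq> 0"
    have hom: "(power_product x :: ('n, 'k) mpoly) \<in> homogeneous 2"
      using x unfolding homogeneous_iff by (auto simp: box_monomials_def lookup_single when_def split: if_splits)
    have k': "\<forall>i. lookup k i < 2" "lookup (linear_form c ^ 2 * power_product x) k \<noteq> 0"
      using k by (auto simp: T_def split: if_splits)
    have "mdegree k = 4"
      using homogeneous_mult[OF homogeneous_linear_form_power[of c 2] hom] k'(2)
      unfolding homogeneous_iff by auto
    moreover have "support_degree c k = Suc (Suc 2)"
    proof (rule deg[OF _ k'(2)])
      show "support_degree c m = 2" if "lookup (power_product x :: ('n, 'k) mpoly) m \<noteq> 0" for m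
        using that x supp[of x] by (auto simp: lookup_single when_def box_monomials_def split: if_splits)
    qed
    ultimately show "k \<in> ?Y" using supp[of k] k'(1) by (auto simp: box_monomials_def)
  qed
  have "power_product m \<in> poly.span (T ` power_product ` ?X)"
  proof (rule poly_poly_injective_imp_spanning[OF lin independent_monomials _ _ TY])
    have "card (power_product ` M :: ('n, 'k) mpoly set) = card M" for M :: "('n \<Rightarrow>\<^sub>0 nat) set"
      using inj_power_product[where 'n = 'n and 'k = 'k] by (intro card_image) (auto intro: inj_on_subset)
    then show "card (power_product ` ?Y :: ('n, 'k) mpoly set) \<le> card (power_product ` ?X :: ('n, 'k) mpoly set)"
      using card_squarefree_complement[OF n] by simp
    show "power_product m \<in> poly.span (power_product ` ?Y)" using m by (auto intro: poly.span_base)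
    fix h :: "('n, 'k) mpoly" assume h: "h \<in> poly.span (power_product ` ?X)" "T h = 0"
    have "h \<in> power_ideal 2"
    proof (rule strong_lefschetz_monomial_complete_intersection[where a = c and e = 2 and s = 2])
      show "support_degree c k = 2" if "lookup h k \<noteq> 0" for k
        using span_monomials_supported[OF h(1) that] supp[of k] by (auto simp: box_monomials_def)
      show "linear_form c ^ 2 * h \<in> power_ideal 2"
        using h(2) by (simp add: T_def reduce_eq_0_iff)
    qed (simp_all add: card_c)
    then show "h = 0"
      using span_monomials_supported[OF h(1)]
      by (intro poly_mapping_eqI) (auto simp: power_ideal_def box_monomials_def)
  qed (use fin in auto)
  moreover have "T ` power_product ` ?X \<subseteq> multiples_mod (linear_form b) (linear_form a)"
  proof -
    have "T h \<in> multiples_mod (linear_form b) (linear_form a)" for h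
    proof -
      let ?l = "linear_form b" and ?L = "linear_form a" and ?\<tau> = "Const (a s / b s)"
      have "linear_form c ^ 2 = ?L ^ 2 + ?l * (?\<tau> * ?\<tau> * ?l - 2 * ?\<tau> * ?L)"
        unfolding c_eq by (simp add: power2_eq_square algebra_simps)
      then have "linear_form c ^ 2 \<in> multiples_mod ?l ?L"
        using multiples_mod_add[OF ideal_subset_multiples_mod[OF power_in_powers_ideal]
            multiple_in_multiples_mod] by (simp only:)
      then have "h * linear_form c ^ 2 \<in> multiples_mod ?l ?L" by (rule multiples_mod_mult)
      moreover have "- (linear_form c ^ 2 * h - T h) \<in> multiples_mod ?l ?L"
        unfolding T_def
        by (intro ideal_subset_multiples_mod power_ideal_subset power_ideal_uminus reduce_diff_in_power_ideal)
      ultimately have "h * linear_form c ^ 2 + - (linear_form c ^ 2 * h - T h) \<in> multiples_mod ?l ?L"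
        by (rule multiples_mod_add)
      then show ?thesis by (simp add: mult.commute)
    qed
    then show ?thesis by blast
  qed
  moreover have "poly.subspace (multiples_mod (linear_form b) (linear_form a))"
    by (rule poly.subspaceI)
       (auto intro: multiples_mod_add multiples_mod_mult ideal_subset_multiples_mod powers_ideal_0)
  ultimately show ?thesis using poly.span_minimal by blast
qed

lemma power_product_add_unit_exp: "power_product (m + unit_exp i) = Var i * power_product m"
  by (simp add: Var_def mult_single add.commute)

text \<open>Modulo \<open>l\<close>, one occurrence of \<open>x\<^sub>s\<close> can be replaced by a combination of the other variables.\<close>

lemma quartics_are_multiples:
  fixes a b :: "'n::finite \<Rightarrow> 'k::field_char_0"
  assumes n: "CARD('n) = 7" and gen: "general_pair a b" and m: "mdegree m = 4"
  shows "power_product m \<in> multiples_mod (linear_form b) (linear_form a)"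
proof -
  fix s :: 'n
  have nonsquarefree: "power_product k \<in> multiples_mod (linear_form b) (linear_form a)"
    if "\<not> (\<forall>i. lookup k i < 2)" for k
  proof -
    have "power_product k \<in> power_ideal 2" using that by (auto simp: power_ideal_def lookup_single when_def)
    then show ?thesis by (intro ideal_subset_multiples_mod power_ideal_subset)
  qed
  have without: "power_product k \<in> multiples_mod (linear_form b) (linear_form a)"
    if "mdegree k = 4" "lookup k s = 0" for k
    using nonsquarefree[of k] squarefree_quartic_without_variable[OF n gen, of k s] that
    by (auto simp: box_monomials_def)
  show ?thesis
  proof (cases "lookup m s = 1")
    case True
    define k where "k = m - unit_exp s"
    have mk: "m = k + unit_exp s" using exponent_split[of m s] True by (simp add: k_def add.commute)
    have k: "mdegree k = 3" "lookup k s = 0"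
      using m True unfolding mk mdegree_add by (simp_all add: lookup_add)
    have "linear_form b = Const (b s) * Var s + (\<Sum>i\<in>UNIV - {s}. Const (b i) * Var i)"
      unfolding linear_form_def by (rule sum.remove) auto
    then have "Const (b s) * power_product m = linear_form b * power_product k
        + (\<Sum>i\<in>UNIV - {s}. Const (- b i) * power_product (k + unit_exp i))"
      unfolding mk power_product_add_unit_exp
      by (simp add: distrib_right sum_distrib_right Const_minus sum_negf mult.assoc)
    moreover have "\<dots> \<in> multiples_mod (linear_form b) (linear_form a)"
    proof (intro multiples_mod_add multiple_in_multiples_mod multiples_mod_sum multiples_mod_mult without)
      fix i assume "i \<in> UNIV - {s}"
      then show "mdegree (k + unit_exp i) = 4" "lookup (k + unit_exp i) s = 0"
        using k by (simp_all add: mdegree_add lookup_add lookup_single when_def)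
    qed
    ultimately have "Const (inverse (b s)) * (Const (b s) * power_product m) \<in> multiples_mod (linear_form b) (linear_form a)"
      using multiples_mod_mult by metis
    moreover have "b s \<noteq> 0" using gen by (simp add: general_pair_def)
    ultimately show ?thesis by (simp flip: mult.assoc Const_mult)
  next
    case False
    then show ?thesis
      using without[OF m] nonsquarefree[of m] by (metis One_nat_def less_2_cases)
  qed
qed

lemma surjective_from_degree_3:
  fixes a b :: "'n::finite \<Rightarrow> 'k::field_char_0"
  assumes n: "CARD('n) = 7" and gen: "general_pair a b"
    and t: "3 \<le> t" and h: "h \<in> homogeneous (Suc t)"
  shows "\<exists>f\<in>homogeneous t. h - linear_form b * f \<in> powers_ideal 2 (linear_form a)"
proof -
  have mono: "power_product m \<in> multiples_mod (linear_form b) (linear_form a)"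
    if "mdegree m = 4 + e" for m e
    using that
  proof (induction e arbitrary: m)
    case 0
    then show ?case using quartics_are_multiples[OF n gen] by simp
  next
    case (Suc e)
    then have "mdegree m = Suc (4 + e)" by simp
    then obtain i m' where "m = m' + unit_exp i" "mdegree m' = 4 + e" by (rule mdegree_SucE)
    then show ?case using multiples_mod_mult[OF Suc.IH] by (simp only: power_product_add_unit_exp)
  qed
  have "(\<Sum>m\<in>keys h. Const (lookup h m) * power_product m) \<in> multiples_mod (linear_form b) (linear_form a)"
  proof (intro multiples_mod_sum multiples_mod_mult)
    fix m assume "m \<in> keys h"
    then have "mdegree m = 4 + (t - 3)" using h t by (auto simp: graded_part_def)
    then show "power_product m \<in> multiples_mod (linear_form b) (linear_form a)" by (rule mono)
  qed
  then have "h \<in> multiples_mod (linear_form b) (linear_form a)"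
    by (simp only: Const_times_power_product sum_of_monomials)
  then obtain f where "h - linear_form b * f \<in> powers_ideal 2 (linear_form a)"
    unfolding multiples_mod_def by blast
  then show ?thesis
    using homogeneous_component_of_multiple[OF h] component_homogeneous by blast
qed

theorem maximal_rank_for_squares:
  fixes a b :: "'n::finite \<Rightarrow> 'k::field_char_0" and t :: int
  assumes n: "CARD('n) = 7" and gen: "general_pair a b"
  defines "I \<equiv> powers_ideal 2 (linear_form a)" and "l \<equiv> linear_form b"
  shows "inj_on (quot_mult I l) (quot_part I t) \<or> quot_mult I l ` quot_part I t = quot_part I (t + 1)"
proof (cases "t \<le> 2")
  case True
  have "f \<in> I" if f: "f \<in> graded_part t" "l * f \<in> I" for f
  proof -
    consider "t < 0" | "t = int 0" | "t = int 1" | "t = int 2" using True by linarith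
    then show ?thesis
    proof cases
      case 1
      then have "f = 0" using f(1) by (auto simp: graded_part_def)
      then show ?thesis unfolding I_def by (simp only: powers_ideal_0)
    next
      case 2
      then have "f = 0" using f injective_in_degree_0[OF gen] unfolding I_def l_def by blast
      then show ?thesis unfolding I_def by (simp only: powers_ideal_0)
    next
      case 3
      then have "f = 0" using f injective_in_degree_1[OF n gen] unfolding I_def l_def by blast
      then show ?thesis unfolding I_def by (simp only: powers_ideal_0)
    next
      case 4
      then show ?thesis using f injective_in_degree_2[OF n gen] unfolding I_def l_def by blast
    qed
  qed
  then show ?thesis unfolding I_def inj_on_quot_mult_iff by blast
next
  case False
  define e where "e = nat t"
  have e: "t = int e" "3 \<le> e" "t + 1 = int (Suc e)" using False by (auto simp: e_def)
  have l: "l \<in> graded_part 1" unfolding l_def by (rule graded_part_linear_form)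
  have "quot_mult I l ` quot_part I t = quot_part I (t + 1)"
    unfolding I_def quot_mult_image_eq_iff[OF l] unfolding l_def e(3) unfolding e(1)
    using surjective_from_degree_3[OF n gen e(2)] by blast
  then show ?thesis by blast
qed

section \<open>General linear forms\<close>

text \<open>On a line a polynomial function is a univariate polynomial, which has only finitely many zeros
  unless it vanishes; this makes the intersection of two nonempty open sets nonempty.\<close>

lemma eval_mpoly_on_line: "\<exists>P :: 'k::field poly. \<forall>s. poly P s = eval_mpoly (\<lambda>i. x i + s * y i) f"
proof -
  define P where "P = (\<Sum>m\<in>keys f. Polynomial.smult (lookup f m) (\<Prod>i\<in>UNIV. [:x i, y i:] ^ lookup m i))"
  have "poly P s = eval_mpoly (\<lambda>i. x i + s * y i) f" for s
    by (simp add: P_def eval_mpoly_def poly_sum poly_prod)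
  then show ?thesis by blast
qed

lemma zariski_open_Int_nonempty:
  fixes U V :: "('n::finite \<Rightarrow> 'k::field_char_0) set"
  assumes "zariski_open U" "zariski_open V" "U \<noteq> {}" "V \<noteq> {}"
  shows "U \<inter> V \<noteq> {}"
proof -
  obtain F G :: "('n, 'k) mpoly set" where FG: "U = - {a. \<forall>f\<in>F. eval_mpoly a f = 0}"
    "V = - {a. \<forall>f\<in>G. eval_mpoly a f = 0}"
    using assms(1,2) unfolding zariski_open_def by blast
  obtain x f where f: "f \<in> F" "eval_mpoly x f \<noteq> 0" using assms(3) FG(1) by blast
  obtain y g where g: "g \<in> G" "eval_mpoly y g \<noteq> 0" using assms(4) FG(2) by blast
  define z where "z s i = x i + s * (y i - x i)" for s i
  obtain P :: "'k poly" where P: "\<And>s. poly P s = eval_mpoly (z s) f"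
    using eval_mpoly_on_line[of x "\<lambda>i. y i - x i" f] unfolding z_def by blast
  obtain Q :: "'k poly" where Q: "\<And>s. poly Q s = eval_mpoly (z s) g"
    using eval_mpoly_on_line[of x "\<lambda>i. y i - x i" g] unfolding z_def by blast
  have "z 0 = x" "z 1 = y" by (auto simp: z_def)
  then have "poly P 0 \<noteq> 0" "poly Q 1 \<noteq> 0" using f(2) g(2) by (simp_all add: P Q)
  then have "P * Q \<noteq> 0" by auto
  then have "finite {s. poly (P * Q) s = 0}" by (rule poly_roots_finite)
  then obtain s where "poly (P * Q) s \<noteq> 0"
    using ex_new_if_finite[OF infinite_UNIV_char_0] by blast
  then have "eval_mpoly (z s) f \<noteq> 0" "eval_mpoly (z s) g \<noteq> 0" by (auto simp: P Q)
  then have "z s \<in> U \<inter> V" using f(1) g(1) unfolding FG by blast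
  then show ?thesis by blast
qed

lemma zariski_open_nonvanishing: "zariski_open {a. eval_mpoly a f \<noteq> 0}"
  unfolding zariski_open_def by (intro exI[of _ "{f}"]) auto

lemma zariski_open_general_pair:
  fixes a :: "'n::finite \<Rightarrow> 'k::field_char_0"
  assumes a: "\<And>i. a i \<noteq> 0"
  shows "zariski_open {b. general_pair a b}" "{b. general_pair a b} \<noteq> {}"
proof -
  define g where "g = (\<Prod>i\<in>UNIV. Var i) *
    (\<Prod>i\<in>UNIV. \<Prod>j\<in>UNIV - {i}. Const (a i) * Var j - Const (a j) * Var i)"
  have "{b. general_pair a b} = {b. eval_mpoly b g \<noteq> 0}"
    using a by (auto simp: general_pair_def g_def eval_mpoly_mult eval_mpoly_prod eval_mpoly_diff)
  then show "zariski_open {b. general_pair a b}" using zariski_open_nonvanishing by metis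
  obtain e :: "'n \<Rightarrow> nat" where e: "inj e" using finite_imp_inj_to_nat_seg[of "UNIV :: 'n set"] by auto
  have "general_pair a (\<lambda>i. a i * of_nat (Suc (e i)))"
    using a injD[OF e] by (auto simp: general_pair_def simp del: of_nat_Suc)
  then show "{b. general_pair a b} \<noteq> {}" by blast
qed

theorem theorem5p5:
  fixes d :: nat
  assumes "d > 0"
  shows "for_general_linear_form (\<lambda>L :: (7, 'k::field_char_0) mpoly.
    let I = ideal_gen (range (\<lambda>i. Var i ^ d) \<union> {L ^ d})
    in (d = 2 \<longrightarrow> wlp I) \<and> (d \<ge> 4 \<longrightarrow> \<not> wlp I))"
proof -
  let ?U = "{a :: 7 \<Rightarrow> 'k. eval_mpoly a (\<Prod>i\<in>UNIV. Var i) \<noteq> 0}"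
  have U: "?U = {a. \<forall>i. a i \<noteq> 0}" by (auto simp: eval_mpoly_prod)
  have "wlp (powers_ideal 2 (linear_form a))" if "a \<in> ?U" for a
    unfolding wlp_def for_general_linear_form_def
  proof (intro exI[of _ "{b. general_pair a b}"] conjI ballI allI)
    show "zariski_open {b. general_pair a b}" "{b. general_pair a b} \<noteq> {}"
      using zariski_open_general_pair[of a] that unfolding U by auto
  qed (use maximal_rank_for_squares[of a] in auto)
  moreover have "\<not> wlp (powers_ideal d (linear_form a))" if "a \<in> ?U" "d \<ge> 4" for a
  proof
    assume "wlp (powers_ideal d (linear_form a))"
    define I where "I = powers_ideal d (linear_form a)"
    from \<open>wlp _\<close> have "\<exists>V. zariski_open V \<and> V \<noteq> {} \<and> (\<forall>b\<in>V. \<forall>t.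
        inj_on (quot_mult I (linear_form b)) (quot_part I t) \<or>
        quot_mult I (linear_form b) ` quot_part I t = quot_part I (t + 1))"
      unfolding wlp_def for_general_linear_form_def I_def[symmetric] .
    then obtain V where V: "zariski_open V" "V \<noteq> {}"
      and max_rank: "\<forall>b\<in>V. \<forall>t. inj_on (quot_mult I (linear_form b)) (quot_part I t) \<or>
        quot_mult I (linear_form b) ` quot_part I t = quot_part I (t + 1)"
      by (elim exE conjE)
    have a: "a i \<noteq> 0" for i using that(1) unfolding U by simp
    have "V \<inter> {b. general_pair a b} \<noteq> {}"
      by (rule zariski_open_Int_nonempty[OF V(1) zariski_open_general_pair(1)[OF a] V(2)
            zariski_open_general_pair(2)[OF a]])
    then obtain b where b: "b \<in> V" "general_pair a b" by blast
    have "\<exists>t. \<not> inj_on (quot_mult I (linear_form b)) (quot_part I t)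
        \<and> quot_mult I (linear_form b) ` quot_part I t \<noteq> quot_part I (t + 1)"
      unfolding I_def using b(2) that(2) by (intro fails_maximal_rank) (auto simp: general_pair_def)
    then obtain t where "\<not> inj_on (quot_mult I (linear_form b)) (quot_part I t)"
      "quot_mult I (linear_form b) ` quot_part I t \<noteq> quot_part I (t + 1)" by (elim exE conjE)
    with max_rank[THEN bspec, OF b(1), THEN spec, of t] show False by (elim disjE) simp_all
  qed
  moreover have "zariski_open ?U" by (rule zariski_open_nonvanishing)
  moreover have "?U \<noteq> {}" unfolding U by (auto intro: exI[of _ "\<lambda>_. 1"])
  ultimately show ?thesis
    unfolding for_general_linear_form_def Let_def by (intro exI[of _ ?U]) auto
qed

end
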